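(* Let $k\ge 0$ be an integer. Let $\mathcal F$ be a family of open sets of a topological space (or a finite family of subcomplexes of a cell complex) such that for every nonempty subfamily $\mathcal G\subseteq\mathcal F$ the intersection $\bigcap\mathcal G$ is empty or $(k-|\mathcal G|+1)$-connected. Let $X=\bigcup\mathcal F$. Then $H_n(X)\cong H_n(N(\mathcal F))$ for all $n\le k$.
   Context: $H_n$ denotes singular homology with integer coefficients. For a family $\mathcal G$ of sets, $\bigcap\mathcal G$ is the intersection of its members and $|\mathcal G|$ is the number of its members. The nerve $N(\mathcal F)$ is the simplicial complex on the vertex set $\mathcal F$ whose simplices are all finite nonempty $\sigma\subseteq\mathcal F$ with $\bigcap_{F\in\sigma}F\ne\emptyset$. For $m\ge -1$, a topological space $Y$ is $m$-connected if for every $l=-1,0,1,\dots,m$ each continuous map $f:S^l\to Y$ extends to a continuous map $\bar f:B^{l+1}\to Y$, where $S^{-1}=\emptyset$ and $B^0$ is a single point; thus $(-1)$-connected means nonempty and $0$-connected means pathwise connected. For $m<-1$, being $m$-connected imposes no condition. A cell complex is a CW-complex. *)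

theory Defs
  imports "HOL-Homology.Homology"
begin

text \<open>The index \<open>d\<close> is the dimension of the ambient Euclidean space: \<open>unit_sphere d\<close> is the
  sphere of dimension \<open>d - 1\<close> and \<open>unit_ball d\<close> is the closed ball of dimension \<open>d\<close>. Hence
  \<open>unit_sphere 0\<close> is the empty sphere of dimension \<open>-1\<close>, and \<open>unit_ball 0\<close> is a point.\<close>

definition unit_sphere :: "nat \<Rightarrow> (nat \<Rightarrow> real) topology"
  where "unit_sphere d = subtopology (Euclidean_space d) {x. (\<Sum>i<d. (x i)\<^sup>2) = 1}"

definition unit_ball :: "nat \<Rightarrow> (nat \<Rightarrow> real) topology"
  where "unit_ball d = subtopology (Euclidean_space d) {x. (\<Sum>i<d. (x i)\<^sup>2) \<le> 1}"

definition open_unit_ball :: "nat \<Rightarrow> (nat \<Rightarrow> real) topology"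
  where "open_unit_ball d = subtopology (Euclidean_space d) {x. (\<Sum>i<d. (x i)\<^sup>2) < 1}"

lemma unit_sphere_0: "topspace (unit_sphere 0) = {}"
  by (simp add: unit_sphere_def)

lemma unit_sphere_Suc: "unit_sphere (Suc n) = nsphere n"
  by (simp add: unit_sphere_def nsphere_def lessThan_Suc_atMost)

lemma unit_ball_0: "topspace (unit_ball 0) = {\<lambda>i. 0}"
  by (auto simp: unit_ball_def topspace_Euclidean_space)

text \<open>With \<open>l = d - 1\<close>, the condition ranges over all \<open>l\<close> with \<open>-1 \<le> l \<le> m\<close>; it is void for
  \<open>m < -1\<close>.\<close>

definition m_connected :: "int \<Rightarrow> 'a topology \<Rightarrow> bool"
  where "m_connected m Y \<longleftrightarrow>
    (\<forall>d::nat. int d - 1 \<le> m \<longrightarrow>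
      (\<forall>f. continuous_map (unit_sphere d) Y f \<longrightarrow>
        (\<exists>g. continuous_map (unit_ball d) Y g \<and> (\<forall>x\<in>topspace (unit_sphere d). g x = f x))))"

lemma m_connected_vacuous: "m < - 1 \<Longrightarrow> m_connected m Y"
  by (simp add: m_connected_def)

lemma m_connected_minus_one: "m_connected (- 1) Y \<longleftrightarrow> topspace Y \<noteq> {}"
proof -
  have eq: "int d - 1 \<le> - 1 \<longleftrightarrow> d = 0" for d
    by simp
  have sphere: "unit_sphere 0 = trivial_topology"
    using unit_sphere_0 by (simp add: null_topspace_iff_trivial)
  have ball: "(\<exists>g. continuous_map (unit_ball 0) Y g) \<longleftrightarrow> topspace Y \<noteq> {}"
  proof
    assume "\<exists>g. continuous_map (unit_ball 0) Y g"
    then obtain g where "continuous_map (unit_ball 0) Y g" ..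
    then have "g (\<lambda>i. 0) \<in> topspace Y"
      by (simp add: unit_ball_0 continuous_map_def Pi_iff)
    then show "topspace Y \<noteq> {}" by blast
  next
    assume "topspace Y \<noteq> {}"
    then obtain y where "y \<in> topspace Y" by blast
    then show "\<exists>g. continuous_map (unit_ball 0) Y g"
      by (intro exI [of _ "\<lambda>_. y"]) simp
  qed
  show ?thesis
    unfolding m_connected_def eq by (simp add: sphere ball)
qed

text \<open>A CW-structure on a space \<open>T\<close> is given by its set \<open>E\<close> of open cells and their dimensions.\<close>

definition characteristic_map ::
    "'a topology \<Rightarrow> nat \<Rightarrow> 'a set \<Rightarrow> ((nat \<Rightarrow> real) \<Rightarrow> 'a) \<Rightarrow> bool"
  where "characteristic_map T d e \<phi> \<longleftrightarrow>
    continuous_map (unit_ball d) T \<phi> \<and>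
    homeomorphic_map (open_unit_ball d) (subtopology T e) \<phi>"

definition cw_complex :: "'a topology \<Rightarrow> 'a set set \<Rightarrow> ('a set \<Rightarrow> nat) \<Rightarrow> bool"
  where "cw_complex T E cdim \<longleftrightarrow>
    Hausdorff_space T \<and>
    \<Union>E = topspace T \<and> disjoint E \<and>
    (\<forall>e\<in>E. \<exists>\<phi>. characteristic_map T (cdim e) e \<phi> \<and>
       (\<exists>C\<subseteq>E. finite C \<and> (\<forall>c\<in>C. cdim c < cdim e) \<and>
          \<phi> ` topspace (unit_sphere (cdim e)) \<subseteq> \<Union>C)) \<and>
    (\<forall>A\<subseteq>topspace T. (\<forall>e\<in>E. closedin T (A \<inter> (T closure_of e))) \<longrightarrow> closedin T A)"

definition subcomplex :: "'a topology \<Rightarrow> 'a set set \<Rightarrow> 'a set \<Rightarrow> bool"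
  where "subcomplex T E A \<longleftrightarrow> closedin T A \<and> (\<exists>C\<subseteq>E. A = \<Union>C)"

definition nerve :: "'a set set \<Rightarrow> 'a set set set"
  where "nerve F = {\<sigma>. \<sigma> \<subseteq> F \<and> finite \<sigma> \<and> \<sigma> \<noteq> {} \<and> \<Inter>\<sigma> \<noteq> {}}"

text \<open>Points of the realization are given by barycentric coordinates.\<close>

definition geometric_simplex :: "'v set \<Rightarrow> ('v \<Rightarrow> real) set"
  where "geometric_simplex \<sigma> =
    {x. (\<forall>v. 0 \<le> x v) \<and> (\<forall>v. v \<notin> \<sigma> \<longrightarrow> x v = 0) \<and> (\<Sum>v\<in>\<sigma>. x v) = 1}"

text \<open>The realization of a simplicial complex \<open>K\<close> (the set of its simplices) carries the weak
  topology, coherent with the Euclidean topologies of the closed simplices. For infinite complexes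
  it may be finer than the topology of pointwise convergence.\<close>

definition geometric_realization :: "'v set set \<Rightarrow> ('v \<Rightarrow> real) topology"
  where "geometric_realization K = topology (\<lambda>U.
    U \<subseteq> (\<Union>\<sigma>\<in>K. geometric_simplex \<sigma>) \<and>
    (\<forall>\<sigma>\<in>K. openin (subtopology (powertop_real UNIV) (geometric_simplex \<sigma>))
             (U \<inter> geometric_simplex \<sigma>)))"

lemma openin_geometric_realization:
  "openin (geometric_realization K) U \<longleftrightarrow>
    U \<subseteq> (\<Union>\<sigma>\<in>K. geometric_simplex \<sigma>) \<and>
    (\<forall>\<sigma>\<in>K. openin (subtopology (powertop_real UNIV) (geometric_simplex \<sigma>))
             (U \<inter> geometric_simplex \<sigma>))"
proof -
  have "istopology (\<lambda>U. U \<subseteq> (\<Union>\<sigma>\<in>K. geometric_simplex \<sigma>) \<and>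
    (\<forall>\<sigma>\<in>K. openin (subtopology (powertop_real UNIV) (geometric_simplex \<sigma>))
             (U \<inter> geometric_simplex \<sigma>)))" (is "istopology ?P")
    unfolding istopology_def
  proof (intro conjI allI impI)
    fix S T assume S: "?P S" and T: "?P T"
    have eq: "S \<inter> T \<inter> A = (S \<inter> A) \<inter> (T \<inter> A)" for A :: "('a \<Rightarrow> real) set"
      by blast
    show "S \<inter> T \<subseteq> (\<Union>\<sigma>\<in>K. geometric_simplex \<sigma>)"
      using S by blast
    show "\<forall>\<sigma>\<in>K. openin (subtopology (powertop_real UNIV) (geometric_simplex \<sigma>))
             (S \<inter> T \<inter> geometric_simplex \<sigma>)"
      unfolding eq using S T by (simp add: openin_Int)
  next
    fix \<K> assume \<K>: "\<forall>S\<in>\<K>. ?P S"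
    have eq: "\<Union>\<K> \<inter> A = \<Union>((\<lambda>S. S \<inter> A) ` \<K>)" for A :: "('a \<Rightarrow> real) set"
      by blast
    show "\<Union>\<K> \<subseteq> (\<Union>\<sigma>\<in>K. geometric_simplex \<sigma>)"
      using \<K> by blast
    show "\<forall>\<sigma>\<in>K. openin (subtopology (powertop_real UNIV) (geometric_simplex \<sigma>))
             (\<Union>\<K> \<inter> geometric_simplex \<sigma>)"
      unfolding eq using \<K> by (intro ballI openin_Union) blast
  qed
  then show ?thesis
    by (simp add: geometric_realization_def topology_inverse')
qed

lemma topspace_geometric_realization:
  "topspace (geometric_realization K) = (\<Union>\<sigma>\<in>K. geometric_simplex \<sigma>)"
proof
  show "topspace (geometric_realization K) \<subseteq> (\<Union>\<sigma>\<in>K. geometric_simplex \<sigma>)"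
    using openin_geometric_realization openin_topspace by blast
  have "openin (geometric_realization K) (\<Union>\<sigma>\<in>K. geometric_simplex \<sigma>)"
    unfolding openin_geometric_realization
  proof (intro conjI ballI order_refl)
    fix \<tau> assume "\<tau> \<in> K"
    then have eq: "(\<Union>\<sigma>\<in>K. geometric_simplex \<sigma>) \<inter> geometric_simplex \<tau> = geometric_simplex \<tau>"
      by blast
    show "openin (subtopology (powertop_real UNIV) (geometric_simplex \<tau>))
            ((\<Union>\<sigma>\<in>K. geometric_simplex \<sigma>) \<inter> geometric_simplex \<tau>)"
      unfolding eq openin_subtopology_refl by simp
  qed
  then show "(\<Union>\<sigma>\<in>K. geometric_simplex \<sigma>) \<subseteq> topspace (geometric_realization K)"
    by (rule openin_subset)
qed

end

theory Submission
  imports Defs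
begin

text \<open>For a cover of \<open>X\<close> consider the double complex spanned by the pairs of an ordered nerve
  simplex \<open>s\<close> and a singular simplex of the intersection of \<open>s\<close>. Its rows resolve the chains that are
  small for the cover. A \<open>p\<close>-simplex of the nerve is an intersection of at most \<open>p + 1\<close> members, so
  the connectivity hypothesis makes the column over it exact up to degree \<open>k - p\<close>; hence the columns
  resolve the ordered chains of the nerve in total degree at most \<open>k\<close>. A zigzag through the double
  complex identifies the homology of \<open>X\<close> with that of the ordered chains of the nerve. The
  realization of the nerve is covered by the open stars of its vertices, whose intersections are
  contractible and which have the same nerve, so the same zigzag computes its homology.

  Small chains compute singular homology for open covers by subdivision. A chain in a CW-complex lies
  in a finite subcomplex, and there a homotopy preserving all subcomplexes moves a neighbourhood of
  each subcomplex into it; this reduces a family of subcomplexes to an open cover.\<close>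

text \<open>A zigzag depends on a chosen lift at every step and so defines no map. It is kept as an
  additive relation between cycles that matches boundaries with boundaries; such a relation already
  induces an isomorphism of the quotients. The bound \<open>n \<le> k\<close> is what connectivity
  pays for: lifting and bounding in degree \<open>n\<close> use exact columns in total degree at
  most \<open>n\<close>, while degree \<open>n + 1\<close> of the nerve enters through nonempty
  intersections. Connectivity becomes exactness by filling spheres directly, simplex by simplex,
  with the filling a function of the simplex, so that the fillings form a chain homotopy. Ordered
  chains see only which finite sets of members meet, hence the cover of the space and the cover of
  the realization by stars yield the very same algebraic complex. Subcomplexes need not be open, so
  subdivision alone does not make a chain small for them; this calls for one homotopy that respects
  all of them at once and a chain homotopy operator natural enough to respect them too.\<close>

section \<open>Zigzags in a double complex\<close>

text \<open>One locale serves both directions of the double complex: the rows are an instance with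
  the two indices interchanged. Lifts are requested up to degree \<open>k + 1\<close>, one more than
  exactness, because a boundary in degree \<open>k\<close> comes from an element of
  \<open>A (k + 1)\<close>. Additivity is encoded by differences, a law that also yields zeros,
  negatives and sums.\<close>

locale augmented_grid =
  fixes D :: "nat \<Rightarrow> nat \<Rightarrow> 'd::ab_group_add set" and A :: "nat \<Rightarrow> 'e::ab_group_add set"
    and dh dv :: "nat \<Rightarrow> nat \<Rightarrow> 'd \<Rightarrow> 'd" and dA :: "nat \<Rightarrow> 'e \<Rightarrow> 'e" and \<eta> :: "nat \<Rightarrow> 'd \<Rightarrow> 'e"
    and k :: nat
  assumes D_diff: "\<lbrakk>x \<in> D p q; y \<in> D p q\<rbrakk> \<Longrightarrow> x - y \<in> D p q"
    and dh_in: "x \<in> D (Suc p) q \<Longrightarrow> dh p q x \<in> D p q"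
    and dh_diff: "dh p q (x - y) = dh p q x - dh p q y"
    and dv_diff: "dv p q (x - y) = dv p q x - dv p q y"
    and \<eta>_diff: "\<eta> p (x - y) = \<eta> p x - \<eta> p y"
    and dh_dh: "x \<in> D (Suc (Suc p)) q \<Longrightarrow> dh p q (dh (Suc p) q x) = 0"
    and dh_dv: "x \<in> D (Suc p) (Suc q) \<Longrightarrow> dh p q (dv (Suc p) q x) = dv p q (dh p (Suc q) x)"
    and \<eta>_dh: "x \<in> D (Suc p) 0 \<Longrightarrow> \<eta> p (dh p 0 x) = dA p (\<eta> (Suc p) x)"
    and exact: "\<lbrakk>p + Suc q \<le> k; x \<in> D p (Suc q); dv p q x = 0\<rbrakk>
                 \<Longrightarrow> \<exists>y\<in>D p (Suc (Suc q)). x = dv p (Suc q) y"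
    and exact0: "\<lbrakk>p \<le> k; x \<in> D p 0; \<eta> p x = 0\<rbrakk> \<Longrightarrow> \<exists>y\<in>D p (Suc 0). x = dv p 0 y"
    and surj: "\<lbrakk>p \<le> Suc k; z \<in> A p\<rbrakk> \<Longrightarrow> \<exists>x\<in>D p 0. \<eta> p x = z"
begin

lemma dh_add: "dh p q (x + y) = dh p q x + dh p q y"
  using dh_diff [of p q "x + y" y] by simp

text \<open>Since \<open>dh\<close> and \<open>dv\<close> commute, the signs of the total complex can be dropped: the cycle condition
  is \<open>dv (x p) = dh (x (p + 1))\<close>, and \<open>x\<close> is a boundary if \<open>x p = dv (y p) + dh (y (p + 1))\<close>.\<close>

definition zigzag :: "nat \<Rightarrow> (nat \<Rightarrow> 'd) \<Rightarrow> bool" where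
  "zigzag n x \<longleftrightarrow> (\<forall>p\<le>n. x p \<in> D p (n - p)) \<and>
     (\<forall>p<n. dv p (n - Suc p) (x p) = dh p (n - Suc p) (x (Suc p)))"

text \<open>Descent from \<open>p = n\<close>: start with a preimage of \<open>z\<close> and solve
  \<open>dv (x p) = dh (x (p + 1))\<close> for one smaller \<open>p\<close> at a time. The
  right-hand side is a vertical cycle because \<open>dh\<close> commutes with \<open>dv\<close> and
  squares to zero; where \<open>q = 0\<close> the augmentation kills it because \<open>z\<close> is
  a cycle.\<close>

lemma zigzag_lift:
  assumes "n \<le> k" and z: "z \<in> A n" and cyc: "\<And>m. n = Suc m \<Longrightarrow> dA m z = 0"
  shows "\<exists>x. zigzag n x \<and> \<eta> n (x n) = z"
proof -
  \<comment> \<open>\<open>j\<close> counts the entries constructed below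
    \<open>x n\<close>.\<close>
  have "\<exists>x. (\<forall>p\<le>n. n \<le> p + j \<longrightarrow> x p \<in> D p (n - p)) \<and> \<eta> n (x n) = z \<and>
     (\<forall>p<n. n \<le> p + j \<longrightarrow> dv p (n - Suc p) (x p) = dh p (n - Suc p) (x (Suc p)))" if "j \<le> n" for j
    using that
  proof (induction j)
    case 0
    obtain x where "x \<in> D n 0" "\<eta> n x = z"
      using surj [of n z] z \<open>n \<le> k\<close> by auto
    then show ?case
      by (intro exI [of _ "\<lambda>_. x"]) (auto simp: le_antisym)
  next
    case (Suc j)
    then obtain x where xD: "\<And>p. \<lbrakk>p \<le> n; n \<le> p + j\<rbrakk> \<Longrightarrow> x p \<in> D p (n - p)" and xz: "\<eta> n (x n) = z"
      and x: "\<And>p. \<lbrakk>p < n; n \<le> p + j\<rbrakk> \<Longrightarrow> dv p (n - Suc p) (x p) = dh p (n - Suc p) (x (Suc p))"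
      by (metis Suc_leD)
    define p where "p = n - Suc j"
    have p: "n = p + Suc j" using Suc.prems p_def by simp
    have x1: "x (Suc p) \<in> D (Suc p) j" using xD [of "Suc p"] p by simp
    have d1: "dh p j (x (Suc p)) \<in> D p j" by (rule dh_in [OF x1])
    have "\<exists>y\<in>D p (Suc j). dh p j (x (Suc p)) = dv p j y"
    proof (cases j)
      case 0
      have "\<eta> p (dh p 0 (x (Suc p))) = dA p (\<eta> (Suc p) (x (Suc p)))"
        using x1 0 by (simp add: \<eta>_dh)
      also have "\<dots> = 0" using xz cyc [of p] p 0 by simp
      finally show ?thesis
        using exact0 [of p "dh p 0 (x (Suc p))"] d1 0 p \<open>n \<le> k\<close> by simp
    next
      case (Suc i)
      have x2: "x (Suc (Suc p)) \<in> D (Suc (Suc p)) i" using xD [of "Suc (Suc p)"] p Suc by simp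
      have "dv p i (dh p j (x (Suc p))) = dh p i (dv (Suc p) i (x (Suc p)))"
        using x1 Suc by (simp add: dh_dv)
      also have "\<dots> = dh p i (dh (Suc p) i (x (Suc (Suc p))))"
        using x [of "Suc p"] p Suc by simp
      also have "\<dots> = 0" by (rule dh_dh [OF x2])
      finally show ?thesis
        using exact [of p i "dh p j (x (Suc p))"] d1 Suc p \<open>n \<le> k\<close> by simp
    qed
    then obtain y where y: "y \<in> D p (Suc j)" "dh p j (x (Suc p)) = dv p j y" by blast
    \<comment> \<open>The relations already established involve larger indices only, so overwriting
      entry \<open>p\<close> leaves them intact.\<close>
    have *: "q = p \<or> n \<le> q + j \<and> q \<noteq> p \<and> Suc q \<noteq> p" if "n \<le> q + Suc j" for q
      using that p by linarith
    show ?case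
      apply (rule exI [of _ "x(p := y)"])
      using y xD x xz p by (auto dest!: *)
  qed
  from this [of n] show ?thesis
    unfolding zigzag_def by auto
qed

text \<open>Descent again, now from a preimage of \<open>w\<close> in degree \<open>n + 1\<close>.
  The defect \<open>x p - dh (y (p + 1))\<close> is a vertical cycle because \<open>x\<close> is a
  zigzag; at the start of the descent \<open>bd\<close> plays this part.\<close>

lemma zigzag_boundary:
  assumes "n \<le> k" and zz: "zigzag n x" and w: "w \<in> A (Suc n)" and bd: "\<eta> n (x n) = dA n w"
  shows "\<exists>y. (\<forall>p\<le>Suc n. y p \<in> D p (Suc n - p)) \<and>
             (\<forall>p\<le>n. x p = dv p (n - p) (y p) + dh p (n - p) (y (Suc p)))"
proof -
  have xD: "\<And>p. p \<le> n \<Longrightarrow> x p \<in> D p (n - p)"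
    and x: "\<And>p. p < n \<Longrightarrow> dv p (n - Suc p) (x p) = dh p (n - Suc p) (x (Suc p))"
    using zz by (auto simp: zigzag_def)
  have "\<exists>y. (\<forall>p\<le>Suc n. Suc n \<le> p + j \<longrightarrow> y p \<in> D p (Suc n - p)) \<and> \<eta> (Suc n) (y (Suc n)) = w \<and>
     (\<forall>p\<le>n. Suc n \<le> p + j \<longrightarrow> x p = dv p (n - p) (y p) + dh p (n - p) (y (Suc p)))" if "j \<le> Suc n" for j
    using that
  proof (induction j)
    case 0
    obtain x where "x \<in> D (Suc n) 0" "\<eta> (Suc n) x = w"
      using surj [of "Suc n" w] w \<open>n \<le> k\<close> by auto
    then show ?case
      by (intro exI [of _ "\<lambda>_. x"]) (auto simp: le_antisym)
  next
    case (Suc j)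
    then obtain y where yD: "\<And>p. \<lbrakk>p \<le> Suc n; Suc n \<le> p + j\<rbrakk> \<Longrightarrow> y p \<in> D p (Suc n - p)"
      and yw: "\<eta> (Suc n) (y (Suc n)) = w"
      and y: "\<And>p. \<lbrakk>p \<le> n; Suc n \<le> p + j\<rbrakk> \<Longrightarrow> x p = dv p (n - p) (y p) + dh p (n - p) (y (Suc p))"
      by (metis Suc_leD)
    define p where "p = n - j"
    have p: "n = p + j" using Suc.prems p_def by simp
    have y1: "y (Suc p) \<in> D (Suc p) j" using yD [of "Suc p"] p by simp
    have x0: "x p \<in> D p j" using xD [of p] p by simp
    have d1: "x p - dh p j (y (Suc p)) \<in> D p j" by (rule D_diff [OF x0 dh_in [OF y1]])
    have "\<exists>u\<in>D p (Suc j). x p - dh p j (y (Suc p)) = dv p j u"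
    proof (cases j)
      case 0
      have "\<eta> p (x p - dh p 0 (y (Suc p))) = 0"
        using y1 0 p bd yw by (simp add: \<eta>_dh \<eta>_diff)
      then show ?thesis
        using exact0 [of p "x p - dh p 0 (y (Suc p))"] d1 0 p \<open>n \<le> k\<close> by simp
    next
      case (Suc i)
      have y2: "y (Suc (Suc p)) \<in> D (Suc (Suc p)) i" using yD [of "Suc (Suc p)"] p Suc by simp
      have "dh p i (x (Suc p)) = dh p i (dv (Suc p) i (y (Suc p))) + dh p i (dh (Suc p) i (y (Suc (Suc p))))"
        using y [of "Suc p"] p Suc by (simp add: dh_add)
      also have "\<dots> = dv p i (dh p j (y (Suc p)))"
        using y1 y2 Suc by (simp add: dh_dh dh_dv)
      finally have "dv p i (x p - dh p j (y (Suc p))) = 0"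
        using x [of p] p Suc by (simp add: dv_diff)
      then show ?thesis
        using exact [of p i "x p - dh p j (y (Suc p))"] d1 Suc p \<open>n \<le> k\<close> by simp
    qed
    then obtain u where u: "u \<in> D p (Suc j)" "x p = dv p j u + dh p j (y (Suc p))"
      by (metis diff_eq_eq)
    have *: "q = p \<or> Suc n \<le> q + j \<and> q \<noteq> p \<and> Suc q \<noteq> p" if "Suc n \<le> q + Suc j" for q
      using that p by linarith
    show ?case
      apply (rule exI [of _ "y(p := u)"])
      using u yD y yw p by (auto dest!: *)
  qed
  from this [of "Suc n"] show ?thesis
    by auto
qed

end

text \<open>A relation rather than a map, so that lifts can be chosen without coherence. Totality on
  both sides and the last clause make it, modulo boundaries, the graph of an isomorphism.\<close>

definition homology_correspondence ::
  "'a::ab_group_add set \<Rightarrow> 'a set \<Rightarrow> 'b::ab_group_add set \<Rightarrow> 'b set \<Rightarrow> ('a \<times> 'b) set \<Rightarrow> bool" where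
  "homology_correspondence Z B Z' B' R \<longleftrightarrow>
     R \<subseteq> Z \<times> Z' \<and> (\<forall>z z' w w'. (z, z') \<in> R \<longrightarrow> (w, w') \<in> R \<longrightarrow> (z - w, z' - w') \<in> R) \<and>
     Z \<subseteq> Domain R \<and> Z' \<subseteq> Range R \<and> (\<forall>z z'. (z, z') \<in> R \<longrightarrow> (z \<in> B \<longleftrightarrow> z' \<in> B'))"

lemma homology_correspondence_converse:
  "homology_correspondence Z B Z' B' R \<Longrightarrow> homology_correspondence Z' B' Z B (R\<inverse>)"
  unfolding homology_correspondence_def by (intro conjI) blast+

lemma homology_correspondenceD:
  assumes "homology_correspondence Z B Z' B' R"
  shows "(z, z') \<in> R \<Longrightarrow> z \<in> Z" "(z, z') \<in> R \<Longrightarrow> z' \<in> Z'"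
    "\<lbrakk>(z, z') \<in> R; (w, w') \<in> R\<rbrakk> \<Longrightarrow> (z - w, z' - w') \<in> R"
    "z \<in> Z \<Longrightarrow> \<exists>z'. (z, z') \<in> R" "z' \<in> Z' \<Longrightarrow> \<exists>z. (z, z') \<in> R"
    "(z, z') \<in> R \<Longrightarrow> z \<in> B \<longleftrightarrow> z' \<in> B'"
  using assms unfolding homology_correspondence_def by (fast | blast)+

lemma homology_correspondence_comp:
  assumes R: "homology_correspondence Z B Z' B' R" and S: "homology_correspondence Z' B' Z'' B'' S"
  shows "homology_correspondence Z B Z'' B'' (R O S)"
  unfolding homology_correspondence_def
proof (intro conjI allI impI)
  show "R O S \<subseteq> Z \<times> Z''"
    using homology_correspondenceD(1) [OF R] homology_correspondenceD(2) [OF S] by fast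
  show "Z \<subseteq> Domain (R O S)"
    using homology_correspondenceD(2,4) [OF R] homology_correspondenceD(4) [OF S]
    by (meson Domain.DomainI relcomp.relcompI subsetI)
  show "Z'' \<subseteq> Range (R O S)"
    using homology_correspondenceD(5) [OF R] homology_correspondenceD(1,5) [OF S]
    by (meson Range.intros relcomp.relcompI subsetI)
  show "z \<in> B \<longleftrightarrow> z'' \<in> B''" if "(z, z'') \<in> R O S" for z z''
    using that homology_correspondenceD(6) [OF R] homology_correspondenceD(6) [OF S] by fast
  show "(z - w, z'' - w'') \<in> R O S" if "(z, z'') \<in> R O S" "(w, w'') \<in> R O S" for z z'' w w''
    using that homology_correspondenceD(3) [OF R] homology_correspondenceD(3) [OF S]
    by (meson relcomp.simps)
qed

text \<open>A zigzag relates its two ends: \<open>\<eta>\<close> of the last entry and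
  \<open>\<epsilon>\<close> of the first. Lifting and bounding through the grid settle the
  \<open>A\<close> side, and the same lemmas for the transposed grid settle the \<open>C\<close>
  side.\<close>

lemma (in augmented_grid) grid_correspondence:
  assumes T: "augmented_grid (\<lambda>p q. D q p) C (\<lambda>p q. dv q p) (\<lambda>p q. dh q p) dC \<epsilon> k"
    and "n \<le> k"
    and \<eta>_in: "\<And>p x. x \<in> D p 0 \<Longrightarrow> \<eta> p x \<in> A p"
    and \<epsilon>_in: "\<And>p x. x \<in> D 0 p \<Longrightarrow> \<epsilon> p x \<in> C p"
    and \<eta>_dv: "\<And>p x. x \<in> D p (Suc 0) \<Longrightarrow> \<eta> p (dv p 0 x) = 0"
    and \<epsilon>_dh: "\<And>p x. x \<in> D (Suc 0) p \<Longrightarrow> \<epsilon> p (dh 0 p x) = 0"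
  shows "\<exists>R. homology_correspondence
           {z \<in> A n. \<forall>m. n = Suc m \<longrightarrow> dA m z = 0} (dA n ` A (Suc n))
           {c \<in> C n. \<forall>m. n = Suc m \<longrightarrow> dC m c = 0} (dC n ` C (Suc n)) R"
proof -
  interpret T: augmented_grid "\<lambda>p q. D q p" C "\<lambda>p q. dv q p" "\<lambda>p q. dh q p" dC \<epsilon> k by (rule T)
  define L where "L = {(z, c). \<exists>x. zigzag n x \<and> \<eta> n (x n) = z \<and> \<epsilon> n (x 0) = c}"
  \<comment> \<open>Reading a zigzag backwards gives a zigzag of the transposed grid; with the signs
    dropped both conditions are the same equations.\<close>
  have flip: "T.zigzag n (\<lambda>p. x (n - p)) \<longleftrightarrow> zigzag n x" for x
  proof -
    have "(\<forall>p\<le>n. x (n - p) \<in> D (n - p) p) \<longleftrightarrow> (\<forall>p\<le>n. x p \<in> D p (n - p))"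
      by (metis diff_diff_cancel diff_le_self)
    moreover have "(\<forall>p<n. dh (n - Suc p) p (x (n - p)) = dv (n - Suc p) p (x (n - Suc p)))
        \<longleftrightarrow> (\<forall>p<n. dv p (n - Suc p) (x p) = dh p (n - Suc p) (x (Suc p)))" (is "?l \<longleftrightarrow> ?r")
    proof
      assume l: ?l
      show ?r
      proof (intro allI impI)
        fix p assume "p < n"
        then have "n - Suc p < n" "n - Suc (n - Suc p) = p" "n - (n - Suc p) = Suc p" by auto
        then show "dv p (n - Suc p) (x p) = dh p (n - Suc p) (x (Suc p))"
          using l by metis
      qed
    next
      assume r: ?r
      show ?l
      proof (intro allI impI)
        fix p assume "p < n"
        then have "n - Suc p < n" "n - Suc (n - Suc p) = p" "n - p = Suc (n - Suc p)" by auto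
        then show "dh (n - Suc p) p (x (n - p)) = dv (n - Suc p) p (x (n - Suc p))"
          using r by metis
      qed
    qed
    ultimately show ?thesis
      by (simp add: T.zigzag_def zigzag_def)
  qed
  have zz_ends: "\<eta> n (x n) \<in> A n" "\<epsilon> n (x 0) \<in> C n"
      "n = Suc m \<Longrightarrow> dA m (\<eta> n (x n)) = 0" "n = Suc m \<Longrightarrow> dC m (\<epsilon> n (x 0)) = 0" if zz: "zigzag n x" for x m
  proof -
    have xD: "\<And>p. p \<le> n \<Longrightarrow> x p \<in> D p (n - p)"
    and x: "\<And>p. p < n \<Longrightarrow> dv p (n - Suc p) (x p) = dh p (n - Suc p) (x (Suc p))"
    using zz by (auto simp: zigzag_def)
    show "\<eta> n (x n) \<in> A n" "\<epsilon> n (x 0) \<in> C n"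
      using xD [of 0] xD [of n] by (simp_all add: \<eta>_in \<epsilon>_in)
    assume n: "n = Suc m"
    \<comment> \<open>The last link of the zigzag replaces \<open>dh\<close> by \<open>dv\<close>,
      and \<open>\<eta>\<close> kills vertical boundaries; \<open>\<epsilon>\<close> is treated
      symmetrically at the first link.\<close>
    have "dA m (\<eta> n (x n)) = \<eta> m (dh m 0 (x n))"
      using xD [of n] n by (simp add: \<eta>_dh)
    also have "\<dots> = \<eta> m (dv m 0 (x m))" using x [of m] n by simp
    also have "\<dots> = 0" using xD [of m] n by (simp add: \<eta>_dv Suc_diff_le)
    finally show "dA m (\<eta> n (x n)) = 0" .
    have "dC m (\<epsilon> n (x 0)) = \<epsilon> m (dv 0 m (x 0))"
      using xD [of 0] n T.\<eta>_dh by simp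
    also have "\<dots> = \<epsilon> m (dh 0 m (x 1))" using x [of 0] n by simp
    also have "\<dots> = 0" using xD [of 1] n by (simp add: \<epsilon>_dh)
    finally show "dC m (\<epsilon> n (x 0)) = 0" .
  qed
  have "homology_correspondence
           {z \<in> A n. \<forall>m. n = Suc m \<longrightarrow> dA m z = 0} (dA n ` A (Suc n))
           {c \<in> C n. \<forall>m. n = Suc m \<longrightarrow> dC m c = 0} (dC n ` C (Suc n)) L"
    unfolding homology_correspondence_def
  proof (intro conjI allI impI)
    show "L \<subseteq> {z \<in> A n. \<forall>m. n = Suc m \<longrightarrow> dA m z = 0} \<times> {c \<in> C n. \<forall>m. n = Suc m \<longrightarrow> dC m c = 0}"
      unfolding L_def using zz_ends by fast
    show "(z - w, z' - w') \<in> L" if zw: "(z, z') \<in> L" "(w, w') \<in> L" for z z' w w'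
    proof -
      obtain x y where "zigzag n x" "\<eta> n (x n) = z" "\<epsilon> n (x 0) = z'"
        "zigzag n y" "\<eta> n (y n) = w" "\<epsilon> n (y 0) = w'"
        using zw unfolding L_def mem_Collect_eq prod.case by blast
      then show ?thesis
        unfolding L_def
        by (auto simp: zigzag_def D_diff dh_diff dv_diff \<eta>_diff T.\<eta>_diff intro!: exI [of _ "\<lambda>p. x p - y p"])
    qed
    show "{z \<in> A n. \<forall>m. n = Suc m \<longrightarrow> dA m z = 0} \<subseteq> Domain L"
      using zigzag_lift [OF \<open>n \<le> k\<close>] by (fastforce simp: L_def)
    show "{c \<in> C n. \<forall>m. n = Suc m \<longrightarrow> dC m c = 0} \<subseteq> Range L"
    proof clarsimp
      fix c assume "c \<in> C n" "\<forall>m. n = Suc m \<longrightarrow> dC m c = 0"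
      then obtain x where x: "T.zigzag n x" "\<epsilon> n (x n) = c"
        using T.zigzag_lift [OF \<open>n \<le> k\<close>] by blast
      have "T.zigzag n (\<lambda>p. x (n - (n - p)))"
        using x by (auto simp: T.zigzag_def)
      then have "zigzag n (\<lambda>p. x (n - p))"
        using flip [of "\<lambda>p. x (n - p)"] by simp
      then have "(\<eta> n (x (n - n)), c) \<in> L"
        using x unfolding L_def by (auto intro!: exI [of _ "\<lambda>p. x (n - p)"])
      then show "c \<in> Range L" by blast
    qed
    fix z c assume "(z, c) \<in> L"
    then obtain x where x: "zigzag n x" "\<eta> n (x n) = z" "\<epsilon> n (x 0) = c"
      by (auto simp: L_def)
    show "z \<in> dA n ` A (Suc n) \<longleftrightarrow> c \<in> dC n ` C (Suc n)"
    proof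
      assume "z \<in> dA n ` A (Suc n)"
      then obtain w where "w \<in> A (Suc n)" "\<eta> n (x n) = dA n w" using x by auto
      then obtain y where y: "\<forall>p\<le>Suc n. y p \<in> D p (Suc n - p)"
         and xy: "\<forall>p\<le>n. x p = dv p (n - p) (y p) + dh p (n - p) (y (Suc p))"
        using zigzag_boundary [OF \<open>n \<le> k\<close> x(1)] by blast
      have "y 0 \<in> D 0 (Suc n)" "y (Suc 0) \<in> D (Suc 0) n"
        using y [rule_format, of 0] y [rule_format, of 1] by auto
      \<comment> \<open>Entry 0 of the bounding chain yields the primitive in \<open>C\<close>,
        since \<open>\<epsilon>\<close> kills the horizontal term.\<close>
      moreover have "x 0 - dh 0 n (y (Suc 0)) = dv 0 n (y 0)"
        using xy by simp
      then have "\<epsilon> n (x 0) - \<epsilon> n (dh 0 n (y (Suc 0))) = \<epsilon> n (dv 0 n (y 0))"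
        using T.\<eta>_diff by metis
      ultimately have "c = dC n (\<epsilon> (Suc n) (y 0))"
        using x T.\<eta>_dh by (simp add: \<epsilon>_dh)
      then show "c \<in> dC n ` C (Suc n)"
        using \<open>y 0 \<in> D 0 (Suc n)\<close> \<epsilon>_in by blast
    next
      assume "c \<in> dC n ` C (Suc n)"
      then obtain w where w: "w \<in> C (Suc n)" "\<epsilon> n (x 0) = dC n w" using x by auto
      have "T.zigzag n (\<lambda>p. x (n - p))" using flip x by blast
      then obtain y where y: "\<forall>p\<le>Suc n. y p \<in> D (Suc n - p) p"
         and xy: "\<forall>p\<le>n. x (n - p) = dh (n - p) p (y p) + dv (n - p) p (y (Suc p))"
        using T.zigzag_boundary [OF \<open>n \<le> k\<close>, of "\<lambda>p. x (n - p)" w] w by auto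
      have "y 0 \<in> D (Suc n) 0" "y (Suc 0) \<in> D n (Suc 0)"
        using y [rule_format, of 0] y [rule_format, of 1] by auto
      moreover have "x n - dv n 0 (y (Suc 0)) = dh n 0 (y 0)"
        using xy by (metis add_diff_cancel diff_zero le0)
      then have "\<eta> n (x n) - \<eta> n (dv n 0 (y (Suc 0))) = \<eta> n (dh n 0 (y 0))"
        using \<eta>_diff by metis
      ultimately have "z = dA n (\<eta> (Suc n) (y 0))"
        using x \<eta>_dh by (simp add: \<eta>_dv)
      then show "z \<in> dA n ` A (Suc n)"
        using \<open>y 0 \<in> D (Suc n) 0\<close> \<eta>_in by blast
    qed
  qed
  then show ?thesis ..
qed

text \<open>A chosen partner \<open>r c\<close> of each cycle is additive only up to boundaries,
  which is enough for a homomorphism into homology. Its kernel is the group of boundaries by the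
  last clause of the correspondence, and the first isomorphism theorem concludes.\<close>

lemma homology_group_iso_correspondence:
  assumes R: "homology_correspondence
      (singular_relcycle_set n X {}) (singular_relboundary_set n X {})
      (singular_relcycle_set n Y {}) (singular_relboundary_set n Y {}) R"
  shows "homology_group (int n) X \<cong> homology_group (int n) Y"
proof -
  note R' = R [unfolded homology_correspondence_def]
  have "\<exists>d. (c, d) \<in> R" if "singular_relcycle n X {} c" for c
    using R' that by blast
  then obtain r where r: "\<And>c. singular_relcycle n X {} c \<Longrightarrow> (c, r c) \<in> R"
    by metis
  have r_cyc: "singular_relcycle n Y {} (r c)" if "singular_relcycle n X {} c" for c
    using r [OF that] R' by blast
  have hom_eq: "homologous_rel n Y {} d d' \<longleftrightarrow> homologous_rel n X {} c c'"
    if "(c, d) \<in> R" "(c', d') \<in> R" for c d c' d'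
    unfolding homologous_rel_def using R' that by (metis mem_Collect_eq)
  let ?G = "relcycle_group n X {}" and ?H = "homology_group (int n) Y"
  let ?f = "\<lambda>c. homologous_rel_set n Y {} (r c)"
  have R0: "(0, 0) \<in> R"
    using r [of 0] R' by (metis cancel_comm_monoid_add_class.diff_cancel singular_relcycle_0)
  have R_add: "(c + c', d + d') \<in> R" if "(c, d) \<in> R" "(c', d') \<in> R" for c d c' d'
  proof -
    have "(0 - c', 0 - d') \<in> R" using R' R0 that by blast
    then have "(c - (0 - c'), d - (0 - d')) \<in> R" using R' that by blast
    then show ?thesis by simp
  qed
  have "group_hom ?G ?H ?f"
  proof (intro group_hom.intro group_hom_axioms.intro)
    show "?f \<in> hom ?G ?H"
    proof (rule homI)
      fix c assume "c \<in> carrier ?G"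
      then show "?f c \<in> carrier ?H"
        by (auto simp: carrier_relative_homology_group r_cyc)
    next
      fix c c' assume cc: "c \<in> carrier ?G" "c' \<in> carrier ?G"
      \<comment> \<open>Both \<open>r (c + c')\<close> and \<open>r c + r c'\<close> are partners of
        \<open>c + c'\<close>, hence homologous.\<close>
      have "?f (c + c') = homologous_rel_set n Y {} (r c + r c')"
        using cc hom_eq [OF r R_add [OF r r], of "c + c'" c c']
        by (simp add: homologous_rel_set_eq singular_relcycle_add)
      also have "\<dots> = ?f c \<otimes>\<^bsub>?H\<^esub> ?f c'"
        using normal.r_coset_hom_Mod [OF normal_subgroup_singular_relboundary_relcycle, of n Y "{}"] cc
        by (simp add: hom_def right_coset_singular_relboundary r_cyc relative_homology_group_def)
      finally show "?f (c \<otimes>\<^bsub>?G\<^esub> c') = ?f c \<otimes>\<^bsub>?H\<^esub> ?f c'" by simp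
    qed
  qed simp_all
  then interpret f: group_hom ?G ?H ?f .
  have ker: "kernel ?G ?H ?f = singular_relboundary_set n X {}"
  proof -
    have "?f c = \<one>\<^bsub>?H\<^esub> \<longleftrightarrow> singular_relboundary n X {} c" if "singular_relcycle n X {} c" for c
      using R' r [OF that] by (simp add: homologous_rel_set_eq_relboundary)
    then show ?thesis
      unfolding kernel_def carrier_relcycle_group mem_Collect_eq
      using singular_relboundary_imp_relcycle [of n X "{}"] by blast
  qed
  have "?f ` carrier ?G = carrier ?H"
  proof
    show "?f ` carrier ?G \<subseteq> carrier ?H"
      by auto
    show "carrier ?H \<subseteq> ?f ` carrier ?G"
    proof
      fix h assume "h \<in> carrier ?H"
      then obtain d where d: "singular_relcycle n Y {} d" "h = homologous_rel_set n Y {} d"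
        by (auto simp: carrier_relative_homology_group)
      then obtain c where c: "(c, d) \<in> R" "singular_relcycle n X {} c" using R' by blast
      then have "?f c = h"
        using hom_eq [OF r [OF c(2)] c(1)] d by (simp add: homologous_rel_set_eq)
      then show "h \<in> ?f ` carrier ?G" using c by auto
    qed
  qed
  then have "?G Mod kernel ?G ?H ?f \<cong> ?H"
    by (rule f.FactGroup_iso)
  then show ?thesis
    unfolding ker by (simp add: relative_homology_group_def)
qed

section \<open>The double complex of a cover\<close>

lemma keys_frag_extend_subset:
  "(\<And>x. x \<in> Poly_Mapping.keys c \<Longrightarrow> Poly_Mapping.keys (f x) \<subseteq> S) \<Longrightarrow>
   Poly_Mapping.keys (frag_extend f c) \<subseteq> S"
  using keys_frag_extend [of f c] by blast

lemma keys_diff_subset: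
  "\<lbrakk>Poly_Mapping.keys x \<subseteq> S; Poly_Mapping.keys y \<subseteq> S\<rbrakk> \<Longrightarrow> Poly_Mapping.keys (x - y) \<subseteq> S"
  for x y :: "'a \<Rightarrow>\<^sub>0 int"
  using keys_diff [of x y] by blast

definition frag_tensor :: "('a \<Rightarrow>\<^sub>0 int) \<Rightarrow> ('b \<Rightarrow>\<^sub>0 int) \<Rightarrow> ('a \<times> 'b \<Rightarrow>\<^sub>0 int)" where
  "frag_tensor x y = frag_extend (\<lambda>a. frag_extend (\<lambda>b. frag_of (a, b)) y) x"

lemma frag_tensor_simps [simp]:
  "frag_tensor (frag_of a) (frag_of b) = frag_of (a, b)"
  "frag_tensor 0 y = 0" "frag_tensor x 0 = 0"
  by (auto simp: frag_tensor_def intro: frag_extend_eq_0)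

lemma frag_tensor_diff1: "frag_tensor (x - x') y = frag_tensor x y - frag_tensor x' y"
  by (simp add: frag_tensor_def frag_extend_diff)

lemma frag_tensor_diff2: "frag_tensor x (y - y') = frag_tensor x y - frag_tensor x y'"
  by (rule frag_induction [of x UNIV]) (auto simp: frag_tensor_def frag_extend_diff)

lemma keys_frag_tensor:
  "Poly_Mapping.keys (frag_tensor x y) \<subseteq> Poly_Mapping.keys x \<times> Poly_Mapping.keys y"
  unfolding frag_tensor_def by (intro keys_frag_extend_subset) auto

lemma frag_extend_tensor:
  assumes "\<And>a b. f (a, b) = frag_tensor (g a) (h b)"
  shows "frag_extend f (frag_tensor x y) = frag_tensor (frag_extend g x) (frag_extend h y)"
proof (rule frag_induction [of x UNIV])
  fix a
  show "frag_extend f (frag_tensor (frag_of a) y) = frag_tensor (frag_extend g (frag_of a)) (frag_extend h y)"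
    by (rule frag_induction [of y UNIV]) (auto simp: assms frag_extend_diff frag_tensor_diff2)
qed (auto simp: frag_extend_diff frag_tensor_diff1)

definition frag_Cons :: "'v \<Rightarrow> ('v list \<Rightarrow>\<^sub>0 int) \<Rightarrow> ('v list \<Rightarrow>\<^sub>0 int)" where
  "frag_Cons a = frag_extend (\<lambda>s. frag_of (a # s))"

lemma frag_Cons_0: "frag_Cons a 0 = 0"
  by (simp add: frag_Cons_def)

text \<open>The alternating sum over deletions of one entry, written as the cone formula d(a s) = s
  - a d(s). A list of length one is sent to the empty list, so in degree 0 this is the augmentation
  and not zero.\<close>

fun list_boundary :: "'v list \<Rightarrow> ('v list \<Rightarrow>\<^sub>0 int)" where
  "list_boundary [] = 0"
| "list_boundary (a # s) = frag_of s - frag_Cons a (list_boundary s)"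

text \<open>The cone formula for chains; by induction on the list it makes
  \<open>list_boundary\<close> square to zero.\<close>

lemma frag_extend_list_boundary_Cons:
  "frag_extend list_boundary (frag_Cons a c) = c - frag_Cons a (frag_extend list_boundary c)"
  unfolding frag_Cons_def
  by (rule frag_induction [of c UNIV]) (auto simp: frag_extend_diff frag_Cons_def)

lemma list_boundary_boundary: "frag_extend list_boundary (list_boundary s) = 0"
  by (induction s) (simp_all add: frag_extend_diff frag_extend_list_boundary_Cons frag_Cons_0)

lemma keys_list_boundary:
  "t \<in> Poly_Mapping.keys (list_boundary s) \<Longrightarrow> Suc (length t) = length s \<and> set t \<subseteq> set s"
proof (induction s arbitrary: t)
  case (Cons a s)
  have "Poly_Mapping.keys (frag_Cons a c) \<subseteq> (#) a ` Poly_Mapping.keys c" for c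
    unfolding frag_Cons_def by (rule keys_frag_extend_subset) auto
  moreover have "t = s \<or> t \<in> Poly_Mapping.keys (frag_Cons a (list_boundary s))"
    using Cons.prems keys_diff [of "frag_of s" "frag_Cons a (list_boundary s)"] by auto
  ultimately consider "t = s" | t' where "t = a # t'" "t' \<in> Poly_Mapping.keys (list_boundary s)"
    by blast
  then show ?case
  proof cases
    case 2
    then show ?thesis using Cons.IH [OF 2(2)] by auto
  qed auto
qed auto

text \<open>Coherent cones over the singular simplices of dimension at most \<open>m\<close>: face 0 of the cone
  \<open>K q \<sigma>\<close> is \<open>\<sigma>\<close>, and its other faces are the cones over the faces of \<open>\<sigma>\<close>.\<close>

definition cone_operator ::
  "int \<Rightarrow> 'a topology \<Rightarrow> ((nat \<Rightarrow> real) \<Rightarrow> 'a) \<Rightarrow> (nat \<Rightarrow> ((nat \<Rightarrow> real) \<Rightarrow> 'a) \<Rightarrow> (nat \<Rightarrow> real) \<Rightarrow> 'a) \<Rightarrow> bool" where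
  "cone_operator m Y b K \<longleftrightarrow> singular_simplex 0 Y b \<and>
     (\<forall>q \<sigma>. int q \<le> m \<longrightarrow> singular_simplex q Y \<sigma> \<longrightarrow> singular_simplex (Suc q) Y (K q \<sigma>) \<and>
        chain_boundary (Suc q) (frag_of (K q \<sigma>)) =
          frag_of \<sigma> - (if q = 0 then frag_of b
                       else frag_extend (\<lambda>\<tau>. frag_of (K (q - 1) \<tau>)) (chain_boundary q (frag_of \<sigma>))))"

definition small_chain :: "nat \<Rightarrow> 'a topology \<Rightarrow> 'a set set \<Rightarrow> 'a chain \<Rightarrow> bool" where
  "small_chain q X \<U> c \<longleftrightarrow>
     Poly_Mapping.keys c \<subseteq> {\<sigma>. \<exists>V\<in>\<U>. singular_simplex q (subtopology X V) \<sigma>}"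

lemma small_chain_diff: "\<lbrakk>small_chain q X \<U> c; small_chain q X \<U> d\<rbrakk> \<Longrightarrow> small_chain q X \<U> (c - d)"
  unfolding small_chain_def by (rule keys_diff_subset)

lemma small_chain_0 [simp]: "small_chain q X \<U> 0"
  by (simp add: small_chain_def)

lemma small_chain_imp_singular: "small_chain q X \<U> c \<Longrightarrow> singular_chain q X c"
  by (auto simp: small_chain_def singular_chain_def singular_simplex_subtopology)

definition small_cycles :: "nat \<Rightarrow> 'a topology \<Rightarrow> 'a set set \<Rightarrow> 'a chain set" where
  "small_cycles n X \<U> = {c. small_chain n X \<U> c \<and> chain_boundary n c = 0}"

definition small_boundaries :: "nat \<Rightarrow> 'a topology \<Rightarrow> 'a set set \<Rightarrow> 'a chain set" where
  "small_boundaries n X \<U> = chain_boundary (Suc n) ` Collect (small_chain (Suc n) X \<U>)"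

text \<open>Indexed by \<open>I\<close> rather than by the sets themselves: the stars of the
  realization carry the members of the family as indices, so both ordered nerves consist of lists
  over the same vertices.\<close>

definition ordered_nerve :: "'a topology \<Rightarrow> 'v set \<Rightarrow> ('v \<Rightarrow> 'a set) \<Rightarrow> 'v list set" where
  "ordered_nerve X I U = {s. s \<noteq> [] \<and> set s \<subseteq> I \<and> topspace X \<inter> (\<Inter>i\<in>set s. U i) \<noteq> {}}"

text \<open>Ordered simplices may repeat vertices, so a \<open>p\<close>-simplex is an intersection of at most
  \<open>p + 1\<close> members; this keeps all signs inside \<open>list_boundary\<close>.\<close>

definition nerve_cell :: "'a topology \<Rightarrow> 'v set \<Rightarrow> ('v \<Rightarrow> 'a set) \<Rightarrow> nat \<Rightarrow> ('v list \<Rightarrow>\<^sub>0 int) set" where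
  "nerve_cell X I U p = {x. Poly_Mapping.keys x \<subseteq> {s \<in> ordered_nerve X I U. length s = Suc p}}"

text \<open>In degree 0 \<open>list_boundary\<close> is the augmentation, so there the condition is
  dropped and every chain is a cycle.\<close>

definition nerve_cycles :: "'a topology \<Rightarrow> 'v set \<Rightarrow> ('v \<Rightarrow> 'a set) \<Rightarrow> nat \<Rightarrow> ('v list \<Rightarrow>\<^sub>0 int) set" where
  "nerve_cycles X I U n = {z \<in> nerve_cell X I U n. \<forall>m. n = Suc m \<longrightarrow> frag_extend list_boundary z = 0}"

definition nerve_boundaries :: "'a topology \<Rightarrow> 'v set \<Rightarrow> ('v \<Rightarrow> 'a set) \<Rightarrow> nat \<Rightarrow> ('v list \<Rightarrow>\<^sub>0 int) set" where
  "nerve_boundaries X I U n = frag_extend list_boundary ` nerve_cell X I U (Suc n)"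

text \<open>A singular simplex in the intersection witnesses that it is nonempty, so the nerve
  condition is implicit.\<close>

definition grid_cell ::
  "'a topology \<Rightarrow> 'v set \<Rightarrow> ('v \<Rightarrow> 'a set) \<Rightarrow> nat \<Rightarrow> nat \<Rightarrow> ('v list \<times> ((nat \<Rightarrow> real) \<Rightarrow> 'a) \<Rightarrow>\<^sub>0 int) set" where
  "grid_cell X I U p q = {x. Poly_Mapping.keys x \<subseteq>
     {(s, \<sigma>). length s = Suc p \<and> set s \<subseteq> I \<and> singular_simplex q (subtopology X (\<Inter>i\<in>set s. U i)) \<sigma>}}"

definition grid_h :: "('v list \<times> 's \<Rightarrow>\<^sub>0 int) \<Rightarrow> ('v list \<times> 's \<Rightarrow>\<^sub>0 int)" where
  "grid_h = frag_extend (\<lambda>(s, \<sigma>). frag_tensor (list_boundary s) (frag_of \<sigma>))"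

definition grid_v :: "nat \<Rightarrow> ('l \<times> ((nat \<Rightarrow> real) \<Rightarrow> 'a) \<Rightarrow>\<^sub>0 int) \<Rightarrow> ('l \<times> ((nat \<Rightarrow> real) \<Rightarrow> 'a) \<Rightarrow>\<^sub>0 int)" where
  "grid_v q = frag_extend (\<lambda>(s, \<sigma>). frag_tensor (frag_of s) (chain_boundary (Suc q) (frag_of \<sigma>)))"

definition frag_fst :: "('a \<times> 'b \<Rightarrow>\<^sub>0 int) \<Rightarrow> ('a \<Rightarrow>\<^sub>0 int)" where
  "frag_fst = frag_extend (\<lambda>(a, b). frag_of a)"

definition frag_snd :: "('a \<times> 'b \<Rightarrow>\<^sub>0 int) \<Rightarrow> ('b \<Rightarrow>\<^sub>0 int)" where
  "frag_snd = frag_extend (\<lambda>(a, b). frag_of b)"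

section \<open>Identities between the differentials and the augmentations\<close>

lemma chain_boundary_extend:
  "frag_extend (\<lambda>\<sigma>. chain_boundary q (frag_of \<sigma>)) c = chain_boundary q c"
  by (rule frag_induction [of c UNIV]) (auto simp: frag_extend_diff chain_boundary_diff)

lemma grid_h_tensor: "grid_h (frag_tensor x y) = frag_tensor (frag_extend list_boundary x) y"
proof -
  have "grid_h (frag_tensor x y) = frag_tensor (frag_extend list_boundary x) (frag_extend frag_of y)"
    unfolding grid_h_def by (rule frag_extend_tensor) simp
  then show ?thesis by (simp flip: frag_expansion)
qed

lemma grid_v_tensor: "grid_v q (frag_tensor x y) = frag_tensor x (chain_boundary (Suc q) y)"
proof -
  have "grid_v q (frag_tensor x y) =
      frag_tensor (frag_extend frag_of x) (frag_extend (\<lambda>\<sigma>. chain_boundary (Suc q) (frag_of \<sigma>)) y)"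
    unfolding grid_v_def by (rule frag_extend_tensor) simp
  then show ?thesis by (simp add: chain_boundary_extend flip: frag_expansion)
qed

lemma grid_diff [simp]:
  "grid_h (x - y) = grid_h x - grid_h y" "grid_v q (u - v) = grid_v q u - grid_v q v"
  "frag_fst (z - w) = frag_fst z - frag_fst w" "frag_snd (z - w) = frag_snd z - frag_snd w"
  by (simp_all add: grid_h_def grid_v_def frag_fst_def frag_snd_def frag_extend_diff)

lemma grid_zero [simp]: "grid_h 0 = 0" "grid_v q 0 = 0" "frag_fst 0 = 0" "frag_snd 0 = 0"
  by (simp_all add: grid_h_def grid_v_def frag_fst_def frag_snd_def)

lemma grid_of:
  "grid_h (frag_of (s, \<sigma>)) = frag_tensor (list_boundary s) (frag_of \<sigma>)"
  "grid_v q (frag_of (l, \<tau>)) = frag_tensor (frag_of l) (chain_boundary (Suc q) (frag_of \<tau>))"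
  "frag_fst (frag_of (a, b)) = frag_of a" "frag_snd (frag_of (c, d)) = frag_of d"
  by (simp_all add: grid_h_def grid_v_def frag_fst_def frag_snd_def)

lemma grid_h_grid_h: "grid_h (grid_h x) = 0"
  by (rule frag_induction [of x UNIV]) (auto simp: grid_of grid_h_tensor list_boundary_boundary)

lemma grid_h_grid_v: "grid_h (grid_v q x) = grid_v q (grid_h x)"
  by (rule frag_induction [of x UNIV]) (auto simp: grid_of grid_h_tensor grid_v_tensor)

lemma frag_fst_grid_h: "frag_fst (grid_h x) = frag_extend list_boundary (frag_fst x)"
proof (rule frag_induction [of x UNIV])
  have "frag_fst (frag_tensor y (frag_of \<sigma>)) = y" for y :: "'c list \<Rightarrow>\<^sub>0 int" and \<sigma> :: 'd
    by (rule frag_induction [of y UNIV]) (auto simp: frag_tensor_diff1 grid_of)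
  then show "frag_fst (grid_h (frag_of a)) = frag_extend list_boundary (frag_fst (frag_of a))"
    for a :: "'c list \<times> 'd"
    by (cases a) (simp add: grid_of)
qed (auto simp: frag_extend_diff)

lemma frag_snd_grid_v: "frag_snd (grid_v q x) = chain_boundary (Suc q) (frag_snd x)"
proof (rule frag_induction [of x UNIV])
  have "frag_snd (frag_tensor (frag_of s) y) = y" for y :: "'d \<Rightarrow>\<^sub>0 int" and s :: 'c
    by (rule frag_induction [of y UNIV]) (auto simp: frag_tensor_diff2 grid_of)
  then show "frag_snd (grid_v q (frag_of a)) = chain_boundary (Suc q) (frag_snd (frag_of a))" for a
    by (cases a) (simp add: grid_of)
qed (auto simp: chain_boundary_diff)

text \<open>The boundary of a 1-simplex is a difference of two points, and \<open>frag_fst\<close>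
  no longer sees which points.\<close>

lemma frag_fst_grid_v_0: "frag_fst (grid_v 0 x) = 0"
proof (rule frag_induction [of x UNIV])
  show "frag_fst (grid_v 0 (frag_of a)) = 0" for a :: "'a \<times> ((nat \<Rightarrow> real) \<Rightarrow> 'b)"
    by (cases a) (simp add: grid_of chain_boundary_of frag_tensor_diff2)
qed auto

lemma list_boundary_two: "length s = 2 \<Longrightarrow> \<exists>a b. list_boundary s = frag_of [b] - frag_of [a]"
  by (force simp: length_Suc_conv numeral_2_eq_2 frag_Cons_def frag_extend_diff)

lemma frag_snd_grid_h_0:
  assumes "x \<in> grid_cell X I U (Suc 0) q"
  shows "frag_snd (grid_h x) = 0"
  using assms unfolding grid_cell_def mem_Collect_eq
proof (induction rule: frag_induction)
  case (one u)
  then obtain s \<sigma> where "u = (s, \<sigma>)" "length s = 2"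
    by (cases u) auto
  moreover obtain a b where "list_boundary s = frag_of [b] - frag_of [a]"
    using list_boundary_two [OF \<open>length s = 2\<close>] by blast
  ultimately show ?case by (simp add: grid_of frag_tensor_diff1)
qed auto

lemma grid_cell_diff: "\<lbrakk>x \<in> grid_cell X I U p q; y \<in> grid_cell X I U p q\<rbrakk> \<Longrightarrow> x - y \<in> grid_cell X I U p q"
  unfolding grid_cell_def using keys_diff_subset by blast

text \<open>Deleting an index enlarges the intersection, so the singular simplex stays
  inside.\<close>

lemma grid_h_in:
  assumes "x \<in> grid_cell X I U (Suc p) q"
  shows "grid_h x \<in> grid_cell X I U p q"
  using assms unfolding grid_cell_def mem_Collect_eq
proof (induction rule: frag_induction)
  case (one u)
  then obtain s \<sigma> where u: "u = (s, \<sigma>)" "length s = Suc (Suc p)" "set s \<subseteq> I"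
    "singular_simplex q (subtopology X (\<Inter>i\<in>set s. U i)) \<sigma>"
    by (cases u) auto
  have "Poly_Mapping.keys (grid_h (frag_of u)) \<subseteq> Poly_Mapping.keys (list_boundary s) \<times> {\<sigma>}"
    using keys_frag_tensor [of "list_boundary s" "frag_of \<sigma>"] by (simp add: grid_of u)
  moreover have "singular_simplex q (subtopology X (\<Inter>i\<in>set t. U i)) \<sigma>" if "set t \<subseteq> set s" for t
    by (rule singular_simplex_mono [OF u(4)]) (use that in blast)
  ultimately show ?case
    using u keys_list_boundary [of _ s] by fastforce
qed (auto simp: keys_diff_subset)

lemma grid_v_in:
  assumes "x \<in> grid_cell X I U p (Suc q)"
  shows "grid_v q x \<in> grid_cell X I U p q"
  using assms unfolding grid_cell_def mem_Collect_eq
proof (induction rule: frag_induction)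
  case (one u)
  then obtain s \<sigma> where u: "u = (s, \<sigma>)" "length s = Suc p" "set s \<subseteq> I"
    "singular_simplex (Suc q) (subtopology X (\<Inter>i\<in>set s. U i)) \<sigma>"
    by (cases u) auto
  have "Poly_Mapping.keys (grid_v q (frag_of u)) \<subseteq> {s} \<times> Poly_Mapping.keys (chain_boundary (Suc q) (frag_of \<sigma>))"
    using keys_frag_tensor [of "frag_of s" "chain_boundary (Suc q) (frag_of \<sigma>)"] by (simp add: grid_of u)
  moreover have "singular_chain q (subtopology X (\<Inter>i\<in>set s. U i)) (chain_boundary (Suc q) (frag_of \<sigma>))"
    using u by (simp add: singular_chain_boundary_alt singular_chain_of)
  ultimately show ?case
    using u by (auto simp: singular_chain_def)
qed (auto simp: keys_diff_subset)

lemma frag_fst_in: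
  assumes "x \<in> grid_cell X I U p q"
  shows "frag_fst x \<in> nerve_cell X I U p"
  using assms unfolding grid_cell_def nerve_cell_def mem_Collect_eq
proof (induction rule: frag_induction)
  case (one u)
  then show ?case
    using singular_simplex_empty [of "subtopology X (\<Inter>i\<in>set (fst u). U i)" q "snd u"]
    by (cases u) (auto simp: grid_of ordered_nerve_def)
qed (auto simp: keys_diff_subset)

lemma frag_snd_in:
  assumes "x \<in> grid_cell X I U p q"
  shows "small_chain q X (U ` I) (frag_snd x)"
  using assms unfolding grid_cell_def small_chain_def mem_Collect_eq
proof (induction rule: frag_induction)
  case (one u)
  then obtain s \<sigma> where u: "u = (s, \<sigma>)" "length s = Suc p" "set s \<subseteq> I"
    "singular_simplex q (subtopology X (\<Inter>i\<in>set s. U i)) \<sigma>"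
    by (cases u) auto
  then have "hd s \<in> set s" by (cases s) auto
  then have "hd s \<in> I" "singular_simplex q (subtopology X (U (hd s))) \<sigma>"
    using u by (auto intro: singular_simplex_mono [OF u(4)])
  then show ?case
    using u by (auto simp: grid_of)
qed (auto simp: keys_diff_subset)

text \<open>The cones over the simplices of one intersection give a homotopy \<open>H\<close> with
  dv H = 1 - H dv in positive degrees. A list of length \<open>p + 1\<close> has cones in dimensions
  up to \<open>k + 1 - (p + 1) = k - p\<close>, which is the bound \<open>p + q \<le> k\<close> of
  the grid.\<close>

lemma columns_augmented_grid:
  assumes cone: "\<And>s. \<lbrakk>s \<in> ordered_nerve X I U; length s \<le> Suc k\<rbrakk> \<Longrightarrow>
      \<exists>b K. cone_operator (int k + 1 - int (length s)) (subtopology X (\<Inter>i\<in>set s. U i)) b K"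
  shows "augmented_grid (grid_cell X I U) (nerve_cell X I U) (\<lambda>p q. grid_h) (\<lambda>p q. grid_v q)
           (\<lambda>p. frag_extend list_boundary) (\<lambda>p. frag_fst) k"
proof -
  let ?Y = "\<lambda>s. subtopology X (\<Inter>i\<in>set s. U i)"
  obtain b K where bK: "\<And>s. \<lbrakk>s \<in> ordered_nerve X I U; length s \<le> Suc k\<rbrakk> \<Longrightarrow>
      cone_operator (int k + 1 - int (length s)) (?Y s) (b s) (K s)"
    using cone by metis
  have nerve: "s \<in> ordered_nerve X I U"
    if "singular_simplex q (?Y s) \<sigma>" "s \<noteq> []" "set s \<subseteq> I" for q s \<sigma>
    using singular_simplex_empty [of "?Y s" q \<sigma>] that by (auto simp: ordered_nerve_def)
  define H where "H q = frag_extend (\<lambda>(s, \<sigma>). frag_of (s, K s q \<sigma>))" for q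
  have KI: "singular_simplex (Suc q) (?Y s) (K s q \<sigma>)"
    "chain_boundary (Suc q) (frag_of (K s q \<sigma>)) =
          frag_of \<sigma> - (if q = 0 then frag_of (b s)
                       else frag_extend (\<lambda>\<tau>. frag_of (K s (q - 1) \<tau>)) (chain_boundary q (frag_of \<sigma>)))"
    if "p + q \<le> k" "length s = Suc p" "set s \<subseteq> I" "singular_simplex q (?Y s) \<sigma>" for p q s \<sigma>
    using bK [of s] nerve [of q s \<sigma>] that unfolding cone_operator_def by fastforce+
  have H_in: "H q x \<in> grid_cell X I U p (Suc q)" if "p + q \<le> k" "x \<in> grid_cell X I U p q" for p q x
    using that(2) unfolding grid_cell_def mem_Collect_eq
  proof (induction rule: frag_induction)
    case (one u)
    then show ?case using KI(1) that(1) by (cases u) (auto simp: H_def)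
  qed (auto simp: keys_diff_subset H_def frag_extend_diff)
  show ?thesis
  proof
    show "\<exists>y\<in>grid_cell X I U p (Suc (Suc q)). x = grid_v (Suc q) y"
      if "p + Suc q \<le> k" "x \<in> grid_cell X I U p (Suc q)" "grid_v q x = 0" for p q x
    proof -
      have "grid_v (Suc q) (H (Suc q) x) = x - H q (grid_v q x)"
        using that(2) unfolding grid_cell_def mem_Collect_eq
      proof (induction rule: frag_induction)
        case (one u)
        then obtain s \<sigma> where u: "u = (s, \<sigma>)" "length s = Suc p" "set s \<subseteq> I" "singular_simplex (Suc q) (?Y s) \<sigma>"
          by (cases u) auto
        have "H q (frag_tensor (frag_of s) y) = frag_tensor (frag_of s) (frag_extend (\<lambda>\<tau>. frag_of (K s q \<tau>)) y)" for y
          by (rule frag_induction [of y UNIV]) (auto simp: H_def frag_tensor_diff2 frag_extend_diff)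
        then show ?case
          using KI(2) [OF that(1) u(2-4)]
          by (simp add: u grid_of H_def frag_tensor_diff2)
      qed (auto simp: H_def frag_extend_diff)
      then have "x = grid_v (Suc q) (H (Suc q) x)"
        using that(3) by (simp add: H_def)
      then show ?thesis
        using H_in [OF that(1,2)] by blast
    qed
    show "\<exists>y\<in>grid_cell X I U p (Suc 0). x = grid_v 0 y"
      if "p \<le> k" "x \<in> grid_cell X I U p 0" "frag_fst x = 0" for p x
    proof -
      \<comment> \<open>In degree 0 the far ends of the cones contribute the base points
        \<open>b s\<close> with the coefficients of \<open>frag_fst x\<close>, which vanish by
        assumption.\<close>
      have "grid_v 0 (H 0 x) = x - frag_extend (\<lambda>s. frag_of (s, b s)) (frag_fst x)"
        using that(2) unfolding grid_cell_def mem_Collect_eq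
      proof (induction rule: frag_induction)
        case (one u)
        then obtain s \<sigma> where u: "u = (s, \<sigma>)" "length s = Suc p" "set s \<subseteq> I" "singular_simplex 0 (?Y s) \<sigma>"
          by (cases u) auto
        then show ?case
          using KI(2) [of p 0 s \<sigma>] that(1)
          by (simp add: grid_of H_def frag_tensor_diff2)
      qed (auto simp: H_def frag_extend_diff)
      then show ?thesis
        using that H_in [of p 0 x] by (auto intro!: bexI [of _ "H 0 x"])
    qed
    show "\<exists>x\<in>grid_cell X I U p 0. frag_fst x = z" if "z \<in> nerve_cell X I U p" for p z
    proof -
      \<comment> \<open>A nonempty intersection supplies a point, hence a 0-simplex, so lifts exist
        in every degree.\<close>
      have "\<exists>\<sigma>. singular_simplex 0 (?Y s) \<sigma>" if "s \<in> ordered_nerve X I U" for s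
      proof -
        obtain a where "a \<in> topspace (?Y s)" using \<open>s \<in> _\<close> by (auto simp: ordered_nerve_def)
        then have "singular_simplex 0 (?Y s) (restrict (\<lambda>_. a) (standard_simplex 0))"
          by (simp add: singular_simplex_def)
        then show ?thesis by blast
      qed
      then obtain c where c: "\<And>s. s \<in> ordered_nerve X I U \<Longrightarrow> singular_simplex 0 (?Y s) (c s)"
        by metis
      have "frag_extend (\<lambda>s. frag_of (s, c s)) z \<in> grid_cell X I U p 0 \<and>
            frag_fst (frag_extend (\<lambda>s. frag_of (s, c s)) z) = z"
        using that unfolding grid_cell_def nerve_cell_def mem_Collect_eq
      proof (induction rule: frag_induction)
        case (one s)
        then show ?case using c [of s] by (auto simp: grid_of ordered_nerve_def)
      qed (auto simp: frag_extend_diff keys_diff_subset)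
      then show ?thesis by blast
    qed
  qed (auto simp: grid_cell_diff grid_h_in grid_h_grid_h grid_h_grid_v frag_fst_grid_h)
qed

text \<open>Over a fixed singular simplex the row is the ordered chain complex of all members
  containing it, a full simplex. Prepending one such member contracts it.\<close>

lemma rows_augmented_grid:
  "augmented_grid (\<lambda>p q. grid_cell X I U q p) (\<lambda>q. Collect (small_chain q X (U ` I)))
     (\<lambda>p q. grid_v p) (\<lambda>p q. grid_h) (\<lambda>q. chain_boundary (Suc q)) (\<lambda>q. frag_snd) k"
proof -
  let ?Y = "\<lambda>s. subtopology X (\<Inter>i\<in>set s. U i)"
  \<comment> \<open>Chosen from the simplex alone and not from the list, so that prepending it is
    compatible with deleting list entries.\<close>
  define idx where "idx q \<sigma> = (SOME i. i \<in> I \<and> singular_simplex q (subtopology X (U i)) \<sigma>)" for q \<sigma>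
  have idx: "idx q \<sigma> \<in> I" "singular_simplex q (subtopology X (U (idx q \<sigma>))) \<sigma>"
    if "i \<in> I" "singular_simplex q (subtopology X (U i)) \<sigma>" for q i \<sigma>
    using someI [of "\<lambda>i. i \<in> I \<and> singular_simplex q (subtopology X (U i)) \<sigma>"] that
    by (auto simp: idx_def)
  have idx': "idx q \<sigma> \<in> I" "singular_simplex q (subtopology X (U (idx q \<sigma>))) \<sigma>"
    if "length s = Suc p" "set s \<subseteq> I" "singular_simplex q (?Y s) \<sigma>" for p q s \<sigma>
  proof -
    have "hd s \<in> set s" using that by (cases s) auto
    then have "hd s \<in> I" "singular_simplex q (subtopology X (U (hd s))) \<sigma>"
      using that by (auto intro: singular_simplex_mono [OF that(3)])
    then show "idx q \<sigma> \<in> I" "singular_simplex q (subtopology X (U (idx q \<sigma>))) \<sigma>"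
      using idx by blast+
  qed
  define H where "H q = frag_extend (\<lambda>(s, \<sigma>). frag_of (idx q \<sigma> # s, \<sigma>))" for q
  have H_in: "H q x \<in> grid_cell X I U (Suc p) q" if "x \<in> grid_cell X I U p q" for p q x
    using that unfolding grid_cell_def mem_Collect_eq
  proof (induction rule: frag_induction)
    case (one u)
    then show ?case
      using idx' [of "fst u" p q "snd u"]
      by (cases u) (auto simp: H_def singular_simplex_subtopology)
  qed (auto simp: keys_diff_subset H_def frag_extend_diff)
  show ?thesis
  proof
    show "\<exists>y\<in>grid_cell X I U (Suc (Suc q)) p. x = grid_h y"
      if "x \<in> grid_cell X I U (Suc q) p" "grid_h x = 0" for p q x
    proof -
      have "grid_h (H p x) = x - H p (grid_h x)"
      proof (rule frag_induction [of x UNIV])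
        fix u :: "'a list \<times> ((nat \<Rightarrow> real) \<Rightarrow> 'b)"
        obtain s \<sigma> where u: "u = (s, \<sigma>)" by (cases u)
        have "H p (frag_tensor y (frag_of \<sigma>)) = frag_tensor (frag_Cons (idx p \<sigma>) y) (frag_of \<sigma>)" for y
          unfolding frag_Cons_def
          by (rule frag_induction [of y UNIV]) (auto simp: H_def frag_tensor_diff1 frag_extend_diff)
        then show "grid_h (H p (frag_of u)) = frag_of u - H p (grid_h (frag_of u))"
          by (simp add: u grid_of H_def frag_tensor_diff1)
      qed (auto simp: H_def frag_extend_diff)
      then have "x = grid_h (H p x)"
        using that(2) by (simp add: H_def)
      then show ?thesis
        using H_in [OF that(1)] by blast
    qed
    show "\<exists>y\<in>grid_cell X I U (Suc 0) p. x = grid_h y"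
      if "x \<in> grid_cell X I U 0 p" "frag_snd x = 0" for p x
    proof -
      have "grid_h (H p x) = x - frag_extend (\<lambda>\<sigma>. frag_of ([idx p \<sigma>], \<sigma>)) (frag_snd x)"
        using that(1) unfolding grid_cell_def mem_Collect_eq
      proof (induction rule: frag_induction)
        case (one u)
        then obtain a \<sigma> where u: "u = ([a], \<sigma>)"
          by (cases u) (auto simp: length_Suc_conv)
        then show ?case
          by (simp add: grid_of H_def frag_tensor_diff1 frag_Cons_def frag_extend_diff)
      qed (auto simp: H_def frag_extend_diff)
      then show ?thesis
        using that H_in [of x 0 p] by (auto intro!: bexI [of _ "H p x"])
    qed
    show "\<exists>x\<in>grid_cell X I U 0 p. frag_snd x = z" if "z \<in> Collect (small_chain p X (U ` I))" for p z
    proof -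
      have "frag_extend (\<lambda>\<sigma>. frag_of ([idx p \<sigma>], \<sigma>)) z \<in> grid_cell X I U 0 p \<and>
            frag_snd (frag_extend (\<lambda>\<sigma>. frag_of ([idx p \<sigma>], \<sigma>)) z) = z"
        using that unfolding grid_cell_def small_chain_def mem_Collect_eq
      proof (induction rule: frag_induction)
        case (one s)
        then show ?case using idx by (auto simp: grid_of)
      qed (auto simp: frag_extend_diff keys_diff_subset)
      then show ?thesis by blast
    qed
    show "grid_v q (grid_v (Suc q) x) = 0" if "x \<in> grid_cell X I U p (Suc (Suc q))" for p q x
      using that unfolding grid_cell_def mem_Collect_eq
    proof (induction rule: frag_induction)
      case (one u)
      then obtain s \<sigma> where u: "u = (s, \<sigma>)" "singular_simplex (Suc (Suc q)) (?Y s) \<sigma>"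
        by (cases u) auto
      then show ?case
        using chain_boundary_boundary_alt [of "Suc q" "?Y s" "frag_of \<sigma>"]
        by (simp add: grid_of grid_v_tensor singular_chain_of)
    qed auto
  qed (auto simp: grid_cell_diff grid_v_in grid_h_grid_v frag_snd_grid_v)
qed

theorem nerve_small_chains_correspondence:
  assumes cone: "\<And>s. \<lbrakk>s \<in> ordered_nerve X I U; length s \<le> Suc k\<rbrakk> \<Longrightarrow>
      \<exists>b K. cone_operator (int k + 1 - int (length s)) (subtopology X (\<Inter>i\<in>set s. U i)) b K"
    and "n \<le> k"
  shows "\<exists>R. homology_correspondence
      (nerve_cycles X I U n) (nerve_boundaries X I U n)
      (small_cycles n X (U ` I)) (small_boundaries n X (U ` I)) R"
proof -
  interpret augmented_grid "grid_cell X I U" "nerve_cell X I U" "\<lambda>p q. grid_h" "\<lambda>p q. grid_v q"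
           "\<lambda>p. frag_extend list_boundary" "\<lambda>p. frag_fst" k
    by (rule columns_augmented_grid [OF cone])
  \<comment> \<open>\<open>chain_boundary 0\<close> is zero, so in degree 0 every small chain is a
    cycle on both sides.\<close>
  have eq: "{c \<in> Collect (small_chain n X (U ` I)). \<forall>m. n = Suc m \<longrightarrow> chain_boundary (Suc m) c = 0} =
      (small_cycles n X (U ` I))"
    by (cases n) (auto simp: small_cycles_def chain_boundary_def)
  show ?thesis
    unfolding nerve_cycles_def nerve_boundaries_def small_boundaries_def eq [symmetric]
    by (rule grid_correspondence [OF rows_augmented_grid \<open>n \<le> k\<close>])
       (auto simp: frag_fst_in
          frag_snd_in frag_fst_grid_v_0 frag_snd_grid_h_0)
qed

section \<open>Cones over singular simplices\<close>

lemma continuous_map_Max: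
  assumes "finite I" "I \<noteq> {}" "\<And>i. i \<in> I \<Longrightarrow> continuous_map X euclideanreal (f i)"
  shows "continuous_map X euclideanreal (\<lambda>x. Max ((\<lambda>i. f i x) ` I))"
  using assms
proof (induction I rule: finite_ne_induct)
  case (insert i I)
  then have "(\<lambda>x. Max ((\<lambda>i. f i x) ` insert i I)) = (\<lambda>x. max (f i x) (Max ((\<lambda>i. f i x) ` I)))"
    by simp
  then show ?case
    using insert by (simp add: continuous_map_real_max)
qed simp

text \<open>The simplicial identity. It holds as an equation of functions, since both sides are
  \<open>undefined\<close> off the standard simplex.\<close>

lemma singular_face_singular_face:
  assumes "i \<le> j" "j \<le> Suc p"
  shows "singular_face (Suc p) i (singular_face (Suc (Suc p)) (Suc j) g) =
         singular_face (Suc p) j (singular_face (Suc (Suc p)) i g)"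
proof (rule ext)
  fix t
  show "singular_face (Suc p) i (singular_face (Suc (Suc p)) (Suc j) g) t =
        singular_face (Suc p) j (singular_face (Suc (Suc p)) i g) t"
  proof (cases "t \<in> standard_simplex p")
    case True
    have fi: "simplical_face i t \<in> standard_simplex (Suc p)"
      using True simplical_face_in_standard_simplex [of "Suc p" i t] assms by simp
    have fj: "simplical_face j t \<in> standard_simplex (Suc p)"
      using True simplical_face_in_standard_simplex [of "Suc p" j t] assms by simp
    have eq: "simplical_face (Suc j) (simplical_face i t) = simplical_face i (simplical_face j t)"
      using assms unfolding simplical_face_def by fastforce
    show ?thesis by (simp add: singular_face_def fi fj eq)
  qed (simp add: singular_face_def)
qed

section \<open>Radial comparison of simplices with balls\<close>

definition face_collapse :: "nat \<Rightarrow> (nat \<Rightarrow> real) \<Rightarrow> nat \<Rightarrow> real" where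
  "face_collapse i x = (\<lambda>j. if j < i then x j else x (Suc j))"

lemma face_collapse_simplical_face: "face_collapse i (simplical_face i t) = t"
  by (auto simp: face_collapse_def simplical_face_def)

lemma simplical_face_face_collapse: "x i = 0 \<Longrightarrow> simplical_face i (face_collapse i x) = x"
  by (auto simp: face_collapse_def simplical_face_def fun_eq_iff)

lemma face_collapse_in_standard_simplex:
  assumes x: "x \<in> standard_simplex (Suc p)" and i: "i \<le> Suc p" "x i = 0"
  shows "face_collapse i x \<in> standard_simplex p"
proof -
  have "(\<Sum>j\<le>Suc p. x j) = (\<Sum>j\<in>{..Suc p} - {i}. x j)"
    using i by (simp add: sum_diff1)
  also have "\<dots> = (\<Sum>j\<le>p. face_collapse i x j)"
    by (rule sum.reindex_bij_witness [where i = "\<lambda>j. if j < i then j else Suc j" and j = "\<lambda>j. if j < i then j else j - 1"])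
       (use i in \<open>auto simp: face_collapse_def\<close>)
  finally show ?thesis
    using x i by (auto simp: standard_simplex_def face_collapse_def)
qed

lemma continuous_map_face_collapse: "continuous_map (powertop_real UNIV) (powertop_real UNIV) (face_collapse i)"
  unfolding continuous_map_componentwise_UNIV face_collapse_def
  by (auto intro: continuous_map_product_projection)

text \<open>Centre the simplex at its barycenter, drop the last coordinate and divide. The product
  of the barycentric coordinates vanishes exactly on the boundary: there the denominator is the norm
  and the image lies on the sphere, while at the barycenter the product keeps it positive.\<close>

definition simplex_to_ball :: "nat \<Rightarrow> (nat \<Rightarrow> real) \<Rightarrow> nat \<Rightarrow> real" where
  "simplex_to_ball d x = (\<lambda>i. if i < d then (x i - 1 / (real d + 1)) /
     (sqrt (\<Sum>i<d. (x i - 1 / (real d + 1))\<^sup>2) + (\<Prod>j\<le>d. x j)) else 0)"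

text \<open>Restores the dropped coordinate: the vector of coordinate sum 0 with the given first
  \<open>d\<close> entries.\<close>

definition hyperplane_point :: "nat \<Rightarrow> (nat \<Rightarrow> real) \<Rightarrow> nat \<Rightarrow> real" where
  "hyperplane_point d w = (\<lambda>j. if j < d then w j else - (\<Sum>i<d. w i))"

text \<open>Radial projection to the boundary of the simplex. On a ray from the barycenter the
  coordinate with the most negative direction is the first to reach 0, and dividing by the maximum
  stops the ray there.\<close>

definition sphere_to_simplex :: "nat \<Rightarrow> (nat \<Rightarrow> real) \<Rightarrow> nat \<Rightarrow> real" where
  "sphere_to_simplex d w = (\<lambda>j. if j \<le> d then
     (1 + hyperplane_point d w j / Max ((\<lambda>j. - hyperplane_point d w j) ` {..d})) / (real d + 1) else 0)"

text \<open>The norm vanishes only at the barycenter, and there all coordinates are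
  positive.\<close>

lemma simplex_to_ball_denominator:
  assumes "x \<in> standard_simplex d"
  shows "sqrt (\<Sum>i<d. (x i - 1 / (real d + 1))\<^sup>2) + (\<Prod>j\<le>d. x j) > 0"
proof -
  have x: "\<And>i. 0 \<le> x i" "(\<Sum>i\<le>d. x i) = 1"
    using assms by (auto simp: standard_simplex_def)
  show ?thesis
  proof (cases "\<forall>i<d. x i = 1 / (real d + 1)")
    case True
    then have "(\<Sum>i<d. x i) = real d / (real d + 1)"
      by simp
    then have "x d = 1 - real d / (real d + 1)"
      using x(2) by (simp add: lessThan_Suc_atMost [symmetric])
    then have "x d = 1 / (real d + 1)"
      by (simp add: field_simps)
    then have "x d > 0"
      by simp
    then have "\<forall>j\<le>d. x j > 0"
      using True by (metis le_neq_implies_less add_pos_nonneg less_add_one divide_pos_pos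
          of_nat_0_le_iff zero_less_one add.commute)
    then have "(\<Prod>j\<le>d. x j) > 0"
      by (intro prod_pos) auto
    then show ?thesis
      by (simp add: add_nonneg_pos sum_nonneg)
  next
    case False
    then obtain i where "i < d" "x i \<noteq> 1 / (real d + 1)" by blast
    then have "(\<Sum>i<d. (x i - 1 / (real d + 1))\<^sup>2) > 0"
      by (intro sum_pos2 [of _ i]) auto
    then show ?thesis
      by (simp add: add_pos_nonneg prod_nonneg x)
  qed
qed

lemma continuous_map_simplex_to_ball:
  "continuous_map (subtopology (powertop_real UNIV) (standard_simplex d)) (unit_ball d) (simplex_to_ball d)"
proof -
  let ?X = "subtopology (powertop_real UNIV) (standard_simplex d)"
  have proj: "continuous_map ?X euclideanreal (\<lambda>x. x i)" for i
    by (intro continuous_map_from_subtopology continuous_map_product_projection) auto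
  have "continuous_map ?X (powertop_real UNIV) (simplex_to_ball d)"
    unfolding continuous_map_componentwise_UNIV
  proof
    fix i
    have "continuous_map ?X euclideanreal (\<lambda>x. (x i - 1 / (real d + 1)) /
     (sqrt (\<Sum>i<d. (x i - 1 / (real d + 1))\<^sup>2) + (\<Prod>j\<le>d. x j)))"
      using simplex_to_ball_denominator
      by (intro continuous_map_real_divide continuous_map_diff continuous_map_add continuous_map_sqrt
          continuous_map_sum continuous_map_prod continuous_map_real_pow proj) (auto simp: less_le)
    then show "continuous_map ?X euclideanreal (\<lambda>x. simplex_to_ball d x i)"
      by (simp add: simplex_to_ball_def)
  qed
  moreover have "(\<Sum>i<d. (simplex_to_ball d x i)\<^sup>2) \<le> 1" if x: "x \<in> standard_simplex d" for x
  proof -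
    define n where "n = sqrt (\<Sum>i<d. (x i - 1 / (real d + 1))\<^sup>2)"
    define r where "r = (\<Prod>j\<le>d. x j)"
    have "r \<ge> 0" unfolding r_def using x by (intro prod_nonneg) (auto simp: standard_simplex_def)
    have pos: "n + r > 0" using simplex_to_ball_denominator [OF x] by (simp add: n_def r_def)
    have "n \<ge> 0" by (simp add: n_def sum_nonneg)
    have "(\<Sum>i<d. (simplex_to_ball d x i)\<^sup>2) = (\<Sum>i<d. (x i - 1 / (real d + 1))\<^sup>2) / (n + r)\<^sup>2"
      by (simp add: simplex_to_ball_def power_divide sum_divide_distrib n_def r_def)
    also have "\<dots> = n\<^sup>2 / (n + r)\<^sup>2"
      by (simp add: n_def sum_nonneg)
    also have "\<dots> \<le> 1"
      using pos \<open>r \<ge> 0\<close> \<open>n \<ge> 0\<close> by (simp add: power_mono)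
    finally show ?thesis .
  qed
  ultimately show ?thesis
    unfolding unit_ball_def Euclidean_space_def subtopology_subtopology continuous_map_in_subtopology
    by (auto simp: simplex_to_ball_def)
qed

text \<open>With a vanishing coordinate the denominator is just the norm \<open>n\<close>. The
  maximum is then \<open>c / n\<close>, attained at the vanishing coordinate, and scaling back
  cancels \<open>n\<close>.\<close>

lemma simplex_to_ball_boundary:
  assumes "x \<in> standard_simplex d" "i \<le> d" "x i = 0"
  shows "simplex_to_ball d x \<in> topspace (unit_sphere d)"
    "sphere_to_simplex d (simplex_to_ball d x) = x"
proof -
  have x: "\<And>i. 0 \<le> x i" "(\<Sum>i\<le>d. x i) = 1"
    using assms by (auto simp: standard_simplex_def)
  define c where "c = 1 / (real d + 1)"
  have "c > 0" by (simp add: c_def)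
  define n where "n = sqrt (\<Sum>i<d. (x i - c)\<^sup>2)"
  have p0: "(\<Prod>j\<le>d. x j) = 0" using assms by auto
  have "n > 0" using simplex_to_ball_denominator [OF assms(1)] by (simp add: n_def c_def p0)
  have xn: "simplex_to_ball d x = (\<lambda>i. if i < d then (x i - c) / n else 0)"
    unfolding simplex_to_ball_def p0 n_def c_def by (simp only: add_0_right)
  have "(\<Sum>i<d. (x i - c)\<^sup>2) = n\<^sup>2"
    by (simp add: n_def sum_nonneg)
  then have "(\<Sum>i<d. (simplex_to_ball d x i)\<^sup>2) = 1"
    using \<open>n > 0\<close> by (simp add: xn power_divide flip: sum_divide_distrib)
  then show "simplex_to_ball d x \<in> topspace (unit_sphere d)"
    by (simp add: unit_sphere_def topspace_Euclidean_space xn)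
  have sx: "(\<Sum>i<d. x i) = 1 - x d"
    using x(2) by (simp add: lessThan_Suc_atMost [symmetric])
  have dc: "1 - real d * c = c"
    by (simp add: c_def field_simps)
  have hp: "hyperplane_point d (simplex_to_ball d x) j = (x j - c) / n" if "j \<le> d" for j
  proof (cases "j < d")
    case False
    then have "j = d" using that by simp
    then have "hyperplane_point d (simplex_to_ball d x) j = - ((\<Sum>i<d. x i - c) / n)"
      by (simp add: hyperplane_point_def xn sum_divide_distrib)
    also have "(\<Sum>i<d. x i - c) = c - x d"
      using dc by (simp add: sum_subtractf sx)
    also have "- ((c - x d) / n) = (x d - c) / n"
      by (simp add: minus_divide_left)
    finally show ?thesis using \<open>j = d\<close> by simp
  qed (simp add: hyperplane_point_def xn)
  have "Max ((\<lambda>j. - hyperplane_point d (simplex_to_ball d x) j) ` {..d}) = c / n"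
  proof (rule Max_eqI)
    show "c / n \<in> (\<lambda>j. - hyperplane_point d (simplex_to_ball d x) j) ` {..d}"
      using assms hp by (auto simp: image_iff intro!: bexI [of _ i])
    show "y \<le> c / n" if "y \<in> (\<lambda>j. - hyperplane_point d (simplex_to_ball d x) j) ` {..d}" for y
      using that hp x(1) \<open>n > 0\<close> by (auto simp: field_simps)
  qed auto
  note Max = this
  show "sphere_to_simplex d (simplex_to_ball d x) = x"
  proof
    fix j
    show "sphere_to_simplex d (simplex_to_ball d x) j = x j"
    proof (cases "j \<le> d")
      case True
      have "sphere_to_simplex d (simplex_to_ball d x) j = (1 + ((x j - c) / n) / (c / n)) * c"
        unfolding sphere_to_simplex_def Max hp [OF True] using True by (simp add: c_def)
      also have "\<dots> = x j"
        using \<open>n > 0\<close> \<open>c > 0\<close> by (simp add: distrib_right)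
      finally show ?thesis .
    next
      case False
      then show ?thesis
        using assms(1) by (simp add: sphere_to_simplex_def standard_simplex_def)
    qed
  qed
qed

lemma sum_hyperplane_point: "(\<Sum>j\<le>d. hyperplane_point d w j) = 0"
  by (simp add: lessThan_Suc_atMost [symmetric] hyperplane_point_def)

text \<open>A nonzero vector whose coordinates add up to 0 has a negative coordinate.\<close>

lemma Max_hyperplane_point_pos:
  assumes "w \<in> topspace (unit_sphere d)"
  shows "Max ((\<lambda>j. - hyperplane_point d w j) ` {..d}) > 0"
proof (rule ccontr)
  assume "\<not> ?thesis"
  then have nn: "0 \<le> hyperplane_point d w j" if "j \<le> d" for j
    using that by (subst (asm) not_less, subst (asm) Max_le_iff) auto
  then have "\<forall>j\<in>{..d}. hyperplane_point d w j = 0"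
    using sum_nonneg_eq_0_iff [of "{..d}" "hyperplane_point d w"] sum_hyperplane_point [of d w] by auto
  then have "\<forall>j<d. w j = 0"
    by (metis atMost_iff hyperplane_point_def less_imp_le)
  then show False
    using assms by (simp add: unit_sphere_def)
qed

definition simplex_boundary :: "nat \<Rightarrow> (nat \<Rightarrow> real) set" where
  "simplex_boundary d = {x \<in> standard_simplex d. \<exists>i\<le>d. x i = 0}"

lemma continuous_map_sphere_to_simplex:
  "continuous_map (unit_sphere d) (subtopology (powertop_real UNIV) (simplex_boundary d)) (sphere_to_simplex d)"
proof -
  let ?M = "\<lambda>w. Max ((\<lambda>j. - hyperplane_point d w j) ` {..d})"
  have proj: "continuous_map (unit_sphere d) euclideanreal (\<lambda>x. x i)" for i
    unfolding unit_sphere_def Euclidean_space_def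
    by (intro continuous_map_from_subtopology continuous_map_product_projection) auto
  have hp: "continuous_map (unit_sphere d) euclideanreal (\<lambda>w. hyperplane_point d w j)" for j
    by (cases "j < d") (auto simp: hyperplane_point_def intro!: continuous_map_minus continuous_map_sum proj)
  have M: "continuous_map (unit_sphere d) euclideanreal ?M"
    by (intro continuous_map_Max continuous_map_minus hp) auto
  have "continuous_map (unit_sphere d) (powertop_real UNIV) (sphere_to_simplex d)"
    unfolding continuous_map_componentwise_UNIV
  proof
    fix j
    have "continuous_map (unit_sphere d) euclideanreal
        (\<lambda>w. (1 + hyperplane_point d w j / ?M w) / (real d + 1))"
      using Max_hyperplane_point_pos [of _ d]
      by (intro continuous_map_real_divide continuous_map_add hp M) (auto simp: less_le)
    then show "continuous_map (unit_sphere d) euclideanreal (\<lambda>w. sphere_to_simplex d w j)"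
      by (simp add: sphere_to_simplex_def)
  qed
  moreover have "sphere_to_simplex d w \<in> simplex_boundary d" if w: "w \<in> topspace (unit_sphere d)" for w
  proof -
    have pos: "?M w > 0" by (rule Max_hyperplane_point_pos [OF w])
    have ge: "- ?M w \<le> hyperplane_point d w j" if "j \<le> d" for j
    proof -
      have "- hyperplane_point d w j \<le> ?M w"
        using that by (intro Max_ge) auto
      then show ?thesis by linarith
    qed
    have nn: "0 \<le> sphere_to_simplex d w j" for j
    proof (cases "j \<le> d")
      case True
      have "- 1 \<le> hyperplane_point d w j / ?M w"
        using ge [OF True] pos by (simp add: pos_le_divide_eq)
      then show ?thesis by (simp add: sphere_to_simplex_def)
    qed (simp add: sphere_to_simplex_def)
    have sum: "(\<Sum>j\<le>d. sphere_to_simplex d w j) = 1"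
    proof -
      have "(\<Sum>j\<le>d. sphere_to_simplex d w j) = (\<Sum>j\<le>d. 1 + hyperplane_point d w j / ?M w) / (real d + 1)"
        by (simp add: sphere_to_simplex_def sum_divide_distrib)
      also have "(\<Sum>j\<le>d. 1 + hyperplane_point d w j / ?M w) = real d + 1"
        using sum_hyperplane_point [of d w] by (simp add: sum.distrib flip: sum_divide_distrib)
      finally show ?thesis by simp
    qed
    have le: "sphere_to_simplex d w j \<le> 1" for j
    proof (cases "j \<le> d")
      case True
      then show ?thesis
        using member_le_sum [of j "{..d}" "sphere_to_simplex d w"] nn sum by simp
    qed (simp add: sphere_to_simplex_def)
    have "?M w \<in> (\<lambda>j. - hyperplane_point d w j) ` {..d}"
      by (rule Max_in) auto
    then obtain i where "i \<in> {..d}" "?M w = - hyperplane_point d w i" by (rule imageE)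
    then have i: "i \<le> d" "?M w = - hyperplane_point d w i" by simp_all
    then have "sphere_to_simplex d w i = 0"
      using pos by (simp add: sphere_to_simplex_def)
    then show ?thesis
      using nn le sum i by (auto simp: simplex_boundary_def standard_simplex_def sphere_to_simplex_def)
  qed
  ultimately show ?thesis
    by (auto simp: continuous_map_in_subtopology)
qed

text \<open>Sphere fillings in the form that singular simplices require. The prescribed faces glue
  to a map on the simplex boundary, which is moved to the sphere, filled over the ball and pulled
  back along \<open>simplex_to_ball\<close>; on the boundary the two comparison maps cancel.\<close>

lemma fill_simplex_boundary:
  assumes conn: "m_connected m Y" and m: "int q \<le> m"
    and f: "\<And>i. i \<le> Suc q \<Longrightarrow> singular_simplex q Y (f i)"
    and compat: "\<And>i j. \<lbrakk>0 < q; i < j; j \<le> Suc q\<rbrakk> \<Longrightarrow> singular_face q (j - 1) (f i) = singular_face q i (f j)"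
  obtains F where "singular_simplex (Suc q) Y F" "\<And>i. i \<le> Suc q \<Longrightarrow> singular_face (Suc q) i F = f i"
proof -
  let ?d = "Suc q"
  let ?B = "subtopology (powertop_real UNIV) (simplex_boundary ?d)"
  have agree: "f i (face_collapse i x) = f j (face_collapse j x)"
    if x: "x \<in> standard_simplex ?d" "i < j" "j \<le> ?d" "x i = 0" "x j = 0" for x i j
  proof -
    \<comment> \<open>The two coordinates of a point of a 1-simplex cannot vanish together, so faces
      overlap only for \<open>q > 0\<close>.\<close>
    have "0 < q"
    proof (rule ccontr)
      assume "\<not> 0 < q"
      then have "q = 0" "i = 0" "j = 1" using that by linarith+
      then have "x 0 = 0" "x 1 = 0" using that by blast+
      then have "(\<Sum>k\<le>?d. x k) = 0" using \<open>q = 0\<close> by simp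
      then show False using x(1) by (simp add: standard_simplex_def)
    qed
    \<comment> \<open>\<open>y\<close> is the point as seen in the common face. Deleting coordinate
      \<open>j\<close> first leaves the index \<open>i\<close> alone, whereas deleting
      \<open>i\<close> first turns \<open>j\<close> into \<open>j - 1\<close>.\<close>
    define y where "y = face_collapse i (face_collapse j x)"
    have cj: "face_collapse j x i = 0" using that by (simp add: face_collapse_def)
    have y1: "face_collapse j x = simplical_face i y"
      using simplical_face_face_collapse [of "face_collapse j x" i] cj by (simp add: y_def)
    have y2: "face_collapse i x = simplical_face (j - 1) y"
      using that by (fastforce simp: y_def fun_eq_iff face_collapse_def simplical_face_def)
    have "face_collapse j x \<in> standard_simplex q"
      using that by (intro face_collapse_in_standard_simplex) auto
    then have y: "y \<in> standard_simplex (q - Suc 0)"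
      unfolding y_def using cj that \<open>0 < q\<close>
      by (intro face_collapse_in_standard_simplex) auto
    have "singular_face q (j - 1) (f i) y = singular_face q i (f j) y"
      using compat that \<open>0 < q\<close> by simp
    then show ?thesis
      using y y1 y2 by (simp add: singular_face_def)
  qed
  \<comment> \<open>Any vanishing coordinate may be chosen; \<open>agree\<close> makes the value
    independent of it.\<close>
  define g where "g x = (let i = SOME i. i \<le> ?d \<and> x i = 0 in f i (face_collapse i x))" for x
  have g: "g x = f i (face_collapse i x)" if "x \<in> standard_simplex ?d" "i \<le> ?d" "x i = 0" for x i
  proof -
    define j where "j = (SOME i. i \<le> ?d \<and> x i = 0)"
    have j: "j \<le> ?d" "x j = 0"
      using someI [of "\<lambda>i. i \<le> ?d \<and> x i = 0" i] that by (auto simp: j_def)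
    have "g x = f j (face_collapse j x)" by (simp add: g_def j_def Let_def)
    also have "\<dots> = f i (face_collapse i x)"
    proof (cases i j rule: linorder_cases)
      case less
      show ?thesis by (rule agree [OF that(1) less j(1) that(3) j(2), symmetric])
    next
      case greater
      show ?thesis by (rule agree [OF that(1) greater that(2) j(2) that(3)])
    qed simp
    finally show ?thesis .
  qed
  have "continuous_map ?B Y g"
  proof (rule pasting_lemma_closed [where I = "{..?d}" and T = "\<lambda>i. {x \<in> simplex_boundary ?d. x i = 0}"
        and f = "\<lambda>i x. f i (face_collapse i x)"])
    fix i assume "i \<in> {..?d}"
    have "closedin ?B {x \<in> topspace ?B. x i \<in> {0}}"
      by (intro closedin_continuous_map_preimage [where Y = euclideanreal]
           continuous_map_from_subtopology continuous_map_product_projection) auto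
    then show "closedin ?B {x \<in> simplex_boundary ?d. x i = 0}"
      by simp
    have "continuous_map (subtopology (powertop_real UNIV) {x \<in> simplex_boundary ?d. x i = 0})
        (subtopology (powertop_real UNIV) (standard_simplex q)) (face_collapse i)"
      using continuous_map_face_collapse face_collapse_in_standard_simplex [of _ q i] \<open>i \<in> {..?d}\<close>
      by (auto simp: continuous_map_in_subtopology continuous_map_from_subtopology simplex_boundary_def)
    then have "continuous_map (subtopology (powertop_real UNIV) {x \<in> simplex_boundary ?d. x i = 0}) Y
        (f i \<circ> face_collapse i)"
      by (rule continuous_map_compose) (use f \<open>i \<in> {..?d}\<close> in \<open>simp add: singular_simplex_def\<close>)
    moreover have "simplex_boundary ?d \<inter> {x \<in> simplex_boundary ?d. x i = 0} = {x \<in> simplex_boundary ?d. x i = 0}"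
      by blast
    ultimately show "continuous_map (subtopology ?B {x \<in> simplex_boundary ?d. x i = 0}) Y
          (\<lambda>x. f i (face_collapse i x))"
      by (simp add: subtopology_subtopology o_def)
  next
    fix i j x
    assume "i \<in> {..?d}" "j \<in> {..?d}" "x \<in> topspace ?B \<inter> {x \<in> simplex_boundary ?d. x i = 0} \<inter>
         {x \<in> simplex_boundary ?d. x j = 0}"
    then show "f i (face_collapse i x) = f j (face_collapse j x)"
      using g [of x i] g [of x j] by (auto simp: simplex_boundary_def)
  next
    fix x assume "x \<in> topspace ?B"
    then show "\<exists>j. j \<in> {..?d} \<and> x \<in> {x \<in> simplex_boundary ?d. x j = 0} \<and> g x = f j (face_collapse j x)"
      using g by (auto simp: simplex_boundary_def)
  qed auto
  then have "continuous_map (unit_sphere ?d) Y (g \<circ> sphere_to_simplex ?d)"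
    using continuous_map_sphere_to_simplex continuous_map_compose by blast
  \<comment> \<open>\<open>unit_sphere (Suc q)\<close> has dimension \<open>q\<close>, whence the
    bound \<open>int q \<le> m\<close>.\<close>
  then obtain G where G: "continuous_map (unit_ball ?d) Y G"
    and Gg: "\<And>x. x \<in> topspace (unit_sphere ?d) \<Longrightarrow> G x = g (sphere_to_simplex ?d x)"
    using conn [unfolded m_connected_def, rule_format, of ?d "g \<circ> sphere_to_simplex ?d"] m by auto
  define F where "F = restrict (G \<circ> simplex_to_ball ?d) (standard_simplex ?d)"
  show thesis
  proof
    show "singular_simplex ?d Y F"
      using continuous_map_compose [OF continuous_map_simplex_to_ball G]
      by (simp add: F_def singular_simplex_def)
    fix i assume i: "i \<le> ?d"
    show "singular_face ?d i F = f i"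
    proof
      fix t
      show "singular_face ?d i F t = f i t"
      proof (cases "t \<in> standard_simplex q")
        case True
        define x where "x = simplical_face i t"
        have x: "x \<in> standard_simplex ?d" "x i = 0"
          using simplical_face_in_standard_simplex [of ?d i t] True i
          by (auto simp: x_def simplical_face_def)
        have "F x = g x"
          using Gg simplex_to_ball_boundary [OF x(1) i x(2)] x by (simp add: F_def)
        also have "\<dots> = f i t"
          using g [OF x(1) i x(2)] by (simp add: x_def face_collapse_simplical_face)
        finally show ?thesis
          using True by (simp add: singular_face_def x_def)
      next
        case False
        then show ?thesis
          using f [OF i] by (simp add: singular_face_def singular_simplex_def extensional_def)
      qed
    qed
  qed
qed

text \<open>Induction on the dimension: the cone over \<open>\<sigma>\<close> fills the sphere made
  of \<open>\<sigma>\<close> and the cones over its faces. Coherence is built in because the cone is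
  a function of the simplex, so a face shared by two simplices receives one cone.\<close>

lemma m_connected_imp_cone_operator:
  assumes conn: "m_connected m Y" and m: "- 1 \<le> m"
  shows "\<exists>b K. cone_operator m Y b K"
proof -
  have "m_connected (- 1) Y"
    using conn m unfolding m_connected_def by (meson order_trans)
  then obtain a where a: "a \<in> topspace Y"
    unfolding m_connected_minus_one by blast
  define b where "b = restrict (\<lambda>_. a) (standard_simplex 0)"
  have b: "singular_simplex 0 Y b"
    using a by (simp add: b_def singular_simplex_def)
  define fill where "fill q f = (SOME F. singular_simplex (Suc q) Y F \<and> (\<forall>i\<le>Suc q. singular_face (Suc q) i F = f i))"
    for q f
  have fill: "singular_simplex (Suc q) Y (fill q f)" "\<And>i. i \<le> Suc q \<Longrightarrow> singular_face (Suc q) i (fill q f) = f i"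
    if "int q \<le> m" "\<And>i. i \<le> Suc q \<Longrightarrow> singular_simplex q Y (f i)"
       "\<And>i j. \<lbrakk>0 < q; i < j; j \<le> Suc q\<rbrakk> \<Longrightarrow> singular_face q (j - 1) (f i) = singular_face q i (f j)" for q f
  proof -
    have "\<exists>F. singular_simplex (Suc q) Y F \<and> (\<forall>i\<le>Suc q. singular_face (Suc q) i F = f i)"
      using fill_simplex_boundary [of m Y q f] conn that by metis
    then have "singular_simplex (Suc q) Y (fill q f) \<and> (\<forall>i\<le>Suc q. singular_face (Suc q) i (fill q f) = f i)"
      unfolding fill_def by (rule someI_ex)
    then show "singular_simplex (Suc q) Y (fill q f)" "\<And>i. i \<le> Suc q \<Longrightarrow> singular_face (Suc q) i (fill q f) = f i"
      by auto
  qed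
  \<comment> \<open>In dimension 0 the cone is a path, and its other end is always the base point
    \<open>b\<close>.\<close>
  define K where "K = rec_nat (\<lambda>\<sigma>. fill 0 (\<lambda>i. if i = 0 then \<sigma> else b))
    (\<lambda>q K \<sigma>. fill (Suc q) (\<lambda>i. if i = 0 then \<sigma> else K (singular_face (Suc q) (i - 1) \<sigma>)))"
  have K0: "K 0 \<sigma> = fill 0 (\<lambda>i. if i = 0 then \<sigma> else b)" for \<sigma>
    by (simp add: K_def)
  have KS: "K (Suc q) \<sigma> = fill (Suc q) (\<lambda>i. if i = 0 then \<sigma> else K q (singular_face (Suc q) (i - 1) \<sigma>))" for q \<sigma>
    unfolding K_def by (simp only: old.nat.simps)
  have faces: "singular_simplex (Suc q) Y (K q \<sigma>) \<and> singular_face (Suc q) 0 (K q \<sigma>) = \<sigma> \<and>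
      (\<forall>i\<le>q. singular_face (Suc q) (Suc i) (K q \<sigma>) = (if q = 0 then b else K (q - 1) (singular_face q i \<sigma>)))"
    if "int q \<le> m" "singular_simplex q Y \<sigma>" for q \<sigma>
    using that
  proof (induction q arbitrary: \<sigma>)
    case 0
    then show ?case
      using fill [of 0 "\<lambda>i. if i = 0 then \<sigma> else b"] b by (auto simp: K0)
  next
    case (Suc q)
    define f where "f i = (if i = 0 then \<sigma> else K q (singular_face (Suc q) (i - 1) \<sigma>))" for i
    have q: "int q \<le> m" using Suc.prems by simp
    have face: "singular_simplex q Y (singular_face (Suc q) i \<sigma>)" if "i \<le> Suc q" for i
      using singular_simplex_singular_face [OF Suc.prems(2), of i] that by simp
    have "singular_simplex (Suc q) Y (f i)" if "i \<le> Suc (Suc q)" for i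
      using Suc.IH [OF q face, of "i - 1"] Suc.prems that by (auto simp: f_def)
    moreover have "singular_face (Suc q) (j - 1) (f i) = singular_face (Suc q) i (f j)"
      if ij: "i < j" "j \<le> Suc (Suc q)" for i j
    proof (cases i)
      case 0
      then show ?thesis
        using Suc.IH [OF q face, of "j - 1"] ij by (simp add: f_def)
    next
      case (Suc i')
      then obtain j' where j': "j = Suc (Suc j')" "i' \<le> j'" "j' \<le> q"
        using ij by (metis Suc_leD Suc_le_D Suc_le_mono Suc_leI)
      \<comment> \<open>Both sides are the cone over a common face of \<open>\<sigma>\<close>, or
        the base point when \<open>q = 0\<close>.\<close>
      have "singular_face (Suc q) (Suc j') (K q (singular_face (Suc q) i' \<sigma>)) =
            singular_face (Suc q) (Suc i') (K q (singular_face (Suc q) (Suc j') \<sigma>))"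
      proof (cases q)
        case 0
        then show ?thesis
          using Suc.IH [OF q face, of i'] Suc.IH [OF q face, of "Suc j'"] j' by simp
      next
        case (Suc r)
        have "singular_face q j' (singular_face (Suc q) i' \<sigma>) = singular_face q i' (singular_face (Suc q) (Suc j') \<sigma>)"
          using singular_face_singular_face [of i' j' r \<sigma>] j' Suc by simp
        then show ?thesis
          using Suc.IH [OF q face, of i'] Suc.IH [OF q face, of "Suc j'"] j' Suc by simp
      qed
      then show ?thesis
        using Suc j' by (simp add: f_def)
    qed
    ultimately have "singular_simplex (Suc (Suc q)) Y (fill (Suc q) f)"
      "\<And>i. i \<le> Suc (Suc q) \<Longrightarrow> singular_face (Suc (Suc q)) i (fill (Suc q) f) = f i"
      using fill [of "Suc q" f] Suc.prems by auto
    moreover have "K (Suc q) \<sigma> = fill (Suc q) f"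
      unfolding KS by (simp add: f_def [abs_def])
    ultimately show ?case
      by (simp add: f_def)
  qed
  have "chain_boundary (Suc q) (frag_of (K q \<sigma>)) =
          frag_of \<sigma> - (if q = 0 then frag_of b
                       else frag_extend (\<lambda>\<tau>. frag_of (K (q - 1) \<tau>)) (chain_boundary q (frag_of \<sigma>)))"
    if "int q \<le> m" "singular_simplex q Y \<sigma>" for q \<sigma>
  proof -
    let ?h = "\<lambda>i. if q = 0 then b else K (q - 1) (singular_face q i \<sigma>)"
    \<comment> \<open>Splitting off face 0 shifts the remaining indices by one, which reverses their
      signs.\<close>
    have "chain_boundary (Suc q) (frag_of (K q \<sigma>)) =
        frag_of \<sigma> + (\<Sum>i\<le>q. frag_cmul ((-1) ^ Suc i) (frag_of (?h i)))"
      using faces [OF that] unfolding chain_boundary_of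
      by (simp add: sum.atMost_Suc_shift del: sum.atMost_Suc power_Suc cong: if_cong)
    also have "(\<Sum>i\<le>q. frag_cmul ((-1) ^ Suc i) (frag_of (?h i))) = - (\<Sum>i\<le>q. frag_cmul ((-1) ^ i) (frag_of (?h i)))"
      by (simp flip: sum_negf)
    also have "(\<Sum>i\<le>q. frag_cmul ((-1) ^ i) (frag_of (?h i))) =
       (if q = 0 then frag_of b else frag_extend (\<lambda>\<tau>. frag_of (K (q - 1) \<tau>)) (chain_boundary q (frag_of \<sigma>)))"
      by (auto simp: chain_boundary_of frag_extend_sum frag_extend_cmul o_def)
    finally show ?thesis by simp
  qed
  then have "cone_operator m Y b K"
    unfolding cone_operator_def using b faces by blast
  then show ?thesis by blast
qed

section \<open>Small chains\<close>

text \<open>The relative homology of the singular chains modulo the small ones vanishes.\<close>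

definition excisive_cover :: "'a topology \<Rightarrow> 'a set set \<Rightarrow> bool" where
  "excisive_cover X \<U> \<longleftrightarrow>
     (\<forall>n c. singular_chain n X c \<longrightarrow> (\<forall>m. n = Suc m \<longrightarrow> small_chain m X \<U> (chain_boundary n c)) \<longrightarrow>
        (\<exists>d. singular_chain (Suc n) X d \<and> small_chain n X \<U> (c - chain_boundary (Suc n) d)))"

text \<open>A small cycle is related to every cycle homologous to it. Excision in degree
  \<open>n\<close> supplies small representatives; excision in degree \<open>n + 1\<close>, applied
  to a chain with small boundary, shows that a small cycle bounding in \<open>X\<close> bounds a
  small chain.\<close>

lemma excisive_cover_correspondence:
  assumes "excisive_cover X \<U>"
  shows "\<exists>R. homology_correspondence
      (small_cycles n X \<U>) (small_boundaries n X \<U>)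
      (singular_relcycle_set n X {}) (singular_relboundary_set n X {}) R"
proof -
  define R where "R = {(s, c). small_chain n X \<U> s \<and> chain_boundary n s = 0 \<and>
     singular_relcycle n X {} c \<and> singular_relboundary n X {} (c - s)}"
  have "homology_correspondence
      (small_cycles n X \<U>) (small_boundaries n X \<U>)
      (singular_relcycle_set n X {}) (singular_relboundary_set n X {}) R"
    unfolding homology_correspondence_def
  proof (intro conjI allI impI)
    show "R \<subseteq> small_cycles n X \<U> \<times> singular_relcycle_set n X {}"
      by (auto simp: R_def small_cycles_def)
    show "(z - w, z' - w') \<in> R" if "(z, z') \<in> R" "(w, w') \<in> R" for z z' w w'
    proof -
      have "singular_relboundary n X {} ((z' - z) - (w' - w))"
        by (rule singular_relboundary_diff) (use that in \<open>simp_all add: R_def\<close>)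
      moreover have "(z' - z) - (w' - w) = (z' - w') - (z - w)" by simp
      ultimately show ?thesis
        using that by (auto simp: R_def small_chain_diff chain_boundary_diff singular_relcycle_diff)
    qed
    show "small_cycles n X \<U> \<subseteq> Domain R"
      unfolding small_cycles_def
    proof clarify
      fix c assume "small_chain n X \<U> c" "chain_boundary n c = 0"
      then have "(c, c) \<in> R"
        by (simp add: R_def singular_cycle small_chain_imp_singular)
      then show "c \<in> Domain R" by blast
    qed
    show "singular_relcycle_set n X {} \<subseteq> Range R"
    proof clarify
      fix c assume "singular_relcycle n X {} c"
      then have c: "singular_chain n X c" "chain_boundary n c = 0"
        by (auto simp: singular_cycle)
      then obtain d where d: "singular_chain (Suc n) X d" "small_chain n X \<U> (c - chain_boundary (Suc n) d)"
        using assms unfolding excisive_cover_def by (metis small_chain_0)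
      have "chain_boundary n (c - chain_boundary (Suc n) d) = 0"
        using c d by (simp add: chain_boundary_diff chain_boundary_boundary_alt)
      then have "(c - chain_boundary (Suc n) d, c) \<in> R"
        using c d by (auto simp: R_def singular_cycle singular_boundary)
      then show "c \<in> Range R" by blast
    qed
    fix s c assume sc: "(s, c) \<in> R"
    have "singular_relboundary n X {} c \<longleftrightarrow> singular_relboundary n X {} s"
      using sc singular_relboundary_diff [of n X "{}" c "c - s"] singular_relboundary_add [of n X "{}" "c - s" s]
      by (auto simp: R_def)
    moreover have "singular_relboundary n X {} s \<longleftrightarrow> s \<in> small_boundaries n X \<U>"
    proof
      assume "singular_relboundary n X {} s"
      then obtain c where c: "singular_chain (Suc n) X c" "chain_boundary (Suc n) c = s"
        by (auto simp: singular_boundary)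
      moreover have "small_chain n X \<U> s" using sc by (simp add: R_def)
      ultimately obtain d where d: "singular_chain (Suc (Suc n)) X d"
        "small_chain (Suc n) X \<U> (c - chain_boundary (Suc (Suc n)) d)"
        using assms unfolding excisive_cover_def by (metis Suc_inject)
      have "chain_boundary (Suc n) (c - chain_boundary (Suc (Suc n)) d) = s"
        using c d by (simp add: chain_boundary_diff chain_boundary_boundary_alt)
      then show "s \<in> small_boundaries n X \<U>"
        using d by (auto simp: small_boundaries_def)
    next
      assume "s \<in> small_boundaries n X \<U>"
      then show "singular_relboundary n X {} s"
        by (auto simp: small_boundaries_def singular_boundary dest: small_chain_imp_singular)
    qed
    ultimately show "s \<in> small_boundaries n X \<U> \<longleftrightarrow>
       c \<in> singular_relboundary_set n X {}"
      by simp
  qed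
  then show ?thesis by blast
qed

lemma small_chain_image:
  assumes "small_chain q X \<U> c"
    and h: "\<And>V. V \<in> \<U> \<Longrightarrow> \<exists>W\<in>\<V>. \<forall>c. singular_chain q (subtopology X V) c \<longrightarrow> singular_chain r (subtopology Y W) (h c)"
    and diff: "\<And>c d. h (c - d) = h c - h d"
  shows "small_chain r Y \<V> (h c)"
  using assms(1) unfolding small_chain_def
proof (induction c rule: frag_induction)
  case zero
  have "h 0 = 0" using diff [of 0 0] by simp
  then show ?case by simp
next
  case (one \<sigma>)
  then obtain V where V: "V \<in> \<U>" "singular_simplex q (subtopology X V) \<sigma>" by blast
  obtain W where "W \<in> \<V>" "singular_chain r (subtopology Y W) (h (frag_of \<sigma>))"
    using h [OF V(1)] V(2) singular_chain_of by blast
  then show ?case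
    by (auto simp: singular_chain_def)
qed (simp add: diff keys_diff_subset)

text \<open>Enough subdivisions make \<open>c\<close> small. The chain homotopy to the identity
  keeps chains of each subspace in that subspace, so its value on the small boundary of
  \<open>c\<close> is again small.\<close>

lemma excisive_open_cover:
  assumes op: "\<And>U. U \<in> \<U> \<Longrightarrow> openin X U" and X: "topspace X \<subseteq> \<Union>\<U>"
  shows "excisive_cover X \<U>"
  unfolding excisive_cover_def
proof (intro allI impI)
  fix n and c :: "'a chain"
  assume c: "singular_chain n X c" and bc: "\<forall>m. n = Suc m \<longrightarrow> small_chain m X \<U> (chain_boundary n c)"
  obtain r where r: "\<And>m f. \<lbrakk>r \<le> m; f \<in> Poly_Mapping.keys ((singular_subdivision n ^^ m) c)\<rbrakk>
                      \<Longrightarrow> \<exists>V \<in> \<U>. f \<in> (standard_simplex n) \<rightarrow> V"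
    using sufficient_iterated_singular_subdivision_exists [OF op X c] by blast
  obtain h where h: "\<And>p. h p 0 = (0 :: 'a chain)"
        "\<And>p c1 c2. h p (c1-c2) = h p c1 - h p c2"
        "\<And>p X c. singular_chain p X c \<Longrightarrow> singular_chain (Suc p) X (h p c)"
        "\<And>p X c. singular_chain p X c
                 \<Longrightarrow> chain_boundary (Suc p) (h p c) + h (p - Suc 0) (chain_boundary p c)
                   = (singular_subdivision p ^^ r) c - c"
    using chain_homotopic_iterated_singular_subdivision by blast
  have "singular_chain n X ((singular_subdivision n ^^ m) c)" for m
    by (induction m) (auto simp: c singular_chain_singular_subdivision)
  then have sc: "Poly_Mapping.keys ((singular_subdivision n ^^ r) c) \<subseteq> singular_simplex_set n X"
    by (simp add: singular_chain_def)
  have small: "small_chain n X \<U> ((singular_subdivision n ^^ r) c)"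
    unfolding small_chain_def
  proof clarify
    fix \<sigma> assume \<sigma>: "\<sigma> \<in> Poly_Mapping.keys ((singular_subdivision n ^^ r) c)"
    then obtain V where "V \<in> \<U>" "\<sigma> \<in> standard_simplex n \<rightarrow> V"
      using r [OF order_refl \<sigma>] by blast
    moreover have "singular_simplex n X \<sigma>" using sc \<sigma> by blast
    ultimately show "\<exists>V\<in>\<U>. singular_simplex n (subtopology X V) \<sigma>"
      by (auto simp: singular_simplex_subtopology)
  qed
  have "small_chain n X \<U> (h (n - Suc 0) (chain_boundary n c))"
  proof (cases n)
    case 0
    then show ?thesis by (simp add: chain_boundary_def h(1))
  next
    case (Suc m)
    have "small_chain (Suc m) X \<U> (h m (chain_boundary n c))"
      by (rule small_chain_image [where X = X and \<U> = \<U> and q = m]) (use h bc Suc in blast)+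
    then show ?thesis using Suc by simp
  qed
  then have "small_chain n X \<U> ((singular_subdivision n ^^ r) c - h (n - Suc 0) (chain_boundary n c))"
    by (rule small_chain_diff [OF small])
  \<comment> \<open>The witness is \<open>- h n c\<close>: the homotopy formula leaves the
    subdivided chain and the term over the boundary.\<close>
  moreover have "c - chain_boundary (Suc n) (- h n c) = (singular_subdivision n ^^ r) c - h (n - Suc 0) (chain_boundary n c)"
    using h(4) [OF c] by (simp add: chain_boundary_minus algebra_simps)
  ultimately show "\<exists>d. singular_chain (Suc n) X d \<and> small_chain n X \<U> (c - chain_boundary (Suc n) d)"
    using h(3) [OF c] by (metis singular_chain_minus)
qed

section \<open>A natural chain homotopy\<close>

definition simplex_space :: "nat \<Rightarrow> (nat \<Rightarrow> real) topology" where
  "simplex_space p = subtopology (powertop_real UNIV) (standard_simplex p)"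

definition cylinder :: "'a topology \<Rightarrow> (real \<times> 'a) topology" where
  "cylinder X = prod_topology (top_of_set {0..1}) X"

text \<open>The universal simplex, of which every singular simplex is an image. It is restricted
  because singular simplices are extensional.\<close>

definition id_simplex :: "nat \<Rightarrow> (nat \<Rightarrow> real) chain" where
  "id_simplex p = frag_of (restrict id (standard_simplex p))"

lemma singular_chain_id_simplex: "singular_chain p (simplex_space p) (id_simplex p)"
  by (auto simp: id_simplex_def simplex_space_def singular_chain_of singular_simplex_def
      continuous_map_in_subtopology continuous_map_from_subtopology)

lemma chain_map_id_simplex: "singular_simplex p X \<sigma> \<Longrightarrow> chain_map p \<sigma> (id_simplex p) = frag_of \<sigma>"
  unfolding id_simplex_def by (rule singular_simplex_chain_map_id)

lemma continuous_map_singular_simplex: "singular_simplex p X \<sigma> \<Longrightarrow> continuous_map (simplex_space p) X \<sigma>"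
  by (simp add: singular_simplex_def simplex_space_def)

lemma contractible_simplex_space: "contractible_space (simplex_space p)"
proof -
  obtain a where a: "a \<in> standard_simplex p" using nonempty_standard_simplex by blast
  have "continuous_map (cylinder (simplex_space p)) (powertop_real UNIV)
          (\<lambda>(t, x) i. (1 - t) * x i + t * a i)"
    unfolding continuous_map_componentwise_UNIV cylinder_def simplex_space_def case_prod_unfold
    by (intro allI continuous_map_add continuous_map_real_mult continuous_map_diff continuous_map_into_fulltopology
        [OF continuous_map_fst] continuous_map_compose [OF continuous_map_snd, unfolded o_def]
        continuous_map_from_subtopology continuous_map_product_projection) auto
  then have "continuous_map (cylinder (simplex_space p)) (simplex_space p)
          (\<lambda>(t, x) i. (1 - t) * x i + t * a i)"
    using a by (auto simp: simplex_space_def cylinder_def continuous_map_in_subtopology convex_standard_simplex)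
  then have "homotopic_with (\<lambda>x. True) (simplex_space p) (simplex_space p) (\<lambda>x. x) (\<lambda>x. a)"
    unfolding homotopic_with_def cylinder_def
    by (intro exI [of _ "\<lambda>(t, x) i. (1 - t) * x i + t * a i"]) simp
  then show ?thesis
    unfolding contractible_space_def id_def by blast
qed

text \<open>Acyclicity in positive degrees, brought back from homology groups to chains; it produces
  the prisms above dimension 0.\<close>

lemma contractible_cycle_boundary:
  assumes "contractible_space X" "singular_chain (Suc p) X c" "chain_boundary (Suc p) c = 0"
  shows "\<exists>d. singular_chain (Suc (Suc p)) X d \<and> chain_boundary (Suc (Suc p)) d = c"
proof -
  have "trivial_group (homology_group (int (Suc p)) X)"
    using trivial_reduced_homology_group_contractible_space [OF assms(1), of "int (Suc p)"]
    by (simp add: un_reduced_homology_group)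
  then have "homologous_rel_set (Suc p) X {} ` singular_relcycle_set (Suc p) X {} = {singular_relboundary_set (Suc p) X {}}"
    unfolding trivial_group_def carrier_relative_homology_group one_relative_homology_group by (rule conjunct2)
  moreover have "singular_relcycle (Suc p) X {} c"
    using assms by (simp add: singular_cycle)
  ultimately have "homologous_rel_set (Suc p) X {} c = singular_relboundary_set (Suc p) X {}"
    by (metis (no_types, lifting) imageI mem_Collect_eq singletonD)
  then show ?thesis
    by (simp add: homologous_rel_set_eq_relboundary singular_boundary)
qed

text \<open>One chain \<open>P\<close> in the prism over the standard simplex is transported to
  every singular simplex, which makes the construction natural in spaces and homotopies.\<close>

definition prism_map ::
  "(real \<times> (nat \<Rightarrow> real)) chain \<Rightarrow> nat \<Rightarrow> (real \<times> 'a \<Rightarrow> 'b) \<Rightarrow> 'a chain \<Rightarrow> 'b chain" where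
  "prism_map P q h = frag_extend (\<lambda>\<sigma>. chain_map (Suc q) (\<lambda>(t, x). h (t, \<sigma> x)) P)"

lemma prism_map_simps [simp]:
  "prism_map P q h 0 = 0" "prism_map P q h (c - d) = prism_map P q h c - prism_map P q h d"
  by (simp_all add: prism_map_def frag_extend_diff)

lemma continuous_map_prism:
  assumes "singular_simplex q X \<sigma>" "continuous_map (cylinder X) Y h"
  shows "continuous_map (cylinder (simplex_space q)) Y (\<lambda>(t, x). h (t, \<sigma> x))"
proof -
  have "continuous_map (cylinder (simplex_space q)) (cylinder X) (\<lambda>z. (fst z, \<sigma> (snd z)))"
    unfolding cylinder_def
    by (intro continuous_map_pairedI continuous_map_fst
        continuous_map_compose [OF continuous_map_snd continuous_map_singular_simplex [OF assms(1)], unfolded o_def])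
  then show ?thesis
    using continuous_map_compose [OF _ assms(2)] by (fastforce simp: o_def case_prod_unfold)
qed

lemma singular_chain_prism_map:
  assumes P: "singular_chain (Suc q) (cylinder (simplex_space q)) P"
    and h: "continuous_map (cylinder X) Y h" and c: "singular_chain q X c"
  shows "singular_chain (Suc q) Y (prism_map P q h c)"
  unfolding prism_map_def
proof (rule singular_chain_extend)
  fix \<sigma> assume "\<sigma> \<in> Poly_Mapping.keys c"
  then have "singular_simplex q X \<sigma>" using c by (auto simp: singular_chain_def)
  then show "singular_chain (Suc q) Y (chain_map (Suc q) (\<lambda>(t, x). h (t, \<sigma> x)) P)"
    by (intro singular_chain_chain_map [OF P] continuous_map_prism [OF _ h])
qed

lemma chain_map_prism_map:
  "chain_map (Suc q) g (prism_map P q h c) = prism_map P q (g \<circ> h) c"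
proof (rule frag_induction [of c UNIV])
  have "g \<circ> (\<lambda>(t, x). h (t, \<sigma> x)) = (\<lambda>(t, x). (g \<circ> h) (t, \<sigma> x))" for \<sigma> :: "(nat \<Rightarrow> real) \<Rightarrow> 'c"
    by auto
  then show "chain_map (Suc q) g (prism_map P q h (frag_of \<sigma>)) = prism_map P q (g \<circ> h) (frag_of \<sigma>)" for \<sigma>
    unfolding prism_map_def frag_extend_of
    by (metis chain_map_compose comp_apply)
qed (auto simp: chain_map_diff)

text \<open>The simplices of \<open>chain_map q f\<close> follow \<open>f\<close> only over the
  standard simplex, hence \<open>P\<close> has to lie in the prism over it.\<close>

lemma prism_map_chain_map:
  assumes P: "singular_chain (Suc q) (cylinder (simplex_space q)) P"
  shows "prism_map P q h (chain_map q f c) = prism_map P q (\<lambda>(t, x). h (t, f x)) c"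
proof (rule frag_induction [of c UNIV])
  show "prism_map P q h (chain_map q f (frag_of \<sigma>)) = prism_map P q (\<lambda>(t, x). h (t, f x)) (frag_of \<sigma>)" for \<sigma>
    unfolding prism_map_def frag_extend_of chain_map_of
    by (rule chain_map_eq [OF P]) (auto simp: cylinder_def simplex_space_def simplex_map_def)
qed (auto simp: chain_map_diff)

text \<open>\<open>P\<close> triangulates the prism over the \<open>p\<close>-simplex, given a triangulation \<open>P'\<close> of the prisms over
  its faces.\<close>

definition prism_chain :: "nat \<Rightarrow> (real \<times> (nat \<Rightarrow> real)) chain \<Rightarrow> (real \<times> (nat \<Rightarrow> real)) chain \<Rightarrow> bool" where
  "prism_chain p P' P \<longleftrightarrow> singular_chain (Suc p) (cylinder (simplex_space p)) P \<and>
     chain_boundary (Suc p) P = chain_map p (Pair 1) (id_simplex p) - chain_map p (Pair 0) (id_simplex p)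
        - (if p = 0 then 0 else prism_map P' (p - 1) id (chain_boundary p (id_simplex p)))"

lemma continuous_map_cylinder_end: "t \<in> {0..1} \<Longrightarrow> continuous_map X (cylinder X) (Pair t)"
  unfolding cylinder_def by (intro continuous_map_pairedI) auto

text \<open>The method of acyclic models: on a generator \<open>\<sigma>\<close> the formula is the
  defining equation of \<open>P\<close> for the universal simplex, transported along
  \<open>\<sigma>\<close>.\<close>

lemma chain_boundary_prism_map:
  assumes P: "prism_chain q P' P"
    and P': "q > 0 \<Longrightarrow> singular_chain q (cylinder (simplex_space (q - 1))) P'"
    and h: "continuous_map (cylinder X) Y h" and c: "singular_chain q X c"
  shows "chain_boundary (Suc q) (prism_map P q h c) =
     chain_map q (\<lambda>x. h (1, x)) c - chain_map q (\<lambda>x. h (0, x)) c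
       - (if q = 0 then 0 else prism_map P' (q - 1) h (chain_boundary q c))"
  using c unfolding singular_chain_def
proof (induction c rule: frag_induction)
  case (one \<sigma>)
  then have \<sigma>: "singular_simplex q X \<sigma>" by simp
  define k where "k = (\<lambda>(t, x). h (t, \<sigma> x))"
  have PS: "singular_chain (Suc q) (cylinder (simplex_space q)) P"
    using P by (simp add: prism_chain_def)
  have ends: "chain_map q k (chain_map q (Pair t) (id_simplex q)) = chain_map q (\<lambda>x. h (t, x)) (frag_of \<sigma>)" for t
  proof -
    have "k \<circ> Pair t = (\<lambda>x. h (t, x)) \<circ> \<sigma>" by (auto simp: k_def)
    then have "chain_map q k (chain_map q (Pair t) (id_simplex q)) =
          chain_map q (\<lambda>x. h (t, x)) (chain_map q \<sigma> (id_simplex q))"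
      by (metis chain_map_compose comp_apply)
    then show ?thesis by (simp only: chain_map_id_simplex [OF \<sigma>])
  qed
  have side: "chain_map q k (prism_map P' (q - 1) id (chain_boundary q (id_simplex q))) =
        prism_map P' (q - 1) h (chain_boundary q (frag_of \<sigma>))" if "q > 0"
  proof -
    have "chain_map q k (prism_map P' (q - 1) id (chain_boundary q (id_simplex q))) =
          prism_map P' (q - 1) k (chain_boundary q (id_simplex q))"
      using chain_map_prism_map [of "q - 1" k P' id] that by simp
    also have "\<dots> = prism_map P' (q - 1) h (chain_map (q - 1) \<sigma> (chain_boundary q (id_simplex q)))"
      unfolding k_def using P' that by (intro prism_map_chain_map [symmetric]) auto
    also have "chain_map (q - 1) \<sigma> (chain_boundary q (id_simplex q)) = chain_boundary q (frag_of \<sigma>)"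
      using chain_boundary_chain_map [OF singular_chain_id_simplex, of q \<sigma>] chain_map_id_simplex [OF \<sigma>] by simp
    finally show ?thesis .
  qed
  have "prism_map P q h (frag_of \<sigma>) = chain_map (Suc q) k P"
    by (simp add: prism_map_def k_def)
  then have "chain_boundary (Suc q) (prism_map P q h (frag_of \<sigma>)) = chain_map q k (chain_boundary (Suc q) P)"
    using chain_boundary_chain_map [OF PS, of k] by simp
  also have "chain_boundary (Suc q) P = chain_map q (Pair 1) (id_simplex q) - chain_map q (Pair 0) (id_simplex q)
        - (if q = 0 then 0 else prism_map P' (q - 1) id (chain_boundary q (id_simplex q)))"
    using P by (simp add: prism_chain_def)
  finally show ?case
    using ends side by (auto simp: chain_map_diff)
next
  case (diff a b)
  then show ?case
    by (auto simp: chain_boundary_diff chain_map_diff)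
qed auto

text \<open>The prescribed boundary of the next prism is a cycle by the formula one dimension lower,
  and the prism is contractible, so this cycle bounds.\<close>

lemma prism_chain_step:
  assumes P: "prism_chain p P' P" and P': "p > 0 \<Longrightarrow> singular_chain p (cylinder (simplex_space (p - 1))) P'"
  shows "\<exists>Q. prism_chain (Suc p) P Q"
proof -
  let ?q = "Suc p" and ?\<iota> = "id_simplex (Suc p)"
  let ?Q = "chain_map ?q (Pair 1) ?\<iota> - chain_map ?q (Pair 0) ?\<iota> - prism_map P p id (chain_boundary ?q ?\<iota>)"
  have PS: "singular_chain (Suc p) (cylinder (simplex_space p)) P"
    using P by (simp add: prism_chain_def)
  have b: "singular_chain p (simplex_space ?q) (chain_boundary ?q ?\<iota>)"
    by (rule singular_chain_boundary_alt [OF singular_chain_id_simplex])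
  have idc: "continuous_map (cylinder (simplex_space ?q)) (cylinder (simplex_space ?q)) id"
    by simp
  have Q: "singular_chain ?q (cylinder (simplex_space ?q)) ?Q"
    by (intro singular_chain_diff singular_chain_chain_map [OF singular_chain_id_simplex]
        continuous_map_cylinder_end singular_chain_prism_map [OF PS idc b]) auto
  have ends: "chain_boundary ?q (chain_map ?q (Pair t) ?\<iota>) = chain_map p (Pair t) (chain_boundary ?q ?\<iota>)"
    for t :: real
    using chain_boundary_chain_map [OF singular_chain_id_simplex, of ?q "Pair t"] by simp
  have "chain_boundary ?q (prism_map P p id (chain_boundary ?q ?\<iota>)) =
      chain_map p (Pair 1) (chain_boundary ?q ?\<iota>) - chain_map p (Pair 0) (chain_boundary ?q ?\<iota>)"
    using chain_boundary_prism_map [OF P P' idc b] chain_boundary_boundary_alt [OF singular_chain_id_simplex]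
    by simp
  then have "chain_boundary ?q ?Q = 0"
    by (simp add: chain_boundary_diff ends)
  moreover have "contractible {0..1::real}"
    by (rule convex_imp_contractible) (rule convex_real_interval)
  then have "contractible_space (cylinder (simplex_space ?q))"
    unfolding cylinder_def contractible_space_prod_topology contractible_space_top_of_set
    using contractible_simplex_space by blast
  ultimately obtain R where "singular_chain (Suc ?q) (cylinder (simplex_space ?q)) R"
    "chain_boundary (Suc ?q) R = ?Q"
    using contractible_cycle_boundary [OF _ Q] by blast
  then show ?thesis
    unfolding prism_chain_def by auto
qed

lemma prism_chain_0: "\<exists>P. prism_chain 0 P' P"
proof -
  \<comment> \<open>The identity of the cylinder is a homotopy between its two ends; the empty sets
    specialize a statement on pairs to single spaces.\<close>
  have "homotopic_with (\<lambda>h. h \<in> {} \<rightarrow> {}) (simplex_space 0) (cylinder (simplex_space 0)) (Pair 0) (Pair 1)"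
    unfolding homotopic_with_def by (intro exI [of _ id]) (auto simp: cylinder_def)
  moreover have "singular_relcycle 0 (simplex_space 0) {} (id_simplex 0)"
    using singular_chain_id_simplex [of 0] by (simp add: singular_cycle chain_boundary_def)
  ultimately have "homologous_rel 0 (cylinder (simplex_space 0)) {}
      (chain_map 0 (Pair 1) (id_simplex 0)) (chain_map 0 (Pair 0) (id_simplex 0))"
    by (metis homotopic_imp_homologous_rel_chain_maps homologous_rel_sym)
  then show ?thesis
    by (auto simp: homologous_rel_def singular_boundary prism_chain_def)
qed

lemma prism_chains_exist:
  obtains P where "\<And>p. prism_chain p (P (p - 1)) (P p)"
proof -
  define S where "S = rec_nat (SOME P. prism_chain 0 0 P) (\<lambda>p P'. SOME P. prism_chain (Suc p) P' P)"
  \<comment> \<open>In dimension 0 \<open>prism_chain\<close> means the same for every first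
    argument, so the truncated index \<open>p - 1\<close> may be read as 0 there.\<close>
  have S0: "prism_chain 0 P' (S 0)" for P'
    using someI_ex [OF prism_chain_0 [of 0]] by (simp add: S_def prism_chain_def)
  have "prism_chain p (S (p - 1)) (S p) \<and> prism_chain (Suc p) (S p) (S (Suc p))" for p
  proof (induction p)
    case 0
    have "\<exists>Q. prism_chain (Suc 0) (S 0) Q"
      using prism_chain_step [OF S0] by simp
    then show ?case
      using S0 by (simp add: S_def someI_ex)
  next
    case (Suc p)
    then have "\<exists>Q. prism_chain (Suc (Suc p)) (S (Suc p)) Q"
      by (intro prism_chain_step [of _ "S p"]) (auto simp: prism_chain_def)
    then show ?case
      using Suc by (simp add: S_def someI_ex)
  qed
  then show thesis
    using that by blast
qed

text \<open>For \<open>q = 0\<close> the truncated index \<open>q - 1\<close> does no harm: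
  \<open>chain_boundary 0\<close> is zero and \<open>H\<close> sends 0 to 0.\<close>

definition chain_homotopy_operator :: "((real \<times> 'a \<Rightarrow> 'b) \<Rightarrow> nat \<Rightarrow> 'a chain \<Rightarrow> 'b chain) \<Rightarrow> bool" where
  "chain_homotopy_operator H \<longleftrightarrow>
     (\<forall>h q. H h q 0 = 0) \<and> (\<forall>h q c d. H h q (c - d) = H h q c - H h q d) \<and>
     (\<forall>h q X Y c. continuous_map (cylinder X) Y h \<longrightarrow> singular_chain q X c \<longrightarrow>
       singular_chain (Suc q) Y (H h q c) \<and>
       chain_boundary (Suc q) (H h q c) + H h (q - 1) (chain_boundary q c) =
       chain_map q (\<lambda>x. h (1, x)) c - chain_map q (\<lambda>x. h (0, x)) c)"

text \<open>One operator serves all spaces and homotopies, so it preserves every subspace that the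
  homotopy preserves; \<open>homotopic_imp_homologous_rel_chain_maps\<close> only controls one subspace.\<close>

proposition chain_homotopy_operator_exists:
  "\<exists>H :: (real \<times> 'a \<Rightarrow> 'b) \<Rightarrow> nat \<Rightarrow> 'a chain \<Rightarrow> 'b chain. chain_homotopy_operator H"
proof -
  obtain P where P: "\<And>p. prism_chain p (P (p - 1)) (P p)"
    using prism_chains_exist by blast
  then have PS: "\<And>p. singular_chain (Suc p) (cylinder (simplex_space p)) (P p)"
    by (auto simp: prism_chain_def)
  have *: "singular_chain (Suc q) Y (prism_map (P q) q h c)"
    "chain_boundary (Suc q) (prism_map (P q) q h c) + prism_map (P (q - 1)) (q - 1) h (chain_boundary q c) =
       chain_map q (\<lambda>x. h (1, x)) c - chain_map q (\<lambda>x. h (0, x)) c"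
    if h: "continuous_map (cylinder X) Y h" and c: "singular_chain q X c"
    for h :: "real \<times> 'a \<Rightarrow> 'b" and q X Y c
  proof -
    show "singular_chain (Suc q) Y (prism_map (P q) q h c)"
      by (rule singular_chain_prism_map [OF PS h c])
    show "chain_boundary (Suc q) (prism_map (P q) q h c) + prism_map (P (q - 1)) (q - 1) h (chain_boundary q c) =
       chain_map q (\<lambda>x. h (1, x)) c - chain_map q (\<lambda>x. h (0, x)) c"
    proof (cases q)
      case 0
      then show ?thesis
        using chain_boundary_prism_map [OF P _ h c] by (simp add: chain_boundary_def)
    next
      case (Suc p)
      then show ?thesis
        using chain_boundary_prism_map [OF P _ h c] PS [of "q - 1"] by simp
    qed
  qed
  have "chain_homotopy_operator (\<lambda>(h :: real \<times> 'a \<Rightarrow> 'b) q. prism_map (P q) q h)"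
    unfolding chain_homotopy_operator_def
    by (intro conjI allI impI) (rule prism_map_simps | rule *, assumption, assumption)+
  then show ?thesis by blast
qed

section \<open>Excision for CW-complexes\<close>

definition enorm :: "nat \<Rightarrow> (nat \<Rightarrow> real) \<Rightarrow> real" where
  "enorm d z = sqrt (\<Sum>i<d. (z i)\<^sup>2)"

definition escale :: "real \<Rightarrow> (nat \<Rightarrow> real) \<Rightarrow> nat \<Rightarrow> real" where
  "escale r z = (\<lambda>i. r * z i)"

lemma enorm_nonneg [simp]: "0 \<le> enorm d z"
  by (simp add: enorm_def sum_nonneg)

lemma enorm_escale: "enorm d (escale r z) = \<bar>r\<bar> * enorm d z"
  by (simp add: enorm_def escale_def power_mult_distrib real_sqrt_mult flip: sum_distrib_left)

lemma escale_1 [simp]: "escale 1 z = z"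
  by (simp add: escale_def)

lemma topspace_unit_ball: "topspace (unit_ball d) = {z. (\<forall>i\<ge>d. z i = 0) \<and> enorm d z \<le> 1}"
  by (auto simp: unit_ball_def topspace_Euclidean_space enorm_def)

lemma topspace_unit_sphere: "topspace (unit_sphere d) = {z. (\<forall>i\<ge>d. z i = 0) \<and> enorm d z = 1}"
  by (auto simp: unit_sphere_def topspace_Euclidean_space enorm_def)

lemma topspace_open_unit_ball: "topspace (open_unit_ball d) = {z. (\<forall>i\<ge>d. z i = 0) \<and> enorm d z < 1}"
  by (auto simp: open_unit_ball_def topspace_Euclidean_space enorm_def)

lemma unit_ball_eq_subtopology: "unit_ball d = subtopology (powertop_real UNIV) (topspace (unit_ball d))"
  by (simp add: unit_ball_def Euclidean_space_def subtopology_subtopology)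

lemma unit_sphere_eq_subtopology: "unit_sphere d = subtopology (unit_ball d) (topspace (unit_sphere d))"
  by (subst unit_ball_eq_subtopology)
     (auto simp: unit_ball_def unit_sphere_def Euclidean_space_def subtopology_subtopology intro!: arg_cong [where f = "subtopology _"])

lemma continuous_map_unit_ball_proj: "continuous_map (unit_ball d) euclideanreal (\<lambda>z. z i)"
  unfolding unit_ball_def Euclidean_space_def
  by (intro continuous_map_from_subtopology continuous_map_product_projection) auto

lemma continuous_map_enorm:
  assumes "continuous_map X (unit_ball d) f"
  shows "continuous_map X euclideanreal (\<lambda>x. enorm d (f x))"
  unfolding enorm_def
  by (intro continuous_map_sqrt continuous_map_sum continuous_map_real_pow
      continuous_map_compose [OF assms continuous_map_unit_ball_proj, unfolded o_def]) auto

lemma continuous_map_into_unit_ball: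
  assumes "\<And>i. continuous_map X euclideanreal (\<lambda>x. f x i)" "f \<in> topspace X \<rightarrow> topspace (unit_ball d)"
  shows "continuous_map X (unit_ball d) f"
  using assms
  by (subst unit_ball_eq_subtopology) (simp add: continuous_map_in_subtopology continuous_map_componentwise_UNIV)

lemma continuous_map_escale:
  assumes r: "continuous_map X euclideanreal r" and f: "continuous_map X (unit_ball d) f"
    and le: "\<And>x. x \<in> topspace X \<Longrightarrow> enorm d (escale (r x) (f x)) \<le> 1"
  shows "continuous_map X (unit_ball d) (\<lambda>x. escale (r x) (f x))"
proof (rule continuous_map_into_unit_ball)
  show "continuous_map X euclideanreal (\<lambda>x. escale (r x) (f x) i)" for i
    unfolding escale_def
    by (intro continuous_map_real_mult r continuous_map_compose [OF f continuous_map_unit_ball_proj, unfolded o_def])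
  show "(\<lambda>x. escale (r x) (f x)) \<in> topspace X \<rightarrow> topspace (unit_ball d)"
    using le continuous_map_funspace [OF f]
    by (auto simp: topspace_unit_ball escale_def Pi_iff)
qed

lemma continuous_map_enorm_ball: "continuous_map (unit_ball d) euclideanreal (enorm d)"
  using continuous_map_enorm [of "unit_ball d" d id] by simp

lemma escale_unit_sphere:
  "\<lbrakk>z \<in> topspace (unit_ball d); 0 < enorm d z\<rbrakk> \<Longrightarrow> escale (1 / enorm d z) z \<in> topspace (unit_sphere d)"
  by (auto simp: topspace_unit_ball topspace_unit_sphere enorm_escale) (simp add: escale_def)

lemma continuous_map_radial:
  assumes f: "continuous_map X (unit_ball d) f" and pos: "\<And>x. x \<in> topspace X \<Longrightarrow> 0 < enorm d (f x)"
  shows "continuous_map X (unit_sphere d) (\<lambda>x. escale (1 / enorm d (f x)) (f x))"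
proof -
  have "continuous_map X euclideanreal (\<lambda>x. 1 / enorm d (f x))"
    by (rule continuous_map_real_divide [OF _ continuous_map_enorm [OF f]]) (use pos in force)+
  then have "continuous_map X (unit_ball d) (\<lambda>x. escale (1 / enorm d (f x)) (f x))"
    by (rule continuous_map_escale [OF _ f]) (use pos in \<open>force simp: enorm_escale\<close>)
  moreover have "f x \<in> topspace (unit_ball d)" if "x \<in> topspace X" for x
    using continuous_map_funspace [OF f] that by auto
  ultimately show ?thesis
    by (subst unit_sphere_eq_subtopology) (auto simp: continuous_map_in_subtopology escale_unit_sphere pos)
qed

text \<open>Closed in a product of copies of the interval from -1 to 1, hence compact by
  Tychonoff.\<close>

lemma compact_unit_ball: "compact_space (unit_ball d)"
proof -
  let ?P = "powertop_real (UNIV :: nat set)"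
  have le: "\<bar>z i\<bar> \<le> 1" if z: "z \<in> topspace (unit_ball d)" for z i
  proof (cases "i < d")
    case True
    have "(z i)\<^sup>2 \<le> (\<Sum>j<d. (z j)\<^sup>2)"
      using True by (intro member_le_sum) auto
    also have "\<dots> \<le> 1"
      using z by (simp add: unit_ball_def)
    finally show ?thesis
      by (simp add: abs_square_le_1)
  qed (use z in \<open>simp add: topspace_unit_ball\<close>)
  have "topspace (unit_ball d) = (\<Inter>i\<in>{d..}. {z \<in> topspace ?P. z i \<in> {0}}) \<inter> {z \<in> topspace ?P. enorm d z \<in> {..1}}"
    by (auto simp: topspace_unit_ball)
  moreover have "closedin ?P (\<Inter>i\<in>{d..}. {z \<in> topspace ?P. z i \<in> {0}})"
  proof (rule closedin_Inter)
    have "closedin ?P {z \<in> topspace ?P. z i \<in> {0}}" for i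
      by (intro closedin_continuous_map_preimage [where Y = euclideanreal] continuous_map_product_projection) auto
    then show "closedin ?P S" if "S \<in> (\<lambda>i. {z \<in> topspace ?P. z i \<in> {0}}) ` {d..}" for S
      using that by blast
  qed auto
  moreover have "closedin ?P {z \<in> topspace ?P. enorm d z \<in> {..1}}"
    unfolding enorm_def
    by (intro closedin_continuous_map_preimage [where Y = euclideanreal] continuous_map_sqrt continuous_map_sum
         continuous_map_real_pow continuous_map_product_projection) auto
  ultimately have "closedin ?P (topspace (unit_ball d))"
    by (simp only: closedin_Int)
  moreover have "compactin ?P (UNIV \<rightarrow>\<^sub>E {-1..1})"
    by (simp add: compactin_PiE)
  moreover have "topspace (unit_ball d) \<subseteq> UNIV \<rightarrow>\<^sub>E {-1..1}"
    using le by (force simp: abs_le_iff)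
  ultimately have "compactin ?P (topspace (unit_ball d))"
    using closed_compactin by blast
  then show ?thesis
    by (subst unit_ball_eq_subtopology) (simp add: compact_space_subtopology)
qed

text \<open>The open neighbourhoods \<open>V U\<close> form an excisive cover. The time-one map
  brings chains that are small for them back into the members, and the chain homotopy stays in each
  member because \<open>h\<close> does.\<close>

lemma excisive_by_homotopy:
  assumes h: "continuous_map (cylinder X) X h" and h0: "\<And>x. x \<in> topspace X \<Longrightarrow> h (0, x) = x"
    and cover: "topspace X \<subseteq> \<Union>\<U>"
    and pres: "\<And>U t x. \<lbrakk>U \<in> \<U>; t \<in> {0..1}; x \<in> U\<rbrakk> \<Longrightarrow> h (t, x) \<in> U"
    and V: "\<And>U. U \<in> \<U> \<Longrightarrow> openin X (V U)" "\<And>U. U \<in> \<U> \<Longrightarrow> U \<subseteq> V U"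
      "\<And>U x. \<lbrakk>U \<in> \<U>; x \<in> V U\<rbrakk> \<Longrightarrow> h (1, x) \<in> U"
  shows "excisive_cover X \<U>"
  unfolding excisive_cover_def
proof (intro allI impI)
  fix n and c :: "'a chain"
  assume c: "singular_chain n X c" and bc: "\<forall>m. n = Suc m \<longrightarrow> small_chain m X \<U> (chain_boundary n c)"
  obtain H :: "(real \<times> 'a \<Rightarrow> 'a) \<Rightarrow> nat \<Rightarrow> 'a chain \<Rightarrow> 'a chain" where "chain_homotopy_operator H"
    using chain_homotopy_operator_exists by blast
  note H = this [unfolded chain_homotopy_operator_def, THEN conjunct1, rule_format]
    this [unfolded chain_homotopy_operator_def, THEN conjunct2, THEN conjunct1, rule_format]
    this [unfolded chain_homotopy_operator_def, THEN conjunct2, THEN conjunct2, rule_format, THEN conjunct1]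
    this [unfolded chain_homotopy_operator_def, THEN conjunct2, THEN conjunct2, rule_format, THEN conjunct2]
  have "excisive_cover X (V ` \<U>)"
  proof (rule excisive_open_cover)
    show "topspace X \<subseteq> \<Union>(V ` \<U>)"
    proof
      fix x assume "x \<in> topspace X"
      then obtain U where "U \<in> \<U>" "x \<in> U" using cover by auto
      then show "x \<in> \<Union>(V ` \<U>)" using V(2) [of U] by auto
    qed
  qed (use V(1) in auto)
  moreover have "small_chain m X (V ` \<U>) (chain_boundary n c)" if "n = Suc m" for m
  proof -
    have "small_chain m X \<U> (chain_boundary n c)" using bc that by blast
    moreover have "{\<sigma>. \<exists>U\<in>\<U>. singular_simplex m (subtopology X U) \<sigma>} \<subseteq>
        {\<sigma>. \<exists>U\<in>V ` \<U>. singular_simplex m (subtopology X U) \<sigma>}"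
      using V(2) by (auto intro: singular_simplex_mono)
    ultimately show ?thesis unfolding small_chain_def by (rule order_trans)
  qed
  ultimately obtain d where d: "singular_chain (Suc n) X d"
    "small_chain n X (V ` \<U>) (c - chain_boundary (Suc n) d)"
    using c unfolding excisive_cover_def by blast
  let ?f = "chain_map n (\<lambda>x. h (1, x))" and ?g = "chain_map (Suc n) (\<lambda>x. h (1, x))"
  have ends: "continuous_map X X (\<lambda>x. h (1, x))"
    using continuous_map_compose [OF continuous_map_cylinder_end h, of 1] by (simp add: o_def)
  have small1: "small_chain n X \<U> (?f s)" if "small_chain n X (V ` \<U>) s" for s
  proof (rule small_chain_image [OF that])
    fix W assume "W \<in> V ` \<U>"
    then obtain U where U: "U \<in> \<U>" "W = V U" by blast
    have "continuous_map (subtopology X W) (subtopology X U) (\<lambda>x. h (1, x))"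
      using ends V(3) [OF U(1)] U(2) by (auto simp: continuous_map_in_subtopology continuous_map_from_subtopology)
    then show "\<exists>U\<in>\<U>. \<forall>c. singular_chain n (subtopology X W) c \<longrightarrow> singular_chain n (subtopology X U) (?f c)"
      using U(1) singular_chain_chain_map by blast
  qed (simp add: chain_map_diff)
  have Hcont: "continuous_map (cylinder (subtopology X U)) (subtopology X U) h" if "U \<in> \<U>" for U
  proof -
    have "cylinder (subtopology X U) = subtopology (cylinder X) (UNIV \<times> U)"
      by (simp only: cylinder_def subtopology_Times subtopology_UNIV)
    then show ?thesis
      using continuous_map_from_subtopology [OF h] pres [OF that]
      by (auto simp: continuous_map_in_subtopology cylinder_def)
  qed
  have small2: "small_chain n X \<U> (H h (n - 1) (chain_boundary n c))"
  proof (cases n)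
    case 0
    then show ?thesis by (simp add: chain_boundary_def H(1))
  next
    case (Suc m)
    have "small_chain (Suc m) X \<U> (H h m s)" if "small_chain m X \<U> s" for s
      by (rule small_chain_image [OF that]) (use H(2,3) Hcont in blast)+
    then show ?thesis using bc Suc by simp
  qed
  have idmap: "chain_map n (\<lambda>x. h (0, x)) c = c"
    by (rule chain_map_id_gen [OF c]) (use h0 in auto)
  have "?f (chain_boundary (Suc n) d) = chain_boundary (Suc n) (?g d)"
    using chain_boundary_chain_map [OF d(1), of "\<lambda>x. h (1, x)"] by simp
  \<comment> \<open>The correction pushes \<open>d\<close> to time one and subtracts the track of
    \<open>c\<close>; what remains is the pushed small chain minus the track of the small
    boundary.\<close>
  then have "c - chain_boundary (Suc n) (?g d - H h n c) =
      ?f (c - chain_boundary (Suc n) d) - H h (n - 1) (chain_boundary n c)"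
    using H(4) [OF h c] by (simp add: idmap chain_boundary_diff chain_map_diff algebra_simps)
  then have "small_chain n X \<U> (c - chain_boundary (Suc n) (?g d - H h n c))"
    using small_chain_diff [OF small1 [OF d(2)] small2] by simp
  moreover have "singular_chain (Suc n) X (?g d - H h n c)"
    by (intro singular_chain_diff singular_chain_chain_map [OF d(1) ends] H(3) [OF h c])
  ultimately show "\<exists>d. singular_chain (Suc n) X d \<and> small_chain n X \<U> (c - chain_boundary (Suc n) d)"
    by blast
qed

text \<open>Points at distance \<open>u / (1 + 2 t)\<close> from the centre of the new cell are pushed outwards to
  distance \<open>u\<close>; once \<open>u\<close> exceeds 1 they have reached the boundary and continue along the old
  homotopy for time \<open>min t (u - 1)\<close>. At \<open>t = 1\<close> the whole collar of points at distance at least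
  \<open>2/3\<close> has completed the old homotopy.\<close>

definition cell_push ::
  "nat \<Rightarrow> ((nat \<Rightarrow> real) \<Rightarrow> 'a) \<Rightarrow> (real \<times> 'a \<Rightarrow> 'a) \<Rightarrow> real \<times> (nat \<Rightarrow> real) \<Rightarrow> 'a" where
  "cell_push d \<phi> h = (\<lambda>(t, z).
     if (1 + 2 * t) * enorm d z \<le> 1 then \<phi> (escale (1 + 2 * t) z)
     else h (min t ((1 + 2 * t) * enorm d z - 1), \<phi> (escale (1 / enorm d z) z)))"

section \<open>Extending a homotopy over one attached cell\<close>

context
  fixes T :: "'a topology" and d :: nat and \<phi> :: "(nat \<Rightarrow> real) \<Rightarrow> 'a" and Y :: "'a set"
    and h :: "real \<times> 'a \<Rightarrow> 'a"
  assumes hausdorff: "Hausdorff_space T"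
    and \<phi>: "continuous_map (unit_ball d) T \<phi>"
    and inj: "inj_on \<phi> (topspace (open_unit_ball d))"
    and Y: "closedin T Y"
    and new: "\<phi> ` topspace (open_unit_ball d) \<inter> Y = {}"
    and old: "\<phi> ` topspace (unit_sphere d) \<subseteq> Y"
    and h: "continuous_map (cylinder (subtopology T Y)) (subtopology T Y) h"
    and h0: "\<And>y. y \<in> Y \<Longrightarrow> h (0, y) = y"
begin

lemma h_in: "\<lbrakk>0 \<le> t; t \<le> 1; y \<in> Y\<rbrakk> \<Longrightarrow> h (t, y) \<in> Y"
  using continuous_map_funspace [OF h] closedin_subset [OF Y] by (auto simp: cylinder_def Pi_iff)

text \<open>At norm 1 the elapsed time \<open>min t (2 * t)\<close> is \<open>t\<close>, so the push
  on the cell glues with \<open>h\<close> on the old space.\<close>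

lemma cell_push_sphere:
  assumes "z \<in> topspace (unit_sphere d)" "0 \<le> t" "t \<le> 1"
  shows "cell_push d \<phi> h (t, z) = h (t, \<phi> z)"
proof -
  have z: "enorm d z = 1" using assms by (simp add: topspace_unit_sphere)
  show ?thesis
  proof (cases "t = 0")
    case True
    then show ?thesis using h0 [of "\<phi> z"] old assms z by (auto simp: cell_push_def)
  next
    case False
    then show ?thesis using assms z by (simp add: cell_push_def)
  qed
qed

lemma cell_push_0:
  assumes "z \<in> topspace (unit_ball d)"
  shows "cell_push d \<phi> h (0, z) = \<phi> z"
  using assms by (simp add: cell_push_def topspace_unit_ball)

text \<open>Prepares the proof that subcomplexes are preserved: one that contains the cell contains
  both the closed cell and the tracks of its attaching points.\<close>

lemma cell_push_cases:
  assumes z: "z \<in> topspace (unit_ball d)" and t: "0 \<le> t" "t \<le> 1"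
  shows "cell_push d \<phi> h (t, z) \<in> \<phi> ` topspace (unit_ball d) \<or>
    (\<exists>s\<in>{0..1}. \<exists>w\<in>topspace (unit_sphere d). cell_push d \<phi> h (t, z) = h (s, \<phi> w))"
proof (cases "(1 + 2 * t) * enorm d z \<le> 1")
  case True
  have "escale (1 + 2 * t) z \<in> topspace (unit_ball d)"
    using True z t by (auto simp: topspace_unit_ball enorm_escale) (simp add: escale_def)
  then show ?thesis using True by (simp add: cell_push_def)
next
  case False
  then have "enorm d z \<noteq> 0" by auto
  then have "enorm d z > 0" by (simp add: less_le)
  then show ?thesis
    using escale_unit_sphere [OF z] False t
    by (intro disjI2 bexI [of _ "min t ((1 + 2 * t) * enorm d z - 1)"] bexI [of _ "escale (1 / enorm d z) z"])
       (auto simp: cell_push_def)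
qed

lemma continuous_map_cell_push:
  "continuous_map (cylinder (unit_ball d)) (subtopology T (Y \<union> \<phi> ` topspace (unit_ball d))) (cell_push d \<phi> h)"
proof -
  let ?W = "cylinder (unit_ball d)" and ?X = "Y \<union> \<phi> ` topspace (unit_ball d)"
  let ?u = "\<lambda>p. (1 + 2 * fst p) * enorm d (snd p)"
  have f1: "continuous_map ?W euclideanreal fst"
    unfolding cylinder_def by (intro continuous_map_into_fulltopology [OF continuous_map_fst])
  have f2: "continuous_map ?W (unit_ball d) snd"
    unfolding cylinder_def by (rule continuous_map_snd)
  have r: "continuous_map ?W euclideanreal (\<lambda>p. 1 + 2 * fst p)"
    by (intro continuous_map_add continuous_map_real_mult f1) auto
  have u: "continuous_map ?W euclideanreal ?u"
    by (intro continuous_map_real_mult r continuous_map_enorm f2)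
  have "continuous_map ?W T (\<lambda>p. if ?u p \<le> 1 then \<phi> (escale (1 + 2 * fst p) (snd p))
     else h (min (fst p) (?u p - 1), \<phi> (escale (1 / enorm d (snd p)) (snd p))))"
  proof (rule continuous_map_cases_le)
    let ?A = "subtopology ?W {p \<in> topspace ?W. ?u p \<le> 1}"
    have "continuous_map ?A (unit_ball d) (\<lambda>p. escale (1 + 2 * fst p) (snd p))"
      by (rule continuous_map_escale [OF continuous_map_from_subtopology [OF r] continuous_map_from_subtopology [OF f2]])
         (auto simp: enorm_escale cylinder_def)
    then show "continuous_map ?A T (\<lambda>p. \<phi> (escale (1 + 2 * fst p) (snd p)))"
      using continuous_map_compose [OF _ \<phi>] by (fastforce simp: o_def)
    let ?B = "subtopology ?W {p \<in> topspace ?W. 1 \<le> ?u p}"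
    have pos: "enorm d (snd p) > 0" if "p \<in> topspace ?B" for p
    proof -
      have "enorm d (snd p) \<noteq> 0" using that by auto
      then show ?thesis by (simp add: less_le)
    qed
    have "continuous_map ?B (unit_sphere d) (\<lambda>p. escale (1 / enorm d (snd p)) (snd p))"
      by (rule continuous_map_radial [OF continuous_map_from_subtopology [OF f2] pos])
    then have "continuous_map ?B (unit_ball d) (\<lambda>p. escale (1 / enorm d (snd p)) (snd p))"
      by (subst (asm) unit_sphere_eq_subtopology) (simp add: continuous_map_in_subtopology)
    then have "continuous_map ?B T (\<lambda>p. \<phi> (escale (1 / enorm d (snd p)) (snd p)))"
      using continuous_map_compose [OF _ \<phi>] by (fastforce simp: o_def)
    moreover have "\<phi> (escale (1 / enorm d (snd p)) (snd p)) \<in> Y" if "p \<in> topspace ?B" for p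
      using escale_unit_sphere [OF _ pos [OF that]] old that by (auto simp: cylinder_def)
    ultimately have B2: "continuous_map ?B (subtopology T Y) (\<lambda>p. \<phi> (escale (1 / enorm d (snd p)) (snd p)))"
      by (auto simp: continuous_map_in_subtopology)
    have "continuous_map ?B euclideanreal (\<lambda>p. min (fst p) (?u p - 1))"
      by (intro continuous_map_real_min continuous_map_diff continuous_map_from_subtopology f1 u) auto
    then have B1: "continuous_map ?B (top_of_set {0..1}) (\<lambda>p. min (fst p) (?u p - 1))"
      by (auto simp: continuous_map_in_subtopology cylinder_def)
    have "continuous_map ?B (cylinder (subtopology T Y))
       (\<lambda>p. (min (fst p) (?u p - 1), \<phi> (escale (1 / enorm d (snd p)) (snd p))))"
      unfolding cylinder_def [of "subtopology T Y"] by (rule continuous_map_pairedI [OF B1 B2])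
    then have "continuous_map ?B (subtopology T Y)
       (h \<circ> (\<lambda>p. (min (fst p) (?u p - 1), \<phi> (escale (1 / enorm d (snd p)) (snd p)))))"
      by (rule continuous_map_compose [OF _ h])
    then show "continuous_map ?B T
       (\<lambda>p. h (min (fst p) (?u p - 1), \<phi> (escale (1 / enorm d (snd p)) (snd p))))"
      by (simp add: continuous_map_in_subtopology o_def)
    fix p assume p: "p \<in> topspace ?W" "?u p = 1"
    then have "p \<in> topspace ?B" by simp
    \<comment> \<open>On the interface the two scale factors coincide and the elapsed time is 0,
      where \<open>h\<close> is the identity.\<close>
    from pos [OF this] have "1 / enorm d (snd p) = 1 + 2 * fst p"
      using p(2) by (simp add: field_simps)
    moreover have "\<phi> (escale (1 / enorm d (snd p)) (snd p)) \<in> Y"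
      using escale_unit_sphere [OF _ pos [OF \<open>p \<in> topspace ?B\<close>]] old p by (auto simp: cylinder_def)
    ultimately show "\<phi> (escale (1 + 2 * fst p) (snd p)) =
         h (min (fst p) (?u p - 1), \<phi> (escale (1 / enorm d (snd p)) (snd p)))"
      using p h0 by (auto simp: cylinder_def min_def)
  qed (use u in auto)
  then have "continuous_map ?W T (cell_push d \<phi> h)"
    by (simp add: cell_push_def case_prod_unfold)
  moreover have "cell_push d \<phi> h p \<in> ?X" if p_in: "p \<in> topspace ?W" for p
  proof -
    obtain t z where p: "p = (t, z)" "0 \<le> t" "t \<le> 1" "z \<in> topspace (unit_ball d)"
      using p_in by (cases p) (auto simp: cylinder_def)
    then consider "cell_push d \<phi> h p \<in> \<phi> ` topspace (unit_ball d)"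
      | s w where "s \<in> {0..1}" "w \<in> topspace (unit_sphere d)" "cell_push d \<phi> h p = h (s, \<phi> w)"
      using cell_push_cases [of z t] by blast
    then show ?thesis
    proof cases
      case 2
      then have "\<phi> w \<in> Y" using old by blast
      then show ?thesis using h_in [of s "\<phi> w"] 2 by simp
    qed blast
  qed
  ultimately show ?thesis
    by (auto simp: continuous_map_in_subtopology)
qed

text \<open>Even after multiplying with the unit interval, the closed cell is a quotient of the
  ball, because a continuous map from a compact to a Hausdorff space is closed. So the push
  descends, and it pastes with \<open>h\<close> along two closed sets.\<close>

lemma attach_cell_homotopy:
  obtains H where
    "continuous_map (cylinder (subtopology T (Y \<union> \<phi> ` topspace (unit_ball d))))
       (subtopology T (Y \<union> \<phi> ` topspace (unit_ball d))) H"
    "\<And>t y. y \<in> Y \<Longrightarrow> H (t, y) = h (t, y)"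
    "\<And>t z. \<lbrakk>t \<in> {0..1}; z \<in> topspace (unit_ball d)\<rbrakk> \<Longrightarrow> H (t, \<phi> z) = cell_push d \<phi> h (t, z)"
proof -
  let ?B = "\<phi> ` topspace (unit_ball d)"
  let ?X = "Y \<union> ?B"
  \<comment> \<open>A point of the closed cell outside \<open>Y\<close> has exactly one preimage in
    the open ball.\<close>
  define H where "H = (\<lambda>(t, x). if x \<in> Y then h (t, x)
      else cell_push d \<phi> h (t, the_inv_into (topspace (open_unit_ball d)) \<phi> x))"
  have HY: "H (t, y) = h (t, y)" if "y \<in> Y" for t y
    using that by (simp add: H_def)
  have HB: "H (t, \<phi> z) = cell_push d \<phi> h (t, z)" if t: "t \<in> {0..1}" and z: "z \<in> topspace (unit_ball d)" for t z
  proof (cases "enorm d z = 1")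
    case True
    then have "z \<in> topspace (unit_sphere d)" using z by (simp add: topspace_unit_ball topspace_unit_sphere)
    then show ?thesis
      using cell_push_sphere [of z t] old t by (auto simp: H_def)
  next
    case False
    then have "z \<in> topspace (open_unit_ball d)" using z by (simp add: topspace_unit_ball topspace_open_unit_ball)
    then show ?thesis
      using new the_inv_into_f_f [OF inj] by (auto simp: H_def)
  qed
  have Bc: "compactin T ?B"
    using image_compactin [OF _ \<phi>] compact_unit_ball by (simp add: compact_space_def)
  have Bcl: "closedin T ?B"
    by (rule compactin_imp_closedin [OF hausdorff Bc])
  have q: "quotient_map (cylinder (unit_ball d)) (cylinder (subtopology T ?B)) (\<lambda>(t, z). (t, \<phi> z))"
  proof -
    have c: "continuous_map (cylinder (unit_ball d)) (cylinder (subtopology T ?B)) (\<lambda>(t, z). (t, \<phi> z))"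
      unfolding cylinder_def continuous_map_prod_top
      using \<phi> by (auto simp: continuous_map_in_subtopology)
    have cl: "closed_map (cylinder (unit_ball d)) (cylinder (subtopology T ?B)) (\<lambda>(t, z). (t, \<phi> z))"
    proof -
      have "compact_space (cylinder (unit_ball d))"
        unfolding cylinder_def compact_space_prod_topology
        by (simp add: compact_unit_ball compact_space_subtopology)
      moreover have "Hausdorff_space (cylinder (subtopology T ?B))"
        unfolding cylinder_def Hausdorff_space_prod_topology
        by (intro disjI2 conjI Hausdorff_space_subtopology hausdorff) auto
      ultimately show ?thesis
        unfolding closed_map_def
        using compactin_imp_closedin [OF _ image_compactin [OF closedin_compact_space c]] by simp
    qed
    have "?B \<subseteq> topspace T" by (rule closedin_subset [OF Bcl])
    then have im: "(\<lambda>(t, z). (t, \<phi> z)) ` topspace (cylinder (unit_ball d)) = topspace (cylinder (subtopology T ?B))"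
      by (auto simp: cylinder_def image_iff)
    show ?thesis
      by (rule continuous_closed_imp_quotient_map [OF c cl im])
  qed
  let ?C = "cylinder (subtopology T ?X)"
  have sub: "subtopology ?C (UNIV \<times> S) = cylinder (subtopology T S)" if "S \<subseteq> ?X" for S
    using that by (simp add: cylinder_def subtopology_Times subtopology_subtopology Int_absorb1)
  have contB: "continuous_map (cylinder (subtopology T ?B)) (subtopology T ?X) H"
    unfolding continuous_compose_quotient_map_eq [OF q, symmetric]
    by (rule continuous_map_eq [OF continuous_map_cell_push]) (auto simp: HB cylinder_def)
  have contY: "continuous_map (cylinder (subtopology T Y)) (subtopology T ?X) H"
  proof (rule continuous_map_eq)
    show "continuous_map (cylinder (subtopology T Y)) (subtopology T ?X) h"
      using h by (auto simp: continuous_map_in_subtopology)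
  qed (auto simp: HY cylinder_def)
  have cl: "closedin ?C (topspace ?C \<inter> UNIV \<times> S)" if "closedin T S" for S
  proof -
    have "closedin ?C {p \<in> topspace ?C. snd p \<in> topspace (subtopology T ?X) \<inter> S}"
    proof (rule closedin_continuous_map_preimage)
      show "continuous_map ?C (subtopology T ?X) snd"
        unfolding cylinder_def by (rule continuous_map_snd)
      show "closedin (subtopology T ?X) (topspace (subtopology T ?X) \<inter> S)"
        using that by (auto simp: closedin_subtopology closedin_Int_closure_of intro!: exI [of _ S] dest: closedin_subset)
    qed
    moreover have "{p \<in> topspace ?C. snd p \<in> topspace (subtopology T ?X) \<inter> S} = topspace ?C \<inter> UNIV \<times> S"
      by (auto simp: cylinder_def)
    ultimately show ?thesis by simp
  qed
  have "continuous_map ?C (subtopology T ?X) H"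
  proof (rule pasting_lemma_closed [where I = "{Y, ?B}" and T = "\<lambda>S. topspace ?C \<inter> UNIV \<times> S" and f = "\<lambda>_. H"])
    fix S assume S: "S \<in> {Y, ?B}"
    then have "closedin T S" using Y Bcl by fast
    then show "closedin ?C (topspace ?C \<inter> UNIV \<times> S)" by (rule cl)
    have "S \<subseteq> ?X" using S by blast
    then have "subtopology ?C (topspace ?C \<inter> UNIV \<times> S) = cylinder (subtopology T S)"
      by (simp only: subtopology_restrict sub)
    then show "continuous_map (subtopology ?C (topspace ?C \<inter> UNIV \<times> S)) (subtopology T ?X) H"
      using S contB contY by fastforce
  next
    fix p assume "p \<in> topspace ?C"
    then show "\<exists>S. S \<in> {Y, ?B} \<and> p \<in> topspace ?C \<inter> UNIV \<times> S \<and> H p = H p"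
      by (cases p) (auto simp: cylinder_def)
  qed auto
  then show thesis
    by (rule that [OF _ HY HB])
qed

end

text \<open>An infinite \<open>S\<close> would accumulate at some \<open>x\<close>, although
  removing \<open>x\<close> from \<open>S\<close> leaves a closed set. Cells and simplices are both
  counted this way.\<close>

lemma compact_discrete_finite:
  assumes K: "compactin X K" and "S \<subseteq> K" and closed: "\<And>A. A \<subseteq> S \<Longrightarrow> closedin X A"
  shows "finite S"
proof (rule ccontr)
  assume "infinite S"
  then obtain x where x: "x \<in> X derived_set_of S"
    using compactin_imp_Bolzano_Weierstrass [OF K] \<open>S \<subseteq> K\<close> by blast
  have "openin X (topspace X - (S - {x}))"
    using closed [of "S - {x}"] by blast
  moreover have "x \<in> topspace X - (S - {x})"
    using x by (simp add: in_derived_set_of)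
  ultimately have "\<exists>y. y \<noteq> x \<and> y \<in> S \<and> y \<in> topspace X - (S - {x})"
    using x [unfolded in_derived_set_of, THEN conjunct2, THEN spec, of "topspace X - (S - {x})"] by simp
  then show False by blast
qed

text \<open>Fixes one characteristic map per cell, so that closed cells and cell boundaries become
  functions of the cell.\<close>

locale cw_structure =
  fixes T :: "'a topology" and E :: "'a set set" and cdim :: "'a set \<Rightarrow> nat"
    and \<phi> :: "'a set \<Rightarrow> (nat \<Rightarrow> real) \<Rightarrow> 'a"
  assumes hausdorff: "Hausdorff_space T"
    and cells: "\<Union>E = topspace T" and disj: "disjoint E"
    and char: "e \<in> E \<Longrightarrow> characteristic_map T (cdim e) e (\<phi> e)"
    and attach: "e \<in> E \<Longrightarrow> \<exists>C\<subseteq>E. finite C \<and> (\<forall>c\<in>C. cdim c < cdim e) \<and>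
          \<phi> e ` topspace (unit_sphere (cdim e)) \<subseteq> \<Union>C"
    and weak: "\<lbrakk>A \<subseteq> topspace T; \<And>e. e \<in> E \<Longrightarrow> closedin T (A \<inter> (T closure_of e))\<rbrakk> \<Longrightarrow> closedin T A"
begin

section \<open>Cells and finite closed families\<close>

definition closed_cell :: "'a set \<Rightarrow> 'a set" where
  "closed_cell e = \<phi> e ` topspace (unit_ball (cdim e))"

definition cell_boundary :: "'a set \<Rightarrow> 'a set" where
  "cell_boundary e = \<phi> e ` topspace (unit_sphere (cdim e))"

lemma cell_unique: "\<lbrakk>e \<in> E; e' \<in> E; x \<in> e; x \<in> e'\<rbrakk> \<Longrightarrow> e = e'"
  using disj by (auto simp: disjoint_def)

lemma cell_map: "e \<in> E \<Longrightarrow> continuous_map (unit_ball (cdim e)) T (\<phi> e)"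
  using char by (simp add: characteristic_map_def)

lemma cell_inj: "e \<in> E \<Longrightarrow> inj_on (\<phi> e) (topspace (open_unit_ball (cdim e)))"
  using char homeomorphic_imp_injective_map unfolding characteristic_map_def by blast

lemma cell_image:
  assumes "e \<in> E"
  shows "\<phi> e ` topspace (open_unit_ball (cdim e)) = e"
proof -
  have "\<phi> e ` topspace (open_unit_ball (cdim e)) = topspace (subtopology T e)"
    using char [OF assms] homeomorphic_imp_surjective_map unfolding characteristic_map_def by blast
  then show ?thesis
    using cells assms by auto
qed

lemma cell_point:
  assumes "e \<in> E" "x \<in> e"
  obtains z where "z \<in> topspace (unit_ball (cdim e))" "x = \<phi> e z"
proof -
  have "x \<in> \<phi> e ` topspace (open_unit_ball (cdim e))"
    using cell_image [OF assms(1)] assms(2) by simp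
  then obtain z where "z \<in> topspace (open_unit_ball (cdim e))" "x = \<phi> e z" by (rule imageE)
  moreover have "topspace (open_unit_ball d) \<subseteq> topspace (unit_ball d)" for d
    by (auto simp: topspace_unit_ball topspace_open_unit_ball)
  ultimately show thesis
    using that by blast
qed

lemma cell_map_interior:
  assumes "e \<in> E" "z \<in> topspace (unit_ball (cdim e))" "enorm (cdim e) z \<noteq> 1"
  shows "\<phi> e z \<in> e"
proof -
  have "z \<in> topspace (open_unit_ball (cdim e))"
    using assms by (simp add: topspace_unit_ball topspace_open_unit_ball)
  then show ?thesis using cell_image [OF assms(1)] by blast
qed

lemma closed_cell_eq: "e \<in> E \<Longrightarrow> closed_cell e = e \<union> cell_boundary e"
proof -
  assume "e \<in> E"
  have "topspace (unit_ball d) = topspace (open_unit_ball d) \<union> topspace (unit_sphere d)" for d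
    by (auto simp: topspace_unit_ball topspace_open_unit_ball topspace_unit_sphere)
  then show ?thesis
    using cell_image [OF \<open>e \<in> E\<close>] by (simp add: closed_cell_def cell_boundary_def image_Un)
qed

lemma closedin_closed_cell:
  assumes "e \<in> E"
  shows "closedin T (closed_cell e)"
proof -
  have "compactin T (closed_cell e)"
    unfolding closed_cell_def
    using image_compactin [OF _ cell_map [OF assms]] compact_unit_ball by (simp add: compact_space_def)
  then show ?thesis by (rule compactin_imp_closedin [OF hausdorff])
qed

lemma closure_subset_closed_cell:
  assumes "e \<in> E"
  shows "T closure_of e \<subseteq> closed_cell e"
proof (rule closure_of_minimal)
  show "e \<subseteq> closed_cell e" using closed_cell_eq [OF assms] by blast
qed (rule closedin_closed_cell [OF assms])

text \<open>Follow the radius to a boundary point: all earlier points map into the open cell. This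
  forces a closed union of cells to contain the boundaries of its cells.\<close>

lemma cell_boundary_subset_closure:
  assumes e: "e \<in> E"
  shows "cell_boundary e \<subseteq> T closure_of e"
  unfolding cell_boundary_def
proof clarify
  fix z assume z: "z \<in> topspace (unit_sphere (cdim e))"
  let ?f = "\<lambda>t. \<phi> e (escale t z)"
  have "continuous_map (top_of_set {0..1}) (unit_ball (cdim e)) (\<lambda>t. escale t z)"
    by (rule continuous_map_escale)
       (use z in \<open>auto simp: enorm_escale topspace_unit_ball topspace_unit_sphere\<close>)
  then have f: "continuous_map (top_of_set {0..1}) T ?f"
    using continuous_map_compose [OF _ cell_map [OF e]] by (auto simp: o_def)
  let ?B = "{t \<in> topspace (top_of_set {0..1}). ?f t \<in> T closure_of e}"
  have "closedin (top_of_set {0..1}) ?B"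
    by (rule closedin_continuous_map_preimage [OF f]) simp
  then have "closed ?B"
    by (rule closedin_closed_trans) simp
  moreover have "{0..<1} \<subseteq> ?B"
  proof clarsimp
    fix t :: real assume t: "0 \<le> t" "t < 1"
    then have "escale t z \<in> topspace (open_unit_ball (cdim e))"
      using z by (auto simp: topspace_open_unit_ball topspace_unit_sphere enorm_escale) (simp add: escale_def)
    then have "?f t \<in> e" using cell_image [OF e] by blast
    moreover have "e \<subseteq> T closure_of e"
      by (rule closure_of_subset) (use cells e in auto)
    ultimately show "?f t \<in> T closure_of e" by blast
  qed
  ultimately have "closure {0..<1} \<subseteq> ?B"
    by (rule closure_minimal [rotated])
  then have "1 \<in> ?B"
    by (rule subsetD) simp
  then show "\<phi> e z \<in> T closure_of e" by simp
qed

text \<open>The attaching map of \<open>c\<close> only reaches cells of smaller dimension than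
  \<open>c\<close>, and distinct cells are disjoint.\<close>

lemma cell_boundary_disjoint:
  assumes "c \<in> E" "e \<in> E" "cdim c \<le> cdim e"
  shows "cell_boundary c \<inter> e = {}"
proof -
  obtain C where "C \<subseteq> E" "\<forall>c'\<in>C. cdim c' < cdim c" "cell_boundary c \<subseteq> \<Union>C"
    using attach [OF assms(1)] by (auto simp: cell_boundary_def)
  moreover have "e \<notin> C" using calculation assms by auto
  ultimately show ?thesis
    using assms cell_unique by blast
qed

text \<open>Subcomplexes in combinatorial form: a set of cells can be shrunk cell by cell in an
  induction, and for finite sets closedness of the union follows.\<close>

definition closed_family :: "'a set set \<Rightarrow> bool" where
  "closed_family D \<longleftrightarrow> D \<subseteq> E \<and> (\<forall>e\<in>D. cell_boundary e \<subseteq> \<Union>D)"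

lemma closed_family_Union: "(\<And>D. D \<in> \<D> \<Longrightarrow> closed_family D) \<Longrightarrow> closed_family (\<Union>\<D>)"
  unfolding closed_family_def by blast

lemma closed_family_insert:
  assumes "e \<in> E" "closed_family D" "cell_boundary e \<subseteq> \<Union>D"
  shows "closed_family (insert e D)"
proof -
  have "cell_boundary c \<subseteq> \<Union>(insert e D)" if "c \<in> insert e D" for c
    using assms that by (auto simp: closed_family_def)
  then show ?thesis
    using assms by (auto simp: closed_family_def)
qed

text \<open>No cell boundary in \<open>A\<close> meets a cell of maximal dimension, so such a cell
  can be regarded as attached last.\<close>

lemma closed_family_remove:
  assumes A: "closed_family A" and e: "e \<in> E" and max: "\<And>c. c \<in> A \<Longrightarrow> cdim c \<le> cdim e"
  shows "closed_family (A - {e})"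
  unfolding closed_family_def
proof (intro conjI ballI)
  fix c assume c: "c \<in> A - {e}"
  then have "cell_boundary c \<inter> e = {}"
    using cell_boundary_disjoint [of c e] max [of c] A e by (auto simp: closed_family_def)
  then show "cell_boundary c \<subseteq> \<Union>(A - {e})"
    using c A unfolding closed_family_def by blast
qed (use A in \<open>auto simp: closed_family_def\<close>)

lemma finite_closed_family: "e \<in> E \<Longrightarrow> \<exists>D. finite D \<and> closed_family D \<and> e \<in> D"
proof (induction "cdim e" arbitrary: e rule: less_induct)
  case less
  obtain C where C: "C \<subseteq> E" "finite C" "\<forall>c\<in>C. cdim c < cdim e" "cell_boundary e \<subseteq> \<Union>C"
    using attach [OF less.prems] by (auto simp: cell_boundary_def)
  then have "\<forall>c\<in>C. \<exists>D. finite D \<and> closed_family D \<and> c \<in> D"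
    using less.hyps by blast
  then obtain D where D: "\<And>c. c \<in> C \<Longrightarrow> finite (D c) \<and> closed_family (D c) \<and> c \<in> D c"
    by metis
  have "closed_family (\<Union>(D ` C))"
    using D by (intro closed_family_Union) auto
  moreover have "cell_boundary e \<subseteq> \<Union>(\<Union>(D ` C))"
    using C(4) D by blast
  ultimately have "closed_family (insert e (\<Union>(D ` C)))"
    by (rule closed_family_insert [OF less.prems])
  moreover have "finite (insert e (\<Union>(D ` C)))"
    using C(2) D by auto
  ultimately show ?case by blast
qed

lemma closed_family_Union_closed_cells: "closed_family D \<Longrightarrow> \<Union>D = \<Union>(closed_cell ` D)"
  unfolding closed_family_def using closed_cell_eq by blast

lemma closedin_closed_family: "\<lbrakk>finite D; closed_family D\<rbrakk> \<Longrightarrow> closedin T (\<Union>D)"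
  unfolding closed_family_Union_closed_cells
  by (rule closedin_Union) (auto simp: closed_family_def closedin_closed_cell)

text \<open>Pick a point in each cell that meets \<open>K\<close>. The closure of each cell contains
  only finitely many picked points, so by the weak topology every set of picked points is closed,
  and a compact set has room for finitely many of them.\<close>

lemma compact_meets_finite:
  assumes K: "compactin T K"
  shows "finite {e \<in> E. e \<inter> K \<noteq> {}}"
proof -
  let ?M = "{e \<in> E. e \<inter> K \<noteq> {}}"
  have "\<forall>e\<in>?M. \<exists>x. x \<in> e \<inter> K" by blast
  then obtain p where p: "\<And>e. e \<in> ?M \<Longrightarrow> p e \<in> e \<and> p e \<in> K" by (metis IntE)
  have inj: "inj_on p ?M"
    unfolding inj_on_def using p cell_unique by (metis (no_types, lifting) mem_Collect_eq)
  have KT: "K \<subseteq> topspace T" by (rule compactin_subset_topspace [OF K])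
  have "finite (p ` ?M)"
  proof (rule compact_discrete_finite [OF K])
    show "p ` ?M \<subseteq> K" using p by blast
    fix A assume A: "A \<subseteq> p ` ?M"
    show "closedin T A"
    proof (rule weak)
      show "A \<subseteq> topspace T" using A p KT by blast
      fix e assume e: "e \<in> E"
      obtain C where C: "C \<subseteq> E" "finite C" "cell_boundary e \<subseteq> \<Union>C"
        using attach [OF e] by (auto simp: cell_boundary_def)
      \<comment> \<open>The closure of a cell lies in that cell and finitely many others, each
        holding at most one picked point.\<close>
      have "A \<inter> T closure_of e \<subseteq> p ` insert e C"
      proof
        fix x assume x: "x \<in> A \<inter> T closure_of e"
        then obtain e' where e': "e' \<in> ?M" "x = p e'" using A by blast
        have "x \<in> e \<union> \<Union>C"
          using x closure_subset_closed_cell [OF e] closed_cell_eq [OF e] C(3) by blast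
        then obtain c where c: "c \<in> insert e C" "x \<in> c" by blast
        then have "e' = c"
          using p [OF e'(1)] e' e C(1) by (intro cell_unique [of e' c x]) auto
        then show "x \<in> p ` insert e C" using c e' by blast
      qed
      then have "finite (A \<inter> T closure_of e)"
        by (rule finite_subset) (use C in simp)
      then show "closedin T (A \<inter> T closure_of e)"
        using closure_of_subset_topspace [of T e]
        by (intro closedin_Hausdorff_finite [OF hausdorff]) auto
    qed
  qed
  then show ?thesis
    using inj finite_imageD by blast
qed

lemma compact_in_finite_family:
  assumes K: "compactin T K"
  shows "\<exists>D. finite D \<and> closed_family D \<and> K \<subseteq> \<Union>D"
proof -
  let ?M = "{e \<in> E. e \<inter> K \<noteq> {}}"
  have "\<forall>e\<in>?M. \<exists>D. finite D \<and> closed_family D \<and> e \<in> D"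
    using finite_closed_family by blast
  then obtain D where D: "\<And>e. e \<in> ?M \<Longrightarrow> finite (D e) \<and> closed_family (D e) \<and> e \<in> D e"
    by metis
  have "K \<subseteq> topspace T" by (rule compactin_subset_topspace [OF K])
  then have "K \<subseteq> \<Union>?M" using cells by blast
  moreover have "?M \<subseteq> \<Union>(D ` ?M)" using D by auto
  ultimately have "K \<subseteq> \<Union>(\<Union>(D ` ?M))" by (meson Union_mono order_trans)
  moreover have "closed_family (\<Union>(D ` ?M))"
    using D by (intro closed_family_Union) auto
  moreover have "finite (\<Union>(D ` ?M))"
    using D compact_meets_finite [OF K] by auto
  ultimately show ?thesis by blast
qed

text \<open>A single \<open>h\<close> serves all closed subfamilies \<open>A\<close>, while the
  neighbourhood \<open>V\<close> may depend on \<open>A\<close>: the members of a cover are such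
  subfamilies, and excision moves all of them simultaneously.\<close>

definition collar_homotopy :: "'a set set \<Rightarrow> (real \<times> 'a \<Rightarrow> 'a) \<Rightarrow> bool" where
  "collar_homotopy D h \<longleftrightarrow>
     continuous_map (cylinder (subtopology T (\<Union>D))) (subtopology T (\<Union>D)) h \<and>
     (\<forall>x\<in>\<Union>D. h (0, x) = x) \<and>
     (\<forall>A. A \<subseteq> D \<longrightarrow> closed_family A \<longrightarrow> (\<forall>t\<in>{0..1}. \<forall>x\<in>\<Union>A. h (t, x) \<in> \<Union>A) \<and>
        (\<exists>V. openin (subtopology T (\<Union>D)) V \<and> \<Union>A \<subseteq> V \<and> (\<forall>x\<in>V. h (1, x) \<in> \<Union>A)))"

text \<open>Attach a top cell \<open>e\<close> last. If \<open>e\<close> is in \<open>A\<close>, the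
  whole open cell joins the neighbourhood; otherwise the neighbourhood \<open>V'\<close> in the rest
  is thickened by the collar points of \<open>e\<close> whose radial projection lies in
  \<open>V'\<close>.\<close>

lemma collar_homotopy_step:
  assumes D: "finite D" "closed_family D" and e: "e \<in> D" and max: "\<And>c. c \<in> D \<Longrightarrow> cdim c \<le> cdim e"
    and h': "collar_homotopy (D - {e}) h'"
  shows "\<exists>h. collar_homotopy D h"
proof -
  let ?Y = "\<Union>(D - {e})" and ?d = "cdim e"
  have eE: "e \<in> E" and DE: "D \<subseteq> E" using D e by (auto simp: closed_family_def)
  have minus: "closed_family (A - {e})" if "A \<subseteq> D" "closed_family A" for A
    using closed_family_remove [OF that(2) eE] max that(1) by blast
  have be: "cell_boundary e \<inter> e = {}"
    using cell_boundary_disjoint [OF eE eE] by simp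
  have bA: "cell_boundary e \<subseteq> \<Union>(A - {e})" if "e \<in> A" "closed_family A" for A
    using be that unfolding closed_family_def by blast
  have eY: "e \<inter> ?Y = {}"
    using cell_unique eE DE by blast
  have DY: "\<Union>D = ?Y \<union> \<phi> e ` topspace (unit_ball ?d)"
    using bA [OF e D(2)] closed_cell_eq [OF eE] e by (auto simp: closed_cell_def)
  have Ycl: "closedin T ?Y"
    using D minus [of D] by (intro closedin_closed_family) auto
  have h'c: "continuous_map (cylinder (subtopology T ?Y)) (subtopology T ?Y) h'"
    and h'0: "\<And>y. y \<in> ?Y \<Longrightarrow> h' (0, y) = y"
    and h'A: "\<And>A t x. \<lbrakk>A \<subseteq> D - {e}; closed_family A; t \<in> {0..1}; x \<in> \<Union>A\<rbrakk> \<Longrightarrow> h' (t, x) \<in> \<Union>A"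
    and h'V: "\<And>A. \<lbrakk>A \<subseteq> D - {e}; closed_family A\<rbrakk> \<Longrightarrow>
        \<exists>V. openin (subtopology T ?Y) V \<and> \<Union>A \<subseteq> V \<and> (\<forall>x\<in>V. h' (1, x) \<in> \<Union>A)"
    using h' unfolding collar_homotopy_def by meson+
  have new: "\<phi> e ` topspace (open_unit_ball ?d) \<inter> ?Y = {}"
    using cell_image [OF eE] eY by simp
  have old: "\<phi> e ` topspace (unit_sphere ?d) \<subseteq> ?Y"
    using bA [OF e D(2)] by (simp add: cell_boundary_def)
  note ctxt = hausdorff cell_map [OF eE] cell_inj [OF eE] Ycl new old h'c h'0
  obtain h where hc: "continuous_map (cylinder (subtopology T (\<Union>D))) (subtopology T (\<Union>D)) h"
    and hY: "\<And>t y. y \<in> ?Y \<Longrightarrow> h (t, y) = h' (t, y)"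
    and hB: "\<And>t z. \<lbrakk>t \<in> {0..1}; z \<in> topspace (unit_ball ?d)\<rbrakk> \<Longrightarrow> h (t, \<phi> e z) = cell_push ?d (\<phi> e) h' (t, z)"
    using attach_cell_homotopy [OF ctxt, folded DY] by blast
  have h0: "h (0, x) = x" if xD: "x \<in> \<Union>D" for x
  proof (cases "x \<in> ?Y")
    case False
    moreover have "x \<in> ?Y \<union> \<phi> e ` topspace (unit_ball ?d)" using xD unfolding DY .
    ultimately have "x \<in> \<phi> e ` topspace (unit_ball ?d)" by (simp only: Un_iff) simp
    then obtain z where z: "z \<in> topspace (unit_ball ?d)" "x = \<phi> e z" by (rule imageE)
    show ?thesis using hB [of 0 z] cell_push_0 [OF ctxt z(1)] z by simp
  next
    case True
    then show ?thesis by (simp only: hY h'0)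
  qed
  have pres: "h (t, x) \<in> \<Union>A" if A: "A \<subseteq> D" "closed_family A" and t: "t \<in> {0..1}" and x: "x \<in> \<Union>A" for A t x
  proof (cases "x \<in> ?Y")
    case True
    then have "x \<in> \<Union>(A - {e})" using x eY by blast
    then have "h' (t, x) \<in> \<Union>(A - {e})"
      by (rule h'A [OF Diff_mono [OF A(1) order_refl] minus [OF A] t])
    then have "h (t, x) \<in> \<Union>(A - {e})"
      by (simp only: hY [OF True])
    then show ?thesis by blast
  next
    case False
    then have xe: "x \<in> e" and eA: "e \<in> A" using x A(1) by blast+
    obtain z where z: "z \<in> topspace (unit_ball ?d)" "x = \<phi> e z"
      by (rule cell_point [OF eE xe])
    have ball: "\<phi> e ` topspace (unit_ball ?d) \<subseteq> \<Union>A"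
      using closed_cell_eq [OF eE] bA [OF eA A(2)] eA by (auto simp: closed_cell_def)
    consider "h (t, x) \<in> \<phi> e ` topspace (unit_ball ?d)"
      | s w where "s \<in> {0..1}" "w \<in> topspace (unit_sphere ?d)" "h (t, x) = h' (s, \<phi> e w)"
      using cell_push_cases [OF ctxt z(1), of t] hB [OF t z(1)] t z(2) by auto
    then show ?thesis
    proof cases
      case 2
      then have "\<phi> e w \<in> \<Union>(A - {e})" using bA [OF eA A(2)] by (auto simp: cell_boundary_def)
      then have "h (t, x) \<in> \<Union>(A - {e})"
        unfolding 2(3) by (rule h'A [OF Diff_mono [OF A(1) order_refl] minus [OF A] 2(1)])
      then show ?thesis by blast
    qed (use ball in blast)
  qed
  have nbd: "\<exists>V. openin (subtopology T (\<Union>D)) V \<and> \<Union>A \<subseteq> V \<and> (\<forall>x\<in>V. h (1, x) \<in> \<Union>A)"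
    if A: "A \<subseteq> D" "closed_family A" for A
  proof -
    have "A - {e} \<subseteq> D - {e}" using A by blast
    from h'V [OF this minus [OF A]]
    obtain V' where V': "openin (subtopology T ?Y) V'" "\<Union>(A - {e}) \<subseteq> V'" "\<forall>x\<in>V'. h' (1, x) \<in> \<Union>(A - {e})"
      by (elim exE conjE)
    have "V' \<subseteq> ?Y" using openin_subset [OF V'(1)] by auto
    have "closedin (subtopology T ?Y) (topspace (subtopology T ?Y) - V')"
      using V'(1) by blast
    then have "closedin T (topspace (subtopology T ?Y) - V')"
      using closedin_trans_full Ycl by blast
    moreover have "topspace (subtopology T ?Y) = ?Y"
      using closedin_subset [OF Ycl] by auto
    ultimately have W: "closedin T (?Y - V')" by simp
    \<comment> \<open>The points of the ball to be discarded: the core, and the collar points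
      projecting outside \<open>V'\<close>. They form a closed subset of a compact ball, so their
      image is closed.\<close>
    let ?Z = "if e \<in> A then {} else {z \<in> topspace (unit_ball ?d). enorm ?d z \<le> 2/3 \<or>
                 (2/3 \<le> enorm ?d z \<and> \<phi> e (escale (1 / enorm ?d z) z) \<in> ?Y - V')}"
    have "closedin (unit_ball ?d) ?Z"
    proof -
      let ?B = "unit_ball ?d"
      let ?R = "{z \<in> topspace ?B. 2/3 \<le> enorm ?d z}"
      note n = continuous_map_enorm_ball
      have c1: "closedin ?B {z \<in> topspace ?B. enorm ?d z \<in> {..2/3}}"
        by (intro closedin_continuous_map_preimage [OF n]) simp
      have "closedin ?B {z \<in> topspace ?B. enorm ?d z \<in> {2/3..}}"
        by (intro closedin_continuous_map_preimage [OF n]) simp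
      then have c2: "closedin ?B ?R" by simp
      have "continuous_map (subtopology ?B ?R) (unit_sphere ?d) (\<lambda>z. escale (1 / enorm ?d z) z)"
        by (rule continuous_map_radial) (auto simp: continuous_map_from_subtopology)
      then have "continuous_map (subtopology ?B ?R) ?B (\<lambda>z. escale (1 / enorm ?d z) z)"
        by (subst (asm) unit_sphere_eq_subtopology) (simp add: continuous_map_in_subtopology)
      then have f: "continuous_map (subtopology ?B ?R) T (\<lambda>z. \<phi> e (escale (1 / enorm ?d z) z))"
        using continuous_map_compose [OF _ cell_map [OF eE]] by (auto simp: o_def)
      have "closedin (subtopology ?B ?R)
          {z \<in> topspace (subtopology ?B ?R). \<phi> e (escale (1 / enorm ?d z) z) \<in> ?Y - V'}"
        by (rule closedin_continuous_map_preimage [OF f W])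
      then have c3: "closedin ?B {z \<in> topspace (subtopology ?B ?R). \<phi> e (escale (1 / enorm ?d z) z) \<in> ?Y - V'}"
        using closedin_trans_full c2 by blast
      have "{z \<in> topspace ?B. enorm ?d z \<le> 2/3 \<or> (2/3 \<le> enorm ?d z \<and> \<phi> e (escale (1 / enorm ?d z) z) \<in> ?Y - V')}
          = {z \<in> topspace ?B. enorm ?d z \<in> {..2/3}} \<union>
            {z \<in> topspace (subtopology ?B ?R). \<phi> e (escale (1 / enorm ?d z) z) \<in> ?Y - V'}"
        by auto
      then show ?thesis
        using closedin_Un [OF c1 c3] by simp
    qed
    then have "compactin (unit_ball ?d) ?Z"
      by (rule closedin_compact_space [OF compact_unit_ball])
    then have "compactin T (\<phi> e ` ?Z)"
      by (rule image_compactin [OF _ cell_map [OF eE]])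
    then have "closedin T (\<phi> e ` ?Z)"
      by (rule compactin_imp_closedin [OF hausdorff])
    then have WZ: "closedin T ((?Y - V') \<union> \<phi> e ` ?Z)"
      by (rule closedin_Un [OF W])
    define V where "V = \<Union>D - ((?Y - V') \<union> \<phi> e ` ?Z)"
    have "openin (subtopology T (\<Union>D)) V"
      unfolding V_def
      using openin_subtopology_diff_closed [OF _ WZ, of "\<Union>D"] closedin_subset [OF closedin_closed_family [OF D]]
      by simp
    moreover have "\<Union>A \<subseteq> V"
    proof
      fix x assume x: "x \<in> \<Union>A"
      have "x \<notin> ?Y - V'"
        using x V'(2) eY by blast
      moreover have "x \<notin> \<phi> e ` ?Z"
      proof (cases "e \<in> A")
        case False
        show ?thesis
        proof
          assume "x \<in> \<phi> e ` ?Z"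
          then obtain z where z: "z \<in> topspace (unit_ball ?d)" "x = \<phi> e z"
            "enorm ?d z \<le> 2/3 \<or> \<phi> e (escale (1 / enorm ?d z) z) \<notin> V'"
            using False by auto
          have "x \<notin> e" using x False A(1) eE DE cell_unique by blast
          then have "enorm ?d z = 1"
            using z cell_map_interior [OF eE z(1)] by blast
          \<comment> \<open>At norm 1 the first alternative fails, and the radial projection is the
            point itself.\<close>
          then have "x \<notin> V'" using z by simp
          then show False using x V'(2) False by blast
        qed
      qed simp
      ultimately show "x \<in> V" using x A(1) unfolding V_def by blast
    qed
    moreover have "h (1, x) \<in> \<Union>A" if x: "x \<in> V" for x
    proof (cases "x \<in> ?Y")
      case True
      then have "x \<in> V'" using x by (auto simp: V_def)
      then have "h (1, x) \<in> \<Union>(A - {e})"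
        using hY [OF True] V'(3) by simp
      then show ?thesis by blast
    next
      case False
      then have xe: "x \<in> e" using x unfolding V_def by blast
      show ?thesis
      proof (cases "e \<in> A")
        case True
        then show ?thesis using pres [OF A, of 1 x] xe by auto
      next
        case eA: False
        obtain z where z: "z \<in> topspace (unit_ball ?d)" "x = \<phi> e z"
          by (rule cell_point [OF eE xe])
        then have "z \<notin> ?Z" using x unfolding V_def by blast
        then have n: "enorm ?d z > 2/3" and zY: "\<phi> e (escale (1 / enorm ?d z) z) \<notin> ?Y - V'"
          using eA z(1) by auto
        have "\<phi> e (escale (1 / enorm ?d z) z) \<in> ?Y"
          using old escale_unit_sphere [OF z(1)] n by auto
        then have "h' (1, \<phi> e (escale (1 / enorm ?d z) z)) \<in> \<Union>(A - {e})"
          using zY V'(3) by blast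
        \<comment> \<open>For norm above 2/3 and time 1 the elapsed time
          \<open>min 1 (3 * enorm ?d z - 1)\<close> is 1.\<close>
        moreover have "h (1, x) = h' (1, \<phi> e (escale (1 / enorm ?d z) z))"
          using hB [of 1 z] z n by (simp add: cell_push_def)
        ultimately show ?thesis by auto
      qed
    qed
    ultimately show ?thesis by blast
  qed
  have "collar_homotopy D h"
    unfolding collar_homotopy_def
  proof (intro conjI allI impI ballI)
    show "h (0, x) = x" if "x \<in> \<Union>D" for x by (rule h0 [OF that])
    show "h (t, x) \<in> \<Union>A" if "A \<subseteq> D" "closed_family A" "t \<in> {0..1}" "x \<in> \<Union>A" for A t x
      by (rule pres [OF that])
    show "\<exists>V. openin (subtopology T (\<Union>D)) V \<and> \<Union>A \<subseteq> V \<and> (\<forall>x\<in>V. h (1, x) \<in> \<Union>A)"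
      if "A \<subseteq> D" "closed_family A" for A
      by (rule nbd [OF that])
  qed (rule hc)
  then show ?thesis by blast
qed

lemma collar_homotopy_exists: "\<lbrakk>finite D; closed_family D\<rbrakk> \<Longrightarrow> \<exists>h. collar_homotopy D h"
proof (induction D rule: finite_psubset_induct)
  case (psubset D)
  show ?case
  proof (cases "D = {}")
    case True
    have "collar_homotopy {} snd"
      by (auto simp: collar_homotopy_def cylinder_def)
    then show ?thesis using True by blast
  next
    case False
    then have "Max (cdim ` D) \<in> cdim ` D"
      using psubset.hyps by (intro Max_in) auto
    then obtain e where e: "e \<in> D" "cdim e = Max (cdim ` D)" by auto
    have max: "cdim c \<le> cdim e" if "c \<in> D" for c
      using that psubset.hyps e(2) by simp
    have "closed_family (D - {e})"
      using closed_family_remove [OF psubset.prems _ max] psubset.prems e(1) by (auto simp: closed_family_def)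
    then obtain h' where "collar_homotopy (D - {e}) h'"
      using psubset.IH [of "D - {e}"] e(1) by blast
    from collar_homotopy_step [OF psubset.hyps psubset.prems e(1) _ this] max
    show ?thesis by simp
  qed
qed

end

context cw_structure
begin

section \<open>Descent from the whole complex to a finite subcomplex\<close>

lemma collar_homotopyD:
  assumes "collar_homotopy D h"
  shows "continuous_map (cylinder (subtopology T (\<Union>D))) (subtopology T (\<Union>D)) h"
    and "x \<in> \<Union>D \<Longrightarrow> h (0, x) = x"
    and "\<lbrakk>A \<subseteq> D; closed_family A; t \<in> {0..1}; x \<in> \<Union>A\<rbrakk> \<Longrightarrow> h (t, x) \<in> \<Union>A"
    and "\<lbrakk>A \<subseteq> D; closed_family A\<rbrakk> \<Longrightarrow>
        \<exists>V. openin (subtopology T (\<Union>D)) V \<and> \<Union>A \<subseteq> V \<and> (\<forall>x\<in>V. h (1, x) \<in> \<Union>A)"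
  using assms unfolding collar_homotopy_def by meson+

text \<open>The simplices of a chain have compact images, so the chain lives in a finite closed
  family. There the traces of the members are closed subfamilies and the collar homotopy
  applies.\<close>

lemma excisive_subcomplexes:
  assumes F: "\<And>A. A \<in> F \<Longrightarrow> subcomplex T E A"
  shows "excisive_cover (subtopology T (\<Union>F)) F"
  unfolding excisive_cover_def
proof (intro allI impI)
  let ?X = "subtopology T (\<Union>F)"
  fix n and c :: "'a chain"
  assume c: "singular_chain n ?X c"
    and bc: "\<forall>m. n = Suc m \<longrightarrow> small_chain m ?X F (chain_boundary n c)"
  let ?K = "\<Union>f\<in>Poly_Mapping.keys c. f ` standard_simplex n"
  have K: "compactin T (f ` standard_simplex n)" "f ` standard_simplex n \<subseteq> \<Union>F"
    if "f \<in> Poly_Mapping.keys c" for f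
  proof -
    have "singular_simplex n ?X f"
      using c that by (auto simp: singular_chain_def)
    then have f: "singular_simplex n T f" "f ` standard_simplex n \<subseteq> \<Union>F"
      by (simp_all only: singular_simplex_subtopology)
    show "f ` standard_simplex n \<subseteq> \<Union>F" by (rule f(2))
    have "compactin (subtopology (powertop_real UNIV) (standard_simplex n)) (standard_simplex n)"
      by (simp add: compactin_subtopology compactin_standard_simplex)
    then show "compactin T (f ` standard_simplex n)"
      by (rule image_compactin) (use f(1) in \<open>simp add: singular_simplex_def\<close>)
  qed
  have "compactin T ?K"
    by (intro compactin_Union) (auto simp: K)
  then obtain D where D: "finite D" "closed_family D" "?K \<subseteq> \<Union>D"
    using compact_in_finite_family by blast
  \<comment> \<open>The trace of a member: as members are unions of cells, the cells of
    \<open>D\<close> inside \<open>A\<close> fill all of \<open>A\<close> within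
    \<open>D\<close>.\<close>
  define cellsof where "cellsof A = {e \<in> D. e \<subseteq> A}" for A
  have DE: "D \<subseteq> E" using D(2) by (simp add: closed_family_def)
  have cells_eq: "\<Union>(cellsof A) = A \<inter> \<Union>D" if AF: "A \<in> F" for A
  proof -
    obtain C where C: "C \<subseteq> E" "A = \<Union>C" using F [OF AF] by (auto simp: subcomplex_def)
    have "x \<in> \<Union>(cellsof A)" if x: "x \<in> A" "x \<in> e" "e \<in> D" for x e
    proof -
      obtain e' where "e' \<in> C" "x \<in> e'" using x C by blast
      then have "e' = e" using cell_unique [of e' e x] x C DE by blast
      then show ?thesis using \<open>e' \<in> C\<close> x C by (auto simp: cellsof_def)
    qed
    then show ?thesis by (auto simp: cellsof_def)
  qed
  have cells_closed: "closed_family (cellsof A)" if "A \<in> F" for A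
    unfolding closed_family_def
  proof (intro conjI ballI)
    show "cellsof A \<subseteq> E" using DE by (auto simp: cellsof_def)
    fix e assume e: "e \<in> cellsof A"
    then have "e \<in> D" "e \<subseteq> A" by (auto simp: cellsof_def)
    have "T closure_of e \<subseteq> A"
      using F [OF that] \<open>e \<subseteq> A\<close> by (intro closure_of_minimal) (auto simp: subcomplex_def)
    then have "cell_boundary e \<subseteq> A"
      using cell_boundary_subset_closure [of e] \<open>e \<in> D\<close> DE by blast
    moreover have "cell_boundary e \<subseteq> \<Union>D"
      using D(2) \<open>e \<in> D\<close> by (auto simp: closed_family_def)
    ultimately show "cell_boundary e \<subseteq> \<Union>(cellsof A)"
      using cells_eq [OF that] by simp
  qed
  \<comment> \<open>Only cells inside some member are kept, so that the traces cover the finite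
    subcomplex.\<close>
  define D0 where "D0 = \<Union>(cellsof ` F)"
  have D0: "finite D0" "closed_family D0"
    using D(1) cells_closed finite_subset [of D0 D]
    by (auto simp: D0_def cellsof_def intro!: closed_family_Union)
  have D0_eq: "\<Union>D0 = \<Union>F \<inter> \<Union>D"
    using cells_eq unfolding D0_def by blast
  obtain h where h: "collar_homotopy D0 h"
    using collar_homotopy_exists [OF D0] by blast
  have sub: "cellsof A \<subseteq> D0" if "A \<in> F" for A
    using that by (auto simp: D0_def)
  let ?Y = "subtopology T (\<Union>D0)" and ?\<U> = "(\<lambda>A. \<Union>(cellsof A)) ` F"
  have tY: "topspace ?Y = \<Union>D0"
    using closedin_subset [OF closedin_closed_family [OF D0]] by auto
  have nbd: "\<exists>V. openin ?Y V \<and> U \<subseteq> V \<and> (\<forall>x\<in>V. h (1, x) \<in> U)" if "U \<in> ?\<U>" for U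
    using that collar_homotopyD(4) [OF h sub cells_closed] by auto
  then obtain V where V: "\<And>U. U \<in> ?\<U> \<Longrightarrow> openin ?Y (V U) \<and> U \<subseteq> V U \<and> (\<forall>x\<in>V U. h (1, x) \<in> U)"
    by metis
  have "excisive_cover ?Y ?\<U>"
  proof (rule excisive_by_homotopy [where h = h and V = V])
    show "continuous_map (cylinder ?Y) ?Y h"
      by (rule collar_homotopyD(1) [OF h])
    show "h (0, x) = x" if "x \<in> topspace ?Y" for x
      using collar_homotopyD(2) [OF h] that tY by simp
    show "topspace ?Y \<subseteq> \<Union>?\<U>"
      unfolding tY by (auto simp: D0_def)
    show "h (t, x) \<in> U" if U: "U \<in> ?\<U>" and tx: "t \<in> {0..1}" "x \<in> U" for U t x
    proof -
      obtain A where A: "A \<in> F" "U = \<Union>(cellsof A)" using U by blast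
      show ?thesis
        using collar_homotopyD(3) [OF h sub [OF A(1)] cells_closed [OF A(1)]] tx unfolding A(2) .
    qed
  qed (use V in auto)
  \<comment> \<open>For simplices within \<open>D\<close>, smallness for the traces and smallness
    for the members agree; this carries the boundary hypothesis in and the conclusion out.\<close>
  moreover have restr: "singular_simplex q (subtopology ?Y (\<Union>(cellsof A))) f \<longleftrightarrow>
      singular_simplex q (subtopology ?X A) f \<and> f ` standard_simplex q \<subseteq> \<Union>D" if "A \<in> F" for q A f
    using that cells_eq [OF that] D0_eq by (auto simp: singular_simplex_subtopology)
  have c_Y: "singular_chain n ?Y c"
    using c D(3) D0_eq K(2) by (fastforce simp: singular_chain_def singular_simplex_subtopology)
  moreover have "small_chain m ?Y ?\<U> (chain_boundary n c)" if "n = Suc m" for m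
  proof -
    have "singular_chain m ?Y (chain_boundary n c)"
      using singular_chain_boundary_alt c_Y that by blast
    then have "Poly_Mapping.keys (chain_boundary n c) \<subseteq> singular_simplex_set m ?Y"
      by (simp add: singular_chain_def)
    moreover have "Poly_Mapping.keys (chain_boundary n c) \<subseteq> {\<sigma>. \<exists>A\<in>F. singular_simplex m (subtopology ?X A) \<sigma>}"
      using bc that by (simp add: small_chain_def)
    ultimately have k: "singular_simplex m ?Y \<sigma>" "\<exists>A\<in>F. singular_simplex m (subtopology ?X A) \<sigma>"
      if "\<sigma> \<in> Poly_Mapping.keys (chain_boundary n c)" for \<sigma>
      using that by blast+
    show ?thesis
      unfolding small_chain_def
    proof
      fix \<sigma> assume \<sigma>: "\<sigma> \<in> Poly_Mapping.keys (chain_boundary n c)"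
      obtain A where A: "A \<in> F" "singular_simplex m (subtopology ?X A) \<sigma>"
        using k(2) [OF \<sigma>] by blast
      have "\<sigma> ` standard_simplex m \<subseteq> \<Union>D"
        using k(1) [OF \<sigma>] D0_eq by (simp add: singular_simplex_subtopology)
      then have "singular_simplex m (subtopology ?Y (\<Union>(cellsof A))) \<sigma>"
        using restr [OF A(1)] A(2) by simp
      then show "\<sigma> \<in> {\<sigma>. \<exists>V\<in>?\<U>. singular_simplex m (subtopology ?Y V) \<sigma>}"
        using A(1) by blast
    qed
  qed
  ultimately obtain d where d: "singular_chain (Suc n) ?Y d"
      "small_chain n ?Y ?\<U> (c - chain_boundary (Suc n) d)"
    unfolding excisive_cover_def by blast
  have "singular_chain (Suc n) ?X d"
    by (rule singular_chain_mono [OF d(1)]) (simp add: D0_eq)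
  moreover have "small_chain n ?X F (c - chain_boundary (Suc n) d)"
    using d(2) restr unfolding small_chain_def by blast
  ultimately show "\<exists>d. singular_chain (Suc n) ?X d \<and> small_chain n ?X F (c - chain_boundary (Suc n) d)"
    by blast
qed

end

lemma cw_complex_imp_structure:
  assumes "cw_complex T E cdim"
  obtains \<phi> where "cw_structure T E cdim \<phi>"
proof -
  have "\<forall>e\<in>E. \<exists>\<phi>. characteristic_map T (cdim e) e \<phi> \<and>
       (\<exists>C\<subseteq>E. finite C \<and> (\<forall>c\<in>C. cdim c < cdim e) \<and>
          \<phi> ` topspace (unit_sphere (cdim e)) \<subseteq> \<Union>C)"
    using assms by (simp add: cw_complex_def)
  then obtain \<phi> where "\<forall>e\<in>E. characteristic_map T (cdim e) e (\<phi> e) \<and>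
       (\<exists>C\<subseteq>E. finite C \<and> (\<forall>c\<in>C. cdim c < cdim e) \<and>
          \<phi> e ` topspace (unit_sphere (cdim e)) \<subseteq> \<Union>C)"
    by metis
  then have "cw_structure T E cdim \<phi>"
    using assms unfolding cw_structure_def cw_complex_def by simp
  then show thesis by (rule that)
qed

section \<open>Open stars in the geometric realization\<close>

definition support :: "('v \<Rightarrow> real) \<Rightarrow> 'v set" where
  "support x = {v. x v \<noteq> 0}"

definition open_star :: "'v set set \<Rightarrow> 'v \<Rightarrow> ('v \<Rightarrow> real) set" where
  "open_star K v = {x \<in> topspace (geometric_realization K). 0 < x v}"

definition barycenter :: "'v set \<Rightarrow> 'v \<Rightarrow> real" where
  "barycenter \<sigma> = (\<lambda>v. if v \<in> \<sigma> then 1 / real (card \<sigma>) else 0)"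

lemma barycenter_in: "\<lbrakk>finite \<sigma>; \<sigma> \<noteq> {}; \<sigma> \<subseteq> \<tau>; finite \<tau>\<rbrakk> \<Longrightarrow> barycenter \<sigma> \<in> geometric_simplex \<tau>"
proof -
  assume \<sigma>: "finite \<sigma>" "\<sigma> \<noteq> {}" "\<sigma> \<subseteq> \<tau>" "finite \<tau>"
  have "(\<Sum>v\<in>\<tau>. barycenter \<sigma> v) = (\<Sum>v\<in>\<sigma>. barycenter \<sigma> v)"
    using \<sigma> by (intro sum.mono_neutral_right) (auto simp: barycenter_def)
  also have "\<dots> = 1"
    using \<sigma> by (simp add: barycenter_def)
  finally show ?thesis
    using \<sigma> by (auto simp: geometric_simplex_def barycenter_def)
qed

lemma vertices_subset:
  assumes x: "x \<in> geometric_simplex \<tau>" and pos: "\<And>v. v \<in> \<sigma> \<Longrightarrow> 0 < x v"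
  shows "\<sigma> \<subseteq> \<tau>"
proof
  fix v assume "v \<in> \<sigma>"
  then have "x v \<noteq> 0" using pos [of v] by simp
  then show "v \<in> \<tau>" using x unfolding geometric_simplex_def by blast
qed

lemma geometric_simplex_convex:
  assumes "x \<in> geometric_simplex \<sigma>" "y \<in> geometric_simplex \<sigma>" "0 \<le> t" "t \<le> 1"
  shows "(\<lambda>v. (1 - t) * x v + t * y v) \<in> geometric_simplex \<sigma>"
  using assms by (auto simp: geometric_simplex_def sum.distrib simp flip: sum_distrib_left)

lemma closedin_geometric_simplex: "closedin (powertop_real UNIV) (geometric_simplex \<sigma>)" for \<sigma> :: "'v set"
proof -
  let ?P = "powertop_real (UNIV :: 'v set)"
  have proj: "continuous_map ?P euclideanreal (\<lambda>x. x v)" for v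
    by (intro continuous_map_product_projection) auto
  have cl: "closedin ?P {x \<in> topspace ?P. x v \<in> C}" if "closed C" for v C
    by (rule closedin_continuous_map_preimage [OF proj]) (use that in simp)
  have "closedin ?P {x \<in> topspace ?P. sum x \<sigma> \<in> {1}}"
  proof (rule closedin_continuous_map_preimage)
    show "continuous_map ?P euclideanreal (\<lambda>x. sum x \<sigma>)"
    proof (cases "finite \<sigma>")
      case True
      then show ?thesis by (intro continuous_map_sum proj) auto
    qed simp
  qed simp
  moreover have "geometric_simplex \<sigma> = (\<Inter>v. {x \<in> topspace ?P. x v \<in> (if v \<in> \<sigma> then {0..} else {0})}) \<inter>
      {x \<in> topspace ?P. sum x \<sigma> \<in> {1}}"
    by (auto simp: geometric_simplex_def split: if_split_asm) (metis order_refl)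
  moreover have "closedin ?P (\<Inter>v. {x \<in> topspace ?P. x v \<in> (if v \<in> \<sigma> then {0..} else {0})})"
    by (intro closedin_INT cl) auto
  ultimately show ?thesis
    by (simp only: closedin_Int)
qed

text \<open>Simplices are closed in the product space, so the weak topology can be tested by closed
  sets of the product instead of open sets of each simplex.\<close>

lemma closedin_realizationD:
  assumes "closedin (geometric_realization K) C" "\<sigma> \<in> K"
  shows "closedin (powertop_real UNIV) (C \<inter> geometric_simplex \<sigma>)"
proof -
  let ?P = "subtopology (powertop_real UNIV) (geometric_simplex \<sigma>)"
  have "openin ?P ((topspace (geometric_realization K) - C) \<inter> geometric_simplex \<sigma>)"
    using openin_diff [OF openin_topspace assms(1)] assms(2)
    unfolding openin_geometric_realization [of K "_ - _"] by blast
  moreover have "topspace ?P - (topspace (geometric_realization K) - C) \<inter> geometric_simplex \<sigma>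
      = C \<inter> geometric_simplex \<sigma>"
    using assms(2) closedin_subset [OF assms(1)] by (auto simp: topspace_geometric_realization)
  ultimately have "closedin ?P (C \<inter> geometric_simplex \<sigma>)"
    by (metis closedin_diff closedin_topspace)
  then show ?thesis
    by (rule closedin_trans_full [OF _ closedin_geometric_simplex])
qed

lemma closedin_realizationI:
  assumes "C \<subseteq> topspace (geometric_realization K)"
    and "\<And>\<sigma>. \<sigma> \<in> K \<Longrightarrow> closedin (powertop_real UNIV) (C \<inter> geometric_simplex \<sigma>)"
  shows "closedin (geometric_realization K) C"
proof -
  have "openin (geometric_realization K) (topspace (geometric_realization K) - C)"
    unfolding openin_geometric_realization
  proof (intro conjI ballI)
    show "topspace (geometric_realization K) - C \<subseteq> \<Union> (geometric_simplex ` K)"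
      by (auto simp: topspace_geometric_realization)
    fix \<sigma> assume \<sigma>: "\<sigma> \<in> K"
    let ?P = "subtopology (powertop_real UNIV) (geometric_simplex \<sigma>)"
    have "closedin ?P (C \<inter> geometric_simplex \<sigma>)"
      using assms(2) [OF \<sigma>] by (intro closedin_subset_topspace) auto
    then have "openin ?P (topspace ?P - C \<inter> geometric_simplex \<sigma>)"
      by blast
    moreover have "topspace ?P - C \<inter> geometric_simplex \<sigma> = (topspace (geometric_realization K) - C) \<inter> geometric_simplex \<sigma>"
      using \<sigma> by (auto simp: topspace_geometric_realization)
    ultimately show "openin ?P ((topspace (geometric_realization K) - C) \<inter> geometric_simplex \<sigma>)"
      by simp
  qed
  then show ?thesis
    using assms(1) by (simp add: closedin_def)
qed

lemma continuous_map_realization_coordinates: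
  fixes K :: "'v set set"
  shows "continuous_map (geometric_realization K) (powertop_real UNIV) (\<lambda>x. x)"
  unfolding continuous_map_def
proof (intro conjI allI impI)
  fix U :: "('v \<Rightarrow> real) set" assume U: "openin (powertop_real UNIV) U"
  show "openin (geometric_realization K) {x \<in> topspace (geometric_realization K). x \<in> U}"
  proof -
    let ?U = "{x \<in> topspace (geometric_realization K). x \<in> U}"
    have "openin (subtopology (powertop_real UNIV) (geometric_simplex \<sigma>)) (?U \<inter> geometric_simplex \<sigma>)"
      if "\<sigma> \<in> K" for \<sigma>
    proof -
      have "?U \<inter> geometric_simplex \<sigma> = U \<inter> geometric_simplex \<sigma>"
        using that by (auto simp: topspace_geometric_realization)
      then show ?thesis
        using U by (auto simp: openin_subtopology)
    qed
    then show ?thesis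
      unfolding openin_geometric_realization by (auto simp: topspace_geometric_realization)
  qed
qed auto

text \<open>With finitely many simplices involved, the preimage of a closed set is a finite union of
  closed sets. In general the weak topology is too fine for coordinatewise continuity to
  suffice.\<close>

lemma continuous_map_into_realization:
  assumes g: "continuous_map X (powertop_real UNIV) g" and M: "finite M" "M \<subseteq> K"
    and im: "\<And>x. x \<in> topspace X \<Longrightarrow> \<exists>\<tau>\<in>M. g x \<in> geometric_simplex \<tau>"
  shows "continuous_map X (geometric_realization K) g"
  unfolding continuous_map_closedin
proof (intro conjI allI impI ballI)
  show "g \<in> topspace X \<rightarrow> topspace (geometric_realization K)"
    using im M by (fastforce simp: topspace_geometric_realization)
  fix C assume C: "closedin (geometric_realization K) C"
  have "closedin X (\<Union>\<tau>\<in>M. {x \<in> topspace X. g x \<in> C \<inter> geometric_simplex \<tau>})"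
  proof (rule closedin_Union)
    have "closedin X {x \<in> topspace X. g x \<in> C \<inter> geometric_simplex \<tau>}" if "\<tau> \<in> M" for \<tau>
      by (rule closedin_continuous_map_preimage [OF g closedin_realizationD [OF C]]) (use M that in blast)
    then show "closedin X S" if "S \<in> (\<lambda>\<tau>. {x \<in> topspace X. g x \<in> C \<inter> geometric_simplex \<tau>}) ` M" for S
      using that by blast
  qed (use M in simp)
  moreover have "(\<Union>\<tau>\<in>M. {x \<in> topspace X. g x \<in> C \<inter> geometric_simplex \<tau>}) = {x \<in> topspace X. g x \<in> C}"
    using im by fast
  ultimately show "closedin X {x \<in> topspace X. g x \<in> C}"
    by simp
qed

section \<open>Carriers and vertex stars in a simplicial complex\<close>

locale simplicial_complex =
  fixes K :: "'v set set"
  assumes finite_simplex: "\<sigma> \<in> K \<Longrightarrow> finite \<sigma>"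
    and subsimplex: "\<lbrakk>\<sigma> \<in> K; \<tau> \<subseteq> \<sigma>; \<tau> \<noteq> {}\<rbrakk> \<Longrightarrow> \<tau> \<in> K"
begin

text \<open>The support is the carrier of the point, its smallest simplex; it is nonempty because
  the coordinates add up to 1.\<close>

lemma support_simplex:
  assumes "x \<in> geometric_simplex \<sigma>" "\<sigma> \<in> K"
  shows "support x \<in> K" "support x \<subseteq> \<sigma>" "x \<in> geometric_simplex (support x)"
proof -
  show sub: "support x \<subseteq> \<sigma>"
    using assms by (auto simp: support_def geometric_simplex_def)
  have ne: "support x \<noteq> {}"
  proof
    assume "support x = {}"
    then have "sum x \<sigma> = 0" by (auto simp: support_def)
    then show False using assms by (simp add: geometric_simplex_def)
  qed
  show "support x \<in> K" by (rule subsimplex [OF assms(2) sub ne])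
  have "sum x (support x) = sum x \<sigma>"
    using finite_simplex [OF assms(2)] sub by (intro sum.mono_neutral_left) (auto simp: support_def)
  then show "x \<in> geometric_simplex (support x)"
    using assms by (auto simp: geometric_simplex_def support_def)
qed

text \<open>Pick one point per carrier. A simplex has finitely many faces, so it contains finitely
  many picked points, and every set of them is closed in the weak topology.\<close>

lemma compact_in_finite_subcomplex:
  assumes C: "compactin (geometric_realization K) C"
  obtains M where "finite M" "M \<subseteq> K" "\<And>x. x \<in> C \<Longrightarrow> \<exists>\<tau>\<in>M. x \<in> geometric_simplex \<tau>"
proof -
  let ?R = "geometric_realization K"
  have CR: "C \<subseteq> topspace ?R" by (rule compactin_subset_topspace [OF C])
  have supp: "support x \<in> K" "x \<in> geometric_simplex (support x)" if "x \<in> C" for x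
    using that CR support_simplex by (auto simp: topspace_geometric_realization)
  have "\<forall>\<tau>\<in>support ` C. \<exists>x. x \<in> C \<and> support x = \<tau>" by blast
  then obtain p where p: "\<And>\<tau>. \<tau> \<in> support ` C \<Longrightarrow> p \<tau> \<in> C \<and> support (p \<tau>) = \<tau>" by metis
  have "finite (p ` support ` C)"
  proof (rule compact_discrete_finite [OF C])
    show "p ` support ` C \<subseteq> C" using p by blast
    fix A assume A: "A \<subseteq> p ` support ` C"
    show "closedin ?R A"
    proof (rule closedin_realizationI)
      show "A \<subseteq> topspace ?R" using A p CR by blast
      fix \<sigma> assume \<sigma>: "\<sigma> \<in> K"
      have "A \<inter> geometric_simplex \<sigma> \<subseteq> p ` Pow \<sigma>"
      proof
        fix x assume x: "x \<in> A \<inter> geometric_simplex \<sigma>"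
        then obtain \<tau> where \<tau>: "\<tau> \<in> support ` C" "x = p \<tau>" using A by blast
        then have "\<tau> \<subseteq> \<sigma>" using p [OF \<tau>(1)] support_simplex(2) [OF _ \<sigma>, of x] x by simp
        then show "x \<in> p ` Pow \<sigma>" using \<tau> by blast
      qed
      then have "finite (A \<inter> geometric_simplex \<sigma>)"
        by (rule finite_subset) (simp add: finite_simplex [OF \<sigma>])
      then show "closedin (powertop_real UNIV) (A \<inter> geometric_simplex \<sigma>)"
        by (intro closedin_Hausdorff_finite) (auto simp: Hausdorff_space_product_topology)
    qed
  qed
  moreover have "inj_on p (support ` C)"
    by (rule inj_on_inverseI [of _ support]) (simp add: p)
  ultimately have "finite (support ` C)"
    using finite_imageD by blast
  then show thesis
    using supp by (intro that [of "support ` C"]) auto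
qed

lemma openin_open_star: "openin (geometric_realization K) (open_star K v)"
proof -
  have "continuous_map (geometric_realization K) euclideanreal (\<lambda>x. x v)"
    using continuous_map_compose [OF continuous_map_realization_coordinates [of K] continuous_map_product_projection [of v]]
    by (simp add: o_def)
  then have "openin (geometric_realization K) {x \<in> topspace (geometric_realization K). x v \<in> {0<..}}"
    by (rule openin_continuous_map_preimage) simp
  then show ?thesis
    by (simp add: open_star_def)
qed

lemma topspace_realization_subset_stars:
  assumes "x \<in> topspace (geometric_realization K)"
  obtains v where "{v} \<in> K" "x \<in> open_star K v"
proof -
  obtain \<sigma> where \<sigma>: "\<sigma> \<in> K" "x \<in> geometric_simplex \<sigma>"
    using assms by (auto simp: topspace_geometric_realization)
  have "\<exists>v\<in>\<sigma>. x v \<noteq> 0"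
  proof (rule ccontr)
    assume "\<not> ?thesis"
    then have "sum x \<sigma> = 0" by simp
    then show False using \<sigma> by (simp add: geometric_simplex_def)
  qed
  then obtain v where v: "v \<in> \<sigma>" "x v \<noteq> 0" by blast
  have "0 \<le> x v" using \<sigma> by (simp add: geometric_simplex_def)
  then have "x \<in> open_star K v"
    using assms v by (simp add: open_star_def less_le)
  then show thesis
    using subsimplex [OF \<sigma>(1), of "{v}"] v by (intro that) auto
qed

text \<open>If all coordinates in \<open>\<sigma>\<close> are positive, any simplex containing the
  point contains \<open>\<sigma>\<close>; conversely the barycenter lies in each of the stars. So
  the star cover has the complex as its nerve.\<close>

lemma open_stars_meet_iff:
  assumes "finite \<sigma>" "\<sigma> \<noteq> {}"
  shows "topspace (geometric_realization K) \<inter> (\<Inter>v\<in>\<sigma>. open_star K v) \<noteq> {} \<longleftrightarrow> \<sigma> \<in> K"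
proof
  assume "topspace (geometric_realization K) \<inter> (\<Inter>v\<in>\<sigma>. open_star K v) \<noteq> {}"
  then obtain x \<tau> where x: "\<tau> \<in> K" "x \<in> geometric_simplex \<tau>" "\<And>v. v \<in> \<sigma> \<Longrightarrow> 0 < x v"
    by (auto simp: topspace_geometric_realization open_star_def)
  have "\<sigma> \<subseteq> \<tau>"
    by (rule vertices_subset [OF x(2,3)])
  then show "\<sigma> \<in> K" by (rule subsimplex [OF x(1) _ assms(2)])
next
  assume \<sigma>: "\<sigma> \<in> K"
  have b: "barycenter \<sigma> \<in> topspace (geometric_realization K)"
    using barycenter_in [OF assms order_refl assms(1)] \<sigma> by (auto simp: topspace_geometric_realization)
  then have "barycenter \<sigma> \<in> open_star K v" if "v \<in> \<sigma>" for v
    using that assms by (auto simp: open_star_def barycenter_def card_gt_0_iff)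
  then show "topspace (geometric_realization K) \<inter> (\<Inter>v\<in>\<sigma>. open_star K v) \<noteq> {}"
    using b by blast
qed

text \<open>A map from a sphere is contracted along straight lines to the barycenter. By compactness
  it stays in a finite subcomplex, where the weak topology is the Euclidean one.\<close>

lemma m_connected_open_stars:
  assumes \<sigma>: "\<sigma> \<in> K" "\<sigma> \<noteq> {}"
  shows "m_connected m (subtopology (geometric_realization K) (\<Inter>v\<in>\<sigma>. open_star K v))"
  unfolding m_connected_def
proof (intro allI impI)
  let ?R = "geometric_realization K" and ?S = "\<Inter>v\<in>\<sigma>. open_star K v"
  fix d :: nat and f assume f: "continuous_map (unit_sphere d) (subtopology ?R ?S) f"
  let ?b = "barycenter \<sigma>"
  have fin: "finite \<sigma>" by (rule finite_simplex [OF \<sigma>(1)])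
  have fR: "continuous_map (unit_sphere d) ?R f" and fS: "\<And>w. w \<in> topspace (unit_sphere d) \<Longrightarrow> f w \<in> ?S"
    using f by (auto simp: continuous_map_in_subtopology)
  have f_coord: "continuous_map (unit_sphere d) (powertop_real UNIV) f"
    using continuous_map_compose [OF fR continuous_map_realization_coordinates] by (simp add: o_def)
  have "closedin (unit_ball d) {z \<in> topspace (unit_ball d). enorm d z \<in> {1}}"
    by (rule closedin_continuous_map_preimage [OF continuous_map_enorm_ball]) simp
  moreover have "{z \<in> topspace (unit_ball d). enorm d z \<in> {1}} = topspace (unit_sphere d)"
    by (auto simp: topspace_unit_ball topspace_unit_sphere)
  ultimately have "compactin (unit_ball d) (topspace (unit_sphere d))"
    using closedin_compact_space [OF compact_unit_ball] by metis
  then have "compact_space (unit_sphere d)"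
    by (subst unit_sphere_eq_subtopology) (simp add: compact_space_subtopology)
  then have "compactin ?R (f ` topspace (unit_sphere d))"
    using image_compactin [OF _ fR] by (simp add: compact_space_def)
  then obtain M where M: "finite M" "M \<subseteq> K" "\<And>x. x \<in> f ` topspace (unit_sphere d) \<Longrightarrow> \<exists>\<tau>\<in>M. x \<in> geometric_simplex \<tau>"
    by (rule compact_in_finite_subcomplex) blast
  \<comment> \<open>Constant up to radius 1/2; beyond it the parameter
    \<open>2 * enorm d z - 1\<close> runs from 0 to 1. The constant core avoids dividing by the norm
    at the centre.\<close>
  define g where "g z = (if enorm d z \<le> 1/2 then ?b
      else (\<lambda>v. (1 - (2 * enorm d z - 1)) * ?b v + (2 * enorm d z - 1) * f (escale (1 / enorm d z) z) v))" for z
  note n = continuous_map_enorm_ball [of d]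
  have g_in: "\<exists>\<tau>\<in>insert \<sigma> M. g z \<in> geometric_simplex \<tau>" and g_pos: "\<And>v. v \<in> \<sigma> \<Longrightarrow> 0 < g z v"
    if z: "z \<in> topspace (unit_ball d)" for z
  proof -
    have b_pos: "0 < ?b v" if "v \<in> \<sigma>" for v
      using that fin by (auto simp: barycenter_def card_gt_0_iff)
    have "(\<exists>\<tau>\<in>insert \<sigma> M. g z \<in> geometric_simplex \<tau>) \<and> (\<forall>v\<in>\<sigma>. 0 < g z v)"
    proof (cases "enorm d z \<le> 1/2")
      case True
      then show ?thesis
        using barycenter_in [OF fin \<sigma>(2) order_refl fin] b_pos by (simp add: g_def)
    next
      case False
      let ?w = "escale (1 / enorm d z) z" and ?t = "2 * enorm d z - 1"
      have w: "?w \<in> topspace (unit_sphere d)" using escale_unit_sphere [OF z] False by simp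
      have t: "0 \<le> ?t" "?t \<le> 1" using False z by (auto simp: topspace_unit_ball)
      obtain \<tau> where \<tau>: "\<tau> \<in> M" "f ?w \<in> geometric_simplex \<tau>" using M(3) w by blast
      have pos: "0 < f ?w v" if "v \<in> \<sigma>" for v
        using fS [OF w] that by (auto simp: open_star_def)
      \<comment> \<open>Containing \<open>\<sigma>\<close>, the simplex \<open>\<tau>\<close> also
        contains the barycenter, and by convexity the whole segment.\<close>
      have "\<sigma> \<subseteq> \<tau>"
        by (rule vertices_subset [OF \<tau>(2) pos])
      then have b: "?b \<in> geometric_simplex \<tau>"
        using barycenter_in [OF fin \<sigma>(2)] finite_simplex M(2) \<tau>(1) by blast
      have gz: "g z = (\<lambda>v. (1 - ?t) * ?b v + ?t * f ?w v)"
        using False by (simp add: g_def)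
      have "g z \<in> geometric_simplex \<tau>"
        unfolding gz by (rule geometric_simplex_convex [OF b \<tau>(2) t])
      moreover have "0 < g z v" if "v \<in> \<sigma>" for v
      proof (cases "?t = 1")
        case True
        then show ?thesis using pos [OF that] unfolding gz by simp
      next
        case False
        then have "0 < (1 - ?t) * ?b v" using t b_pos [OF that] by simp
        then show ?thesis using t pos [OF that] unfolding gz by (simp add: add_pos_nonneg)
      qed
      ultimately show ?thesis using \<tau>(1) by blast
    qed
    then show "\<exists>\<tau>\<in>insert \<sigma> M. g z \<in> geometric_simplex \<tau>" "\<And>v. v \<in> \<sigma> \<Longrightarrow> 0 < g z v" by blast+
  qed
  have "continuous_map (unit_ball d) (powertop_real UNIV) g"
    unfolding g_def
  proof (rule continuous_map_cases_le)
    let ?B = "subtopology (unit_ball d) {z \<in> topspace (unit_ball d). 1/2 \<le> enorm d z}"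
    have nB: "continuous_map ?B euclideanreal (enorm d)"
      by (rule continuous_map_from_subtopology [OF n])
    have "continuous_map ?B (unit_sphere d) (\<lambda>z. escale (1 / enorm d z) z)"
      by (rule continuous_map_radial) (auto simp: continuous_map_from_subtopology)
    then have fB: "continuous_map ?B (powertop_real UNIV) (\<lambda>z. f (escale (1 / enorm d z) z))"
      using continuous_map_compose [OF _ f_coord] by (fastforce simp: o_def)
    show "continuous_map ?B (powertop_real UNIV)
      (\<lambda>z v. (1 - (2 * enorm d z - 1)) * ?b v + (2 * enorm d z - 1) * f (escale (1 / enorm d z) z) v)"
      unfolding continuous_map_componentwise_UNIV
    proof
      fix v
      have "continuous_map ?B euclideanreal (\<lambda>z. f (escale (1 / enorm d z) z) v)"
        using fB by (simp add: continuous_map_componentwise_UNIV)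
      then show "continuous_map ?B euclideanreal
         (\<lambda>z. (1 - (2 * enorm d z - 1)) * ?b v + (2 * enorm d z - 1) * f (escale (1 / enorm d z) z) v)"
        by (intro continuous_map_add continuous_map_real_mult continuous_map_diff nB) auto
    qed
  next
    fix z assume "enorm d z = 1/2"
    then have e: "2 * enorm d z = 1" by simp
    show "?b = (\<lambda>v. (1 - (2 * enorm d z - 1)) * ?b v + (2 * enorm d z - 1) * f (escale (1 / enorm d z) z) v)"
      by (simp only: e) simp
  qed (use n in auto)
  then have "continuous_map (unit_ball d) ?R g"
    using M \<sigma> g_in by (intro continuous_map_into_realization [where M = "insert \<sigma> M"]) auto
  moreover have "g z \<in> ?S" if z: "z \<in> topspace (unit_ball d)" for z
    using g_in [OF z] g_pos [OF z] M(2) \<sigma>(1) by (auto simp: open_star_def topspace_geometric_realization)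
  ultimately have "continuous_map (unit_ball d) (subtopology ?R ?S) g"
    by (auto simp: continuous_map_in_subtopology)
  moreover have "g w = f w" if "w \<in> topspace (unit_sphere d)" for w
    using that by (simp add: g_def topspace_unit_sphere)
  ultimately show "\<exists>g. continuous_map (unit_ball d) (subtopology ?R ?S) g \<and>
      (\<forall>x\<in>topspace (unit_sphere d). g x = f x)"
    by blast
qed

end

lemma simplicial_complex_nerve: "simplicial_complex (nerve F)"
proof
  fix \<sigma> \<tau> assume "\<sigma> \<in> nerve F" "\<tau> \<subseteq> \<sigma>" "\<tau> \<noteq> {}"
  then show "\<tau> \<in> nerve F"
    using Inter_anti_mono [of \<tau> \<sigma>] finite_subset [of \<tau> \<sigma>] by (auto simp: nerve_def)
qed (simp add: nerve_def)

section \<open>The nerve theorem\<close>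

text \<open>In negative degrees every homology group is the singleton group on
  \<open>undefined\<close>.\<close>

lemma homology_group_negative_iso:
  assumes "n < 0"
  shows "homology_group n X \<cong> homology_group n Y"
proof -
  have "(\<lambda>_. undefined) \<in> iso (homology_group n X) (homology_group n Y)"
    using assms by (auto simp: iso_def hom_def bij_betw_def relative_homology_group_def singleton_group_def)
  then show ?thesis
    by (rule is_isoI)
qed

lemma m_connected_mono: "\<lbrakk>m_connected m Y; m' \<le> m\<rbrakk> \<Longrightarrow> m_connected m' Y"
  unfolding m_connected_def by (meson order_trans)

text \<open>Joins the algebra to the topology: connectivity gives cones for lists of length at most
  \<open>k + 1\<close>, where the required degree is nonnegative, and excision replaces small chains
  by all chains.\<close>

proposition nerve_correspondence:
  assumes exc: "excisive_cover X (U ` I)"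
    and conn: "\<And>s. \<lbrakk>s \<in> ordered_nerve X I U; length s \<le> Suc k\<rbrakk> \<Longrightarrow>
      m_connected (int k + 1 - int (length s)) (subtopology X (\<Inter>i\<in>set s. U i))"
    and "n \<le> k"
  shows "\<exists>R. homology_correspondence
      (nerve_cycles X I U n) (nerve_boundaries X I U n)
      (singular_relcycle_set n X {}) (singular_relboundary_set n X {}) R"
proof -
  have "\<exists>b K. cone_operator (int k + 1 - int (length s)) (subtopology X (\<Inter>i\<in>set s. U i)) b K"
    if "s \<in> ordered_nerve X I U" "length s \<le> Suc k" for s
    using that by (intro m_connected_imp_cone_operator conn) auto
  then obtain R where R: "homology_correspondence
      (nerve_cycles X I U n) (nerve_boundaries X I U n)
      (small_cycles n X (U ` I)) (small_boundaries n X (U ` I)) R"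
    using nerve_small_chains_correspondence [OF _ \<open>n \<le> k\<close>] by blast
  obtain S where S: "homology_correspondence
      (small_cycles n X (U ` I)) (small_boundaries n X (U ` I))
      (singular_relcycle_set n X {}) (singular_relboundary_set n X {}) S"
    using excisive_cover_correspondence [OF exc] by blast
  show ?thesis
    using homology_correspondence_comp [OF R S] by (rule exI)
qed

text \<open>The cover of the union by \<open>F\<close> and the cover of the realization by stars
  have identical ordered nerves, so the nerve chains cancel between the two correspondences.\<close>

theorem theorem8:
  fixes T :: "'a topology" and F :: "'a set set" and k n :: int
  assumes "0 \<le> k"
    and "(\<forall>U\<in>F. openin T U) \<or>
         (finite F \<and> (\<exists>E cdim. cw_complex T E cdim \<and> (\<forall>A\<in>F. subcomplex T E A)))"
    and "\<And>G. \<lbrakk>G \<subseteq> F; G \<noteq> {}; finite G\<rbrakk> \<Longrightarrow>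
           \<Inter>G = {} \<or> m_connected (k - int (card G) + 1) (subtopology T (\<Inter>G))"
    and "n \<le> k"
  shows "homology_group n (subtopology T (\<Union>F)) \<cong>
         homology_group n (geometric_realization (nerve F))"
proof (cases "n < 0")
  case True
  then show ?thesis
    by (rule homology_group_negative_iso)
next
  case False
  obtain k' n' where k': "k = int k'" and n': "n = int n'"
    using assms(1) False by (metis not_less zero_le_imp_eq_int)
  have "n' \<le> k'" using assms(4) k' n' by simp
  let ?X = "subtopology T (\<Union>F)" and ?N = "geometric_realization (nerve F)" and ?St = "open_star (nerve F)"
  interpret N: simplicial_complex "nerve F" by (rule simplicial_complex_nerve)
  have FT: "A \<subseteq> topspace T" if "A \<in> F" for A
    using assms(2) that openin_subset closedin_subset unfolding subcomplex_def by metis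
  have exc_X: "excisive_cover ?X (id ` F)"
    using assms(2)
  proof
    assume "\<forall>U\<in>F. openin T U"
    then have "openin ?X U" if "U \<in> F" for U
      using that unfolding openin_subtopology by blast
    then show ?thesis
      unfolding image_id id_apply by (rule excisive_open_cover) auto
  next
    assume "finite F \<and> (\<exists>E cdim. cw_complex T E cdim \<and> (\<forall>A\<in>F. subcomplex T E A))"
    then obtain E cdim where E: "cw_complex T E cdim" "\<And>A. A \<in> F \<Longrightarrow> subcomplex T E A" by blast
    obtain \<phi> where "cw_structure T E cdim \<phi>" by (rule cw_complex_imp_structure [OF E(1)])
    then interpret cw_structure T E cdim \<phi> .
    show ?thesis
      unfolding image_id id_apply by (rule excisive_subcomplexes [OF E(2)])
  qed
  have exc_N: "excisive_cover ?N (?St ` F)"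
  proof (rule excisive_open_cover)
    show "openin ?N U" if "U \<in> ?St ` F" for U
      using that N.openin_open_star by auto
    show "topspace ?N \<subseteq> \<Union>(?St ` F)"
    proof
      fix x assume "x \<in> topspace ?N"
      then obtain v where "{v} \<in> nerve F" "x \<in> ?St v"
        by (rule N.topspace_realization_subset_stars)
      then show "x \<in> \<Union>(?St ` F)" by (auto simp: nerve_def)
    qed
  qed
  have nerve_X: "s \<in> ordered_nerve ?X F id \<longleftrightarrow> s \<noteq> [] \<and> set s \<in> nerve F" for s
  proof -
    \<comment> \<open>An intersection over a nonempty list of members already lies inside the
      union.\<close>
    have "topspace ?X \<inter> (\<Inter>i\<in>set s. id i) = \<Inter>(set s)" if s: "s \<noteq> []" "set s \<subseteq> F"
    proof -
      have "hd s \<in> set s" using s by simp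
      then have "\<Inter>(set s) \<subseteq> hd s" "hd s \<in> F" using s by blast+
      then show ?thesis using FT [of "hd s"] by auto
    qed
    then show ?thesis
      by (auto simp: ordered_nerve_def nerve_def)
  qed
  have nerve_N: "s \<in> ordered_nerve ?N F ?St \<longleftrightarrow> s \<noteq> [] \<and> set s \<in> nerve F" for s
    using N.open_stars_meet_iff [of "set s"] by (auto simp: ordered_nerve_def nerve_def)
  \<comment> \<open>Equal sets of chains, not merely isomorphic ones: the two correspondences share
    their left side.\<close>
  have cells: "nerve_cycles ?N F ?St = nerve_cycles ?X F id" "nerve_boundaries ?N F ?St = nerve_boundaries ?X F id"
    by (simp_all add: nerve_cycles_def nerve_boundaries_def nerve_cell_def nerve_X nerve_N fun_eq_iff)
  have conn_X: "m_connected (int k' + 1 - int (length s)) (subtopology ?X (\<Inter>i\<in>set s. id i))"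
    if "s \<in> ordered_nerve ?X F id" for s
  proof -
    have s: "s \<noteq> []" "set s \<in> nerve F" using that nerve_X by auto
    then have "hd s \<in> set s" "set s \<subseteq> F" by (auto simp: nerve_def)
    then have "\<Inter>(set s) \<subseteq> \<Union>F" by blast
    then have eq: "subtopology ?X (\<Inter>i\<in>set s. id i) = subtopology T (\<Inter>(set s))"
      by (simp add: subtopology_subtopology Int_absorb1)
    \<comment> \<open>Repetitions only help: \<open>card (set s)\<close> is at most
      \<open>length s\<close>, so the hypothesis gives at least the connectivity asked for.\<close>
    have "m_connected (k - int (card (set s)) + 1) (subtopology T (\<Inter>(set s)))"
      using assms(3) [of "set s"] s by (auto simp: nerve_def)
    then show ?thesis
      unfolding eq by (rule m_connected_mono) (use card_length [of s] k' in simp)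
  qed
  have conn_N: "m_connected m (subtopology ?N (\<Inter>v\<in>set s. ?St v))"
    if "s \<in> ordered_nerve ?N F ?St" for s m
    using that nerve_N by (intro N.m_connected_open_stars) auto
  obtain R where R: "homology_correspondence
      (nerve_cycles ?X F id n') (nerve_boundaries ?X F id n')
      (singular_relcycle_set n' ?X {}) (singular_relboundary_set n' ?X {}) R"
    using nerve_correspondence [OF exc_X conn_X \<open>n' \<le> k'\<close>] by blast
  obtain S where S: "homology_correspondence
      (nerve_cycles ?X F id n') (nerve_boundaries ?X F id n')
      (singular_relcycle_set n' ?N {}) (singular_relboundary_set n' ?N {}) S"
    using nerve_correspondence [OF exc_N conn_N \<open>n' \<le> k'\<close>] unfolding cells by blast
  show ?thesis
    unfolding n'
    by (rule homology_group_iso_correspondence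
        [OF homology_correspondence_comp [OF homology_correspondence_converse [OF R] S]])
qed

end
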